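(* Let $\chi$ be a primitive Dirichlet character of conductor $q$ such that $3 \mid q$, and let $L(s,\chi)=\sum_{n\ge 1}\chi(n)n^{-s}$ be its Dirichlet $L$-function. Then \[ |L(1,\chi)|\leq \tfrac 13\log q + \begin{cases} 0.368296 & \text{if } \chi \text{ is even, i.e. } \chi(-1)=1,\\ 0.838374 & \text{if } \chi \text{ is odd, i.e. } \chi(-1)=-1.\end{cases} \]
   Context: A Dirichlet character $\chi$ is even if $\chi(-1)=1$ and odd if $\chi(-1)=-1$. $L(1,\chi)$ denotes the value at $s=1$ of the (analytically continued) Dirichlet $L$-series. *)

theory Defs
  imports "HOL-Complex_Analysis.Complex_Analysis" "HOL-Number_Theory.Number_Theory"
begin

definition dirichlet_character :: "nat \<Rightarrow> (int \<Rightarrow> complex) \<Rightarrow> bool" where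
  "dirichlet_character q chi \<longleftrightarrow> q > 0 \<and>
     (\<forall>a b. chi (a * b) = chi a * chi b) \<and>
     (\<forall>a. chi (a + int q) = chi a) \<and>
     (\<forall>a. chi a \<noteq> 0 \<longleftrightarrow> coprime a (int q))"

definition induced_modulus :: "nat \<Rightarrow> (int \<Rightarrow> complex) \<Rightarrow> nat \<Rightarrow> bool" where
  "induced_modulus q chi d \<longleftrightarrow> d dvd q \<and>
     (\<forall>a. coprime a (int q) \<and> [a = 1] (mod int d) \<longrightarrow> chi a = 1)"

definition conductor :: "nat \<Rightarrow> (int \<Rightarrow> complex) \<Rightarrow> nat" where
  "conductor q chi = (LEAST d. induced_modulus q chi d)"

definition primitive_character :: "nat \<Rightarrow> (int \<Rightarrow> complex) \<Rightarrow> bool" where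
  "primitive_character q chi \<longleftrightarrow> dirichlet_character q chi \<and> conductor q chi = q"

text \<open>
  The function \<open>f\<close> continues the Dirichlet series from the half-plane \<open>Re z > 1\<close> to the
  half-plane \<open>Re z > c\<close>, which contains \<open>s\<close>. The point \<open>1\<close>, where a principal character produces
  a pole, is exempt from holomorphy unless \<open>s = 1\<close>; for \<open>s = 1\<close> the domain is the whole
  half-plane.
\<close>
definition L_continuation :: "(int \<Rightarrow> complex) \<Rightarrow> complex \<Rightarrow> (complex \<Rightarrow> complex) \<Rightarrow> bool" where
  "L_continuation chi s f \<longleftrightarrow>
     (\<exists>c. c < Re s \<and> f holomorphic_on insert s ({z. Re z > c} - {1})) \<and>
     (\<forall>z. Re z > 1 \<longrightarrow> (\<lambda>n. chi (int (Suc n)) / of_nat (Suc n) powr z) sums f z)"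

text \<open>
  The value is determined as soon as a continuation exists, see \<open>dirichlet_L_eqI\<close>. It is
  unspecified only at the pole \<open>s = 1\<close> of principal characters.
\<close>
definition dirichlet_L :: "(int \<Rightarrow> complex) \<Rightarrow> complex \<Rightarrow> complex" where
  "dirichlet_L chi s = (THE w. \<exists>f. L_continuation chi s f \<and> f s = w)"

lemma L_continuation_unique:
  assumes f: "L_continuation chi s f" and g: "L_continuation chi s g"
  shows "f s = g s"
proof -
  obtain c1 where c1: "c1 < Re s" "f holomorphic_on insert s ({z. Re z > c1} - {1})"
    using f unfolding L_continuation_def by blast
  obtain c2 where c2: "c2 < Re s" "g holomorphic_on insert s ({z. Re z > c2} - {1})"
    using g unfolding L_continuation_def by blast
  define c where "c = max c1 c2"
  define A where "A = insert s ({z. Re z > c} - {1})"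
  have eq: "f z = g z" if "Re z > 1" for z
    using f g that unfolding L_continuation_def by (meson sums_unique2)
  have A_cases: "A = {z. Re z > c} \<or> A = {z. Re z > c} - {1}"
    using c1(1) c2(1) by (auto simp: A_def c_def)
  have op: "open {z. Re z > c}" by (rule open_halfspace_Re_gt)
  have conn: "connected {z. Re z > c}"
    by (intro convex_connected convex_halfspace_Re_gt)
  have A: "open A" "connected A"
    using A_cases op conn connected_open_delete[OF op conn, of 1] by auto
  have holA: "f holomorphic_on A" "g holomorphic_on A"
    by (rule holomorphic_on_subset[OF c1(2)], force simp: A_def c_def,
        rule holomorphic_on_subset[OF c2(2)], force simp: A_def c_def)
  define U where "U = {z. Re z > max 1 c}"
  have "of_real (max 1 c + 1) \<in> U"
    by (auto simp: U_def max_def)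
  hence U: "open U" "U \<noteq> {}" "U \<subseteq> A"
    using open_halfspace_Re_gt[of "max 1 c"] unfolding U_def A_def by (blast, blast, force)
  show ?thesis
    by (rule analytic_continuation_open[OF U(1) A(1) U(2) A(2) U(3) holA])
       (use c1(1) c2(1) in \<open>auto simp: U_def A_def intro: eq\<close>)
qed

lemma dirichlet_L_eqI:
  assumes "L_continuation chi s f"
  shows "dirichlet_L chi s = f s"
  unfolding dirichlet_L_def using assms L_continuation_unique by blast

end

theory Submission
  imports Defs "HOL-Probability.Sinc_Integral" "HOL-Real_Asymp.Real_Asymp"
begin

text \<open>
  Split \<open>L(1, \<chi>) = \<Sum> \<chi>(n) g(n) / n + \<Sum> \<chi>(n) (1 - g(n)) / n\<close>, where \<open>g\<close> is nonnegative, equals nearly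
  \<open>1\<close> for \<open>n\<close> below the order of \<open>\<surd>q\<close>, and \<open>1 - g\<close> is a cosine (\<open>\<chi>\<close> odd) or sine (\<open>\<chi>\<close> even) transform of a
  kernel supported on \<open>[0, X]\<close> with \<open>X\<close> of order \<open>1 / \<surd>q\<close>. The first sum is at most the sum of \<open>g(n) / n\<close> over
  the \<open>n\<close> prime to \<open>3\<close>; over these \<open>n\<close>, \<open>\<Sum> cos (n x) / n\<close> is at most
  \<open>1/3 ln 3 - 2/3 ln x\<close> for small \<open>x\<close> and \<open>\<Sum> sin (n x) / n\<close> is the constant \<open>\<pi> / 3\<close> on \<open>(0, 2 \<pi> / 3)\<close>.
  In the second sum expand \<open>\<chi>\<close> by its Gauss sum: the sawtooth series
  \<open>\<Sum> sin (n x) / n\<close> turn it into a finite sum over \<open>a < q X / (2 \<pi>)\<close> prime to \<open>3\<close> of a decreasing convex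
  function, which is at most \<open>2/3\<close> of the corresponding integral.

  For odd \<open>\<chi>\<close> the kernel is linear (Fejer), \<open>g(n) = (sin (n X / 2) / (n X / 2))\<^sup>2\<close> and \<open>X = 6 / \<surd>q\<close>. For even \<open>\<chi>\<close>
  the kernel is \<open>k(u) / u\<close> with \<open>u = x / X\<close>, \<open>k(u) = 2 (1 - u)\<^sup>2 (1 + 2 u - u\<^sup>2 / 3)\<close> and \<open>X = 2 \<pi> / \<surd>q\<close>.
  Among the multiples of \<open>(1 - u)\<^sup>2 (1 + 2 u + \<beta> u\<^sup>2)\<close>, the value \<open>\<beta> = - 1/3\<close> is the largest for which \<open>g\<close>
  stays nonnegative. All series are Abel regularised by a factor \<open>r^n\<close>, \<open>r \<rightarrow> 1\<close>.
\<close>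

section \<open>Gauss sums of primitive characters\<close>

text \<open>The transform has the parity opposite to that of the character, so that
  \<open>cos (n th) sin (n x)\<close> and \<open>sin (n th) (1 - cos (n x))\<close> both expand into
  sines: the sine series is piecewise linear at radius 1, and the dual side becomes a finite sum of
  tail integrals of the kernel, where cosine series would leave logarithms. The price for even
  characters is that a sine transform tends to a nonzero constant only if the kernel behaves like
  \<open>1 / x\<close> at 0; \<open>cot (x / 2)\<close>, whose transform is exactly
  \<open>pi\<close>, is the comparison kernel. For the family with parameter beta the factor
  \<open>1 + 2 u\<close> removes the linear term of \<open>k\<close>. Integration by parts then
  gives, with \<open>a = n X\<close>, the transform
  \<open>pi + (4 (3 + beta) cos a - 8 (1 - beta)) / a^3 + O(1 / a^4)\<close>. It stays below
  \<open>pi\<close> for large \<open>a\<close> only if \<open>4 (3 + beta) <= 8 (1 - beta)\<close>,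
  that is \<open>beta <= - 1/3\<close>. The size of \<open>X\<close> balances
  \<open>- 2/3 ln X\<close> against a dual term proportional to \<open>X sqrt q\<close>; the factor
  2/3, the density of the integers prime to 3, is what turns \<open>X\<close> of order
  \<open>1 / sqrt q\<close> into \<open>1/3 ln q\<close>.\<close>

lemma dirichlet_characterD:
  assumes "dirichlet_character q chi"
  shows "q > 0" "chi (a * b) = chi a * chi b" "chi (a + int q) = chi a" "chi a \<noteq> 0 \<longleftrightarrow> coprime a (int q)"
  using assms unfolding dirichlet_character_def by blast+

lemma character_one:
  assumes "dirichlet_character q chi"
  shows "chi 1 = 1"
  using dirichlet_characterD(2)[OF assms, of 1 1] dirichlet_characterD(4)[OF assms, of 1] by simp

lemma character_cong:
  assumes "dirichlet_character q chi" "[a = b] (mod int q)"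
  shows "chi a = chi b"
proof -
  have nat: "chi (x + int q * int n) = chi x" for x n
  proof (induction n)
    case (Suc n)
    show ?case
      using dirichlet_characterD(3)[OF assms(1), of "x + int q * int n"] Suc by (simp add: algebra_simps)
  qed auto
  have int: "chi (x + int q * k) = chi x" for x k
  proof (cases "k \<ge> 0")
    case True
    thus ?thesis using nat[of x "nat k"] by simp
  next
    case False
    thus ?thesis using nat[of "x + int q * k" "nat (-k)"] by simp
  qed
  from assms(2) obtain k where "b = a + int q * k"
    by (metis cong_iff_lin)
  thus ?thesis using int by simp
qed

lemma character_power:
  assumes "dirichlet_character q chi"
  shows "chi (a ^ n) = chi a ^ n"
  by (induction n) (auto simp: character_one[OF assms] dirichlet_characterD(2)[OF assms])

text \<open>Euler's theorem makes the value at a unit a root of unity.\<close>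

lemma norm_character:
  assumes "dirichlet_character q chi"
  shows "norm (chi a) = (if coprime a (int q) then 1 else 0)"
proof (cases "coprime a (int q)")
  case True
  define b where "b = nat (a mod int q)"
  have b: "int b = a mod int q" using dirichlet_characterD(1)[OF assms] by (simp add: b_def)
  have "coprime b q"
    using True b dirichlet_characterD(1)[OF assms] by (simp flip: coprime_int_iff)
  hence "[b ^ totient q = 1] (mod q)" by (rule euler_theorem)
  hence "[int b ^ totient q = 1] (mod int q)" by (metis cong_int_iff of_nat_1 of_nat_power)
  hence "chi (int b) ^ totient q = 1"
    using character_cong[OF assms, of "int b ^ totient q" 1]
    by (simp add: character_power[OF assms] character_one[OF assms])
  moreover have "chi (int b) = chi a" by (rule character_cong[OF assms]) (simp add: b cong_def)
  ultimately have "norm (chi a) ^ totient q = 1" by (metis norm_one norm_power)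
  moreover have "totient q > 0" using dirichlet_characterD(1)[OF assms] by simp
  ultimately have "norm (chi a) = 1"
    using power_eq_imp_eq_base[of "norm (chi a)" "totient q" 1] by simp
  thus ?thesis using True by simp
next
  case False
  thus ?thesis using dirichlet_characterD(4)[OF assms, of a] by simp
qed

lemma norm_character_le_1:
  assumes "dirichlet_character q chi"
  shows "norm (chi a) \<le> 1"
  using norm_character[OF assms, of a] by simp

section \<open>Additive characters modulo \<open>q\<close>\<close>

definition unit_root :: "nat \<Rightarrow> int \<Rightarrow> complex" where
  "unit_root q k = cis (2 * pi * of_int k / of_nat q)"

lemma unit_root_add: "unit_root q (a + b) = unit_root q a * unit_root q b"
  by (simp add: unit_root_def cis_mult ring_distribs add_divide_distrib)

lemma unit_root_eq_1:
  assumes "q > 0" 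
  shows "unit_root q k = 1 \<longleftrightarrow> int q dvd k"
proof
  assume "unit_root q k = 1"
  hence "cos (2 * pi * of_int k / of_nat q) = 1" 
    unfolding unit_root_def by (metis cis.simps(1) one_complex.simps(1))
  then obtain m :: int where "2 * pi * of_int k / of_nat q = of_int m * 2 * pi"
    using cos_one_2pi_int by auto
  hence "real_of_int k = of_int (m * int q)" using assms by (simp add: field_simps)
  hence "k = m * int q" by linarith
  thus "int q dvd k" by simp
next
  assume "int q dvd k"
  then obtain m where "k = int q * m" by auto
  hence "2 * pi * of_int k / of_nat q = 2 * pi * of_int m" using assms by simp
  thus "unit_root q k = 1" unfolding unit_root_def by (simp add: cis_multiple_2pi)
qed

lemma unit_root_cong:
  assumes "q > 0" "[a = b] (mod int q)"
  shows "unit_root q a = unit_root q b"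
proof -
  from assms(2) obtain k where "b = a + int q * k" by (metis cong_iff_lin)
  thus ?thesis using unit_root_eq_1[OF assms(1), of "int q * k"] by (simp add: unit_root_add)
qed

lemma unit_root_uminus: "unit_root q (-k) = cnj (unit_root q k)"
  by (simp add: unit_root_def cis_cnj)

lemma sum_unit_root:
  assumes "q > 0"
  shows "(\<Sum>n\<in>{0..<int q}. unit_root q (n * k)) = (if int q dvd k then of_nat q else 0)"
proof (cases "int q dvd k")
  case True
  have "unit_root q (n * k) = 1" for n using True unit_root_eq_1[OF assms] by simp
  thus ?thesis using True by simp
next
  case False
  define w where "w = unit_root q k"
  have w: "w \<noteq> 1" using False unit_root_eq_1[OF assms] by (simp add: w_def)
  have pw: "unit_root q (int n * k) = w ^ n" for n
    by (induction n) (auto simp: w_def unit_root_add ring_distribs, simp add: unit_root_def)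
  have "(\<Sum>n\<in>{0..<int q}. unit_root q (n * k)) = (\<Sum>n<q. unit_root q (int n * k))"
    by (rule sum.reindex_bij_witness[of _ int nat]) auto
  also have "\<dots> = (\<Sum>n<q. w ^ n)" by (simp add: pw)
  also have "\<dots> = (w ^ q - 1) / (w - 1)" using w by (simp add: geometric_sum)
  also have "w ^ q = 1" using pw[of q] unit_root_eq_1[OF assms, of "int q * k"] by simp
  finally show ?thesis using False by simp
qed

lemma sum_residues_mult:
  fixes f :: "int \<Rightarrow> complex"
  assumes "q > 0" "coprime c (int q)" and per: "\<And>a b. [a = b] (mod int q) \<Longrightarrow> f a = f b"
  shows "(\<Sum>a\<in>{0..<int q}. f (c * a)) = (\<Sum>a\<in>{0..<int q}. f a)"
proof -
  have inj: "inj_on (\<lambda>a. (c * a) mod int q) {0..<int q}"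
  proof (rule inj_onI)
    fix x y assume xy: "x \<in> {0..<int q}" "y \<in> {0..<int q}" "(c * x) mod int q = (c * y) mod int q"
    hence "[c * x = c * y] (mod int q)" by (simp add: cong_def)
    hence "[x = y] (mod int q)" using assms(2) cong_mult_lcancel by blast
    thus "x = y" using xy by (simp add: cong_def)
  qed
  have img: "(\<lambda>a. (c * a) mod int q) ` {0..<int q} = {0..<int q}"
    by (rule endo_inj_surj[OF _ _ inj]) (use assms(1) in auto)
  have "(\<Sum>a\<in>{0..<int q}. f a) = (\<Sum>a\<in>(\<lambda>a. (c * a) mod int q) ` {0..<int q}. f a)" by (simp add: img)
  also have "\<dots> = (\<Sum>a\<in>{0..<int q}. f ((c * a) mod int q))"
    using sum.reindex[OF inj, of f] by (simp add: o_def)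
  also have "\<dots> = (\<Sum>a\<in>{0..<int q}. f (c * a))"
    by (intro sum.cong refl per) (simp add: cong_def)
  finally show ?thesis by simp
qed

text \<open>The conjugate character is summed so that separability expresses \<open>chi n\<close>
  itself as a multiple of a finite exponential sum.\<close>

definition gauss_sum :: "nat \<Rightarrow> (int \<Rightarrow> complex) \<Rightarrow> int \<Rightarrow> complex" where
  "gauss_sum q chi n = (\<Sum>a\<in>{0..<int q}. cnj (chi a) * unit_root q (a * n))"

lemma gauss_sum_mult:
  assumes "dirichlet_character q chi" "coprime c (int q)"
  shows "gauss_sum q chi n = cnj (chi c) * gauss_sum q chi (c * n)"
proof -
  note q = dirichlet_characterD(1)[OF assms(1)]
  have "gauss_sum q chi n = (\<Sum>a\<in>{0..<int q}. cnj (chi (c * a)) * unit_root q (c * a * n))"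
    unfolding gauss_sum_def
  proof (rule sum_residues_mult[OF q assms(2), symmetric])
    fix a b assume ab: "[a = b] (mod int q)"
    hence "[a * n = b * n] (mod int q)" by (rule cong_scalar_right)
    thus "cnj (chi a) * unit_root q (a * n) = cnj (chi b) * unit_root q (b * n)"
      using character_cong[OF assms(1) ab] unit_root_cong[OF q] by metis
  qed
  also have "\<dots> = cnj (chi c) * gauss_sum q chi (c * n)"
    unfolding gauss_sum_def sum_distrib_left
    by (intro sum.cong refl) (simp add: dirichlet_characterD(2)[OF assms(1)] mult_ac)
  finally show ?thesis .
qed

lemma primitive_not_induced:
  assumes "primitive_character q chi" "d < q"
  shows "\<not> induced_modulus q chi d"
  using assms not_less_Least unfolding primitive_character_def conductor_def by metis

text \<open>For \<open>n\<close> prime to \<open>q\<close> this is the substitution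
  \<open>a -> n a\<close>. For other \<open>n\<close> both sides vanish, and this is where
  primitivity enters.\<close>

lemma gauss_sum_separable:
  assumes "primitive_character q chi"
  shows "gauss_sum q chi n = chi n * gauss_sum q chi 1"
proof -
  have chi: "dirichlet_character q chi" using assms unfolding primitive_character_def by simp
  note q = dirichlet_characterD(1)[OF chi]
  have unit: "chi c * cnj (chi c) = 1" if "coprime c (int q)" for c
    using norm_character[OF chi, of c] that by (simp add: complex_norm_square[symmetric] flip: of_real_power)
  show ?thesis
  proof (cases "coprime n (int q)")
    case True
    have "chi n * gauss_sum q chi 1 = (chi n * cnj (chi n)) * gauss_sum q chi n"
      using gauss_sum_mult[OF chi True, of 1] by simp
    thus ?thesis using unit[OF True] by simp
  next
    case False
    define g where "g = nat (gcd n (int q))"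
    have g: "int g = gcd n (int q)" by (simp add: g_def)
    have "int g dvd int q" "int g dvd n" unfolding g by auto
    hence gq: "g dvd q" by simp
    have "g \<noteq> 1" using False g by (metis coprime_iff_gcd_eq_1 of_nat_1)
    moreover have "g > 0" using gq q by (auto intro: Nat.gr0I)
    ultimately have "g > 1" by simp
    \<comment> \<open>A proper divisor of \<open>q\<close>, hence not an induced modulus: some unit
      \<open>a\<close> congruent to 1 modulo \<open>d\<close> has \<open>chi a\<close> different
      from 1. As \<open>a * n\<close> and \<open>n\<close> agree modulo \<open>q\<close>, the Gauss
      sum at \<open>n\<close> is fixed by multiplication by a number other than 1.\<close>
    define d where "d = q div g"
    have dg: "q = d * g" using gq by (simp add: d_def)
    hence "d < q" "d dvd q" using \<open>g > 1\<close> q by (auto simp: )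
    with primitive_not_induced[OF assms this(1)] obtain a
      where a: "coprime a (int q)" "[a = 1] (mod int d)" "chi a \<noteq> 1"
      unfolding induced_modulus_def by blast
    obtain m where m: "n = int g * m" using \<open>int g dvd n\<close> by auto
    have "int d dvd a - 1" using a(2) by (simp add: cong_iff_dvd_diff)
    hence "int d * int g dvd (a - 1) * (int g * m)" by (simp add: mult_dvd_mono)
    hence "int q dvd a * n - n" by (simp add: dg m algebra_simps)
    hence "[a * n = n] (mod int q)" by (simp add: cong_iff_dvd_diff)
    hence "gauss_sum q chi (a * n) = gauss_sum q chi n"
      unfolding gauss_sum_def
      by (intro sum.cong refl arg_cong2[where f = "(*)"] unit_root_cong[OF q])
         (metis cong_scalar_left)
    with gauss_sum_mult[OF chi a(1), of n]
    have "gauss_sum q chi n * (1 - cnj (chi a)) = 0" by (simp add: algebra_simps)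
    moreover have "1 - cnj (chi a) \<noteq> 0" using a(3) by (metis complex_cnj_one complex_cnj_cnj eq_iff_diff_eq_0)
    ultimately have "gauss_sum q chi n = 0" by simp
    thus ?thesis using False dirichlet_characterD(4)[OF chi, of n] by simp
  qed
qed

text \<open>The sum of the squared norms of all \<open>gauss_sum q chi n\<close> is evaluated twice:
  orthogonality of the additive characters gives \<open>N * q\<close>, separability gives
  \<open>N\<close> times the squared norm at 1, and \<open>N\<close> is nonzero.\<close>

lemma norm_gauss_sum:
  assumes "primitive_character q chi"
  shows "norm (gauss_sum q chi 1) = sqrt (real q)"
proof -
  have chi: "dirichlet_character q chi" using assms unfolding primitive_character_def by simp
  note q = dirichlet_characterD(1)[OF chi]
  let ?I = "{0..<int q}"
  define N where "N = (\<Sum>a\<in>?I. chi a * cnj (chi a))"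
  have "N = of_real (\<Sum>a\<in>?I. (norm (chi a))\<^sup>2)"
    unfolding N_def by (simp only: complex_norm_square of_real_sum)
  moreover have "(\<Sum>a\<in>?I. (norm (chi a))\<^sup>2) > 0"
  proof (rule sum_pos2)
    show "1 mod int q \<in> ?I" using q by simp
    have "chi (1 mod int q) = 1" 
      using character_cong[OF chi, of "1 mod int q" 1] character_one[OF chi] by (simp add: cong_def)
    thus "0 < (norm (chi (1 mod int q)))\<^sup>2" by simp
  qed auto
  ultimately have N0: "N \<noteq> 0" by (metis less_irrefl of_real_eq_0_iff)
  have "(\<Sum>n\<in>?I. gauss_sum q chi n * cnj (gauss_sum q chi n)) =
        (\<Sum>n\<in>?I. \<Sum>a\<in>?I. \<Sum>b\<in>?I. cnj (chi a) * chi b * unit_root q (n * (a - b)))"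
    unfolding gauss_sum_def cnj_sum sum_product
  proof (intro sum.cong refl)
    fix n a b
    have "unit_root q (n * (a - b)) = unit_root q (a * n) * cnj (unit_root q (b * n))"
      by (simp add: unit_root_uminus[symmetric] unit_root_add[symmetric] right_diff_distrib mult.commute)
    thus "cnj (chi a) * unit_root q (a * n) * cnj (cnj (chi b) * unit_root q (b * n)) =
        cnj (chi a) * chi b * unit_root q (n * (a - b))"
      by (simp add: mult_ac)
  qed
  also have "\<dots> = (\<Sum>a\<in>?I. \<Sum>b\<in>?I. \<Sum>n\<in>?I. cnj (chi a) * chi b * unit_root q (n * (a - b)))"
    by (subst sum.swap, rule sum.cong[OF refl], rule sum.swap)
  also have "\<dots> = (\<Sum>a\<in>?I. \<Sum>b\<in>?I. cnj (chi a) * chi b * (if int q dvd a - b then of_nat q else 0))"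
    by (simp add: sum_distrib_left[symmetric] sum_unit_root[OF q])
  also have "\<dots> = (\<Sum>a\<in>?I. \<Sum>b\<in>?I. if b = a then cnj (chi a) * chi b * of_nat q else 0)"
  proof (intro sum.cong refl)
    fix a b assume "a \<in> ?I" "b \<in> ?I"
    hence "int q dvd a - b \<longleftrightarrow> b = a"
      using zdvd_imp_le[of "int q" "a - b"] zdvd_imp_le[of "int q" "b - a"] 
      by (cases a b rule: linorder_cases) (auto simp: dvd_diff_commute)
    thus "cnj (chi a) * chi b * (if int q dvd a - b then of_nat q else 0) =
          (if b = a then cnj (chi a) * chi b * of_nat q else 0)" by simp
  qed
  also have "\<dots> = N * of_nat q"
    by (simp add: N_def sum_distrib_right sum_distrib_left mult_ac)
  finally have "(\<Sum>n\<in>?I. gauss_sum q chi n * cnj (gauss_sum q chi n)) = N * of_nat q" .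
  moreover have "(\<Sum>n\<in>?I. gauss_sum q chi n * cnj (gauss_sum q chi n)) =
      N * (gauss_sum q chi 1 * cnj (gauss_sum q chi 1))"
    unfolding N_def sum_distrib_right
  proof (intro sum.cong refl)
    fix n
    show "gauss_sum q chi n * cnj (gauss_sum q chi n) =
        chi n * cnj (chi n) * (gauss_sum q chi 1 * cnj (gauss_sum q chi 1))"
      by (subst (1 2) gauss_sum_separable[OF assms, of n]) (simp only: complex_cnj_mult mult_ac)
  qed
  ultimately have "gauss_sum q chi 1 * cnj (gauss_sum q chi 1) = of_nat q" using N0 by simp
  hence "complex_of_real ((norm (gauss_sum q chi 1))\<^sup>2) = of_real (real q)"
    by (simp only: complex_norm_square of_real_of_nat_eq)
  hence "(norm (gauss_sum q chi 1))\<^sup>2 = real q" by (simp only: of_real_eq_iff)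
  thus ?thesis by (metis norm_ge_zero real_sqrt_unique)
qed

section \<open>Dirichlet series with bounded partial sums\<close>

lemma sum_by_parts:
  fixes a w :: "nat \<Rightarrow> 'a :: comm_ring"
  shows "(\<Sum>n<N. a n * w n) = (\<Sum>n<N. (\<Sum>i<Suc n. a i) * (w n - w (Suc n))) + (\<Sum>i<N. a i) * w N"
  by (induction N) (simp_all add: algebra_simps)

text \<open>Mean value bound on the segment between consecutive integers. The extra power of
  \<open>1 / n\<close> makes the series obtained by partial summation converge absolutely for
  \<open>Re z > 0\<close>.\<close>

lemma norm_powr_diff_le:
  fixes z :: complex
  assumes "Re z > 0"
  shows "norm (of_nat (Suc n) powr (-z) - of_nat (Suc (Suc n)) powr (-z)) \<le> norm z * real (Suc n) powr (- Re z - 1)"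
proof -
  define A where "A = closed_segment (complex_of_nat (Suc n)) (of_nat (Suc (Suc n)))"
  have A: "Im t = 0 \<and> Re t \<ge> real (Suc n)" if "t \<in> A" for t
    using that unfolding A_def closed_segment_def
    by (auto, simp add: algebra_simps)
  have "norm (of_nat (Suc n) powr (-z) - of_nat (Suc (Suc n)) powr (-z)) \<le>
        norm z * real (Suc n) powr (- Re z - 1) * norm (of_nat (Suc n) - of_nat (Suc (Suc n)) :: complex)"
  proof (rule field_differentiable_bound[of A "\<lambda>t. t powr (-z)" "\<lambda>t. -z * t powr (-z - 1)"])
    show "convex A" unfolding A_def by (rule convex_closed_segment)
    fix t assume t: "t \<in> A"
    have t': "Re t > 0" using A[OF t] by auto
    hence "t \<notin> \<real>\<^sub>\<le>\<^sub>0" using complex_nonpos_Reals_iff by auto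
    thus "((\<lambda>t. t powr (-z)) has_field_derivative -z * t powr (-z - 1)) (at t within A)"
      by (auto intro!: derivative_eq_intros)
    have tr: "t = of_real (Re t)" using A[OF t] by (simp add: complex_eq_iff)
    have "norm (t powr (-z - 1)) = Re t powr (- Re z - 1)"
      by (subst tr, subst norm_powr_real_powr) (use t' in auto)
    also have "\<dots> \<le> real (Suc n) powr (- Re z - 1)"
      using A[OF t] assms by (intro powr_mono2') auto
    finally show "norm (-z * t powr (-z - 1)) \<le> norm z * real (Suc n) powr (- Re z - 1)"
      by (simp add: norm_mult mult_left_mono)
  qed (auto simp: A_def)
  thus ?thesis by simp
qed

text \<open>Summation by parts trades the coefficients for their bounded partial sums and the powers
  for their differences; the new series converges locally uniformly by the Weierstrass test, and the
  boundary term tends to 0.\<close>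

lemma dirichlet_series_bounded_partial_sums:
  fixes a :: "nat \<Rightarrow> complex"
  assumes C: "\<And>N. norm (\<Sum>n<N. a n) \<le> C"
  obtains f where "f holomorphic_on {z. Re z > 0}"
    "\<And>z. Re z > 0 \<Longrightarrow> (\<lambda>n. a n / of_nat (Suc n) powr z) sums f z"
proof -
  define w where "w = (\<lambda>n z. complex_of_nat (Suc n) powr (-z))"
  define t where "t = (\<lambda>n z. (\<Sum>i<Suc n. a i) * (w n z - w (Suc n) z))"
  define f where "f = (\<lambda>z. \<Sum>n. t n z)"
  have C0: "C \<ge> 0" using C[of 0] by simp
  have t_le: "norm (t n z) \<le> C * R * real (Suc n) powr (- s - 1)"
    if "norm z \<le> R" "s > 0" "Re z \<ge> s" for n z R s
  proof -
    have "norm (w n z - w (Suc n) z) \<le> norm z * real (Suc n) powr (- Re z - 1)"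
      unfolding w_def using that by (intro norm_powr_diff_le) auto
    also have "\<dots> \<le> R * real (Suc n) powr (- s - 1)"
      using that by (intro mult_mono powr_mono) (auto intro: order_trans[OF norm_ge_zero])
    finally show ?thesis
      unfolding t_def norm_mult mult.assoc using C[of "Suc n"] C0 by (intro mult_mono) auto
  qed
  have summ: "summable (\<lambda>n. C * R * real (Suc n) powr (- s - 1))" if "s > 0" for R s
  proof (rule summable_mult)
    have "summable (\<lambda>n. real n powr (- s - 1))" using that by (subst summable_real_powr_iff) auto
    thus "summable (\<lambda>n. real (Suc n) powr (- s - 1))" by (subst summable_Suc_iff)
  qed
  have unif: "uniform_limit {z. norm z \<le> R \<and> Re z \<ge> s} (\<lambda>N z. \<Sum>n<N. t n z) f sequentially"
    if "s > 0" for R s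
    unfolding f_def by (rule Weierstrass_m_test[OF _ summ[OF that, of R]]) (use t_le that in auto)
  have hol: "(\<lambda>z. \<Sum>n<N. t n z) holomorphic_on {z. Re z > 0}" for N
    unfolding t_def w_def by (intro holomorphic_intros) (auto simp del: of_nat_Suc)
  show ?thesis
  proof (rule that[of f])
    show "f holomorphic_on {z. Re z > 0}"
    proof (rule holomorphic_uniform_sequence[OF open_halfspace_Re_gt hol])
      fix x :: complex assume x: "x \<in> {z. Re z > 0}"
      \<comment> \<open>On the disc of this radius the norm is bounded and the real part is at least
        \<open>d\<close>, as the uniform estimate demands.\<close>
      define d where "d = Re x / 2"
      have sub: "cball x d \<subseteq> {z. norm z \<le> norm x + d \<and> Re z \<ge> d}"
      proof
        fix y assume "y \<in> cball x d"
        hence y: "norm (x - y) \<le> d" by (simp add: dist_norm)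
        have "Re (x - y) \<le> d" using complex_Re_le_cmod[of "x - y"] y by linarith
        hence "Re y \<ge> d" by (simp add: d_def field_simps)
        moreover have "norm y \<le> norm x + d" 
          using y norm_triangle_ineq4[of x "x - y"] by simp
        ultimately show "y \<in> {z. norm z \<le> norm x + d \<and> Re z \<ge> d}" by simp
      qed
      have d: "d > 0" using x by (simp add: d_def)
      have "cball x d \<subseteq> {z. Re z > 0}" using sub d by auto
      moreover have "uniform_limit (cball x d) (\<lambda>N z. \<Sum>n<N. t n z) f sequentially"
        by (rule uniform_limit_on_subset[OF unif[OF d] sub])
      ultimately show "\<exists>d>0. cball x d \<subseteq> {z. 0 < Re z} \<and>
          uniform_limit (cball x d) (\<lambda>N z. \<Sum>n<N. t n z) f sequentially"
        using d by blast
    qed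
    fix z :: complex assume z: "Re z > 0"
    have "(\<lambda>N. \<Sum>n<N. t n z) \<longlonglongrightarrow> f z"
      by (rule tendsto_uniform_limitI[OF unif[of "Re z" "norm z"]]) (use z in auto)
    moreover have "(\<lambda>N. (\<Sum>n<N. a n) * w N z) \<longlonglongrightarrow> 0"
    proof (rule Lim_null_comparison)
      have "(\<lambda>N. real (Suc N) powr (- Re z)) \<longlonglongrightarrow> 0"
        using z by (intro tendsto_neg_powr filterlim_compose[OF filterlim_real_sequentially filterlim_Suc]) auto
      from tendsto_mult_left[OF this, of C] show "(\<lambda>N. C * real (Suc N) powr (- Re z)) \<longlonglongrightarrow> 0" by simp
      show "\<forall>\<^sub>F N in sequentially. norm ((\<Sum>n<N. a n) * w N z) \<le> C * real (Suc N) powr (- Re z)"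
      proof (intro always_eventually allI)
        fix N
        have "norm (w N z) = real (Suc N) powr (- Re z)"
          unfolding w_def by (subst norm_powr_real_powr) (auto simp del: of_nat_Suc)
        thus "norm ((\<Sum>n<N. a n) * w N z) \<le> C * real (Suc N) powr (- Re z)"
          using C[of N] by (simp add: norm_mult mult_right_mono)
      qed
    qed
    ultimately have "(\<lambda>N. (\<Sum>n<N. t n z) + (\<Sum>n<N. a n) * w N z) \<longlonglongrightarrow> f z + 0"
      by (rule tendsto_add)
    moreover have "(\<Sum>n<N. t n z) + (\<Sum>n<N. a n) * w N z = (\<Sum>n<N. a n * w n z)" for N
      unfolding t_def by (rule sum_by_parts[symmetric])
    ultimately show "(\<lambda>n. a n / of_nat (Suc n) powr z) sums f z"
      by (simp add: sums_def w_def powr_minus_divide)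
  qed
qed

text \<open>Abel's theorem along a sequence of radii. Summation by parts rewrites the power series
  as \<open>s + (1 - r) * (\<Sum>n. S n * r ^ n)\<close>, where \<open>S n\<close> is the error of
  the partial sums. The factor \<open>1 - r\<close> kills the first \<open>N\<close> terms and
  exactly balances the geometric majorant of the others.\<close>

lemma Abel_limit:
  fixes a :: "nat \<Rightarrow> complex" and r :: "nat \<Rightarrow> real"
  assumes a: "a sums s" and r: "\<And>k. 0 \<le> r k" "\<And>k. r k < 1" "r \<longlonglongrightarrow> 1"
  shows "(\<lambda>k. \<Sum>n. a n * of_real (r k) ^ n) \<longlonglongrightarrow> s"
proof -
  define S where "S = (\<lambda>n. (\<Sum>i<Suc n. a i) - s)"
  have S0: "S \<longlonglongrightarrow> 0"
    using LIMSEQ_Suc[OF a[unfolded sums_def]] unfolding S_def by (simp add: LIM_zero)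
  obtain B where B: "\<And>n. norm (S n) \<le> B" "B > 0"
    using convergent_imp_Bseq[OF convergentI[OF S0]] unfolding Bseq_def by blast
  have geo: "(\<lambda>n. of_real (r k) ^ n) sums (1 / (1 - complex_of_real (r k)))" for k
    using r by (intro geometric_sums) auto
  have summ: "summable (\<lambda>n. norm (S n) * r k ^ n)" for k
  proof (rule summable_comparison_test')
    show "summable (\<lambda>n. B * r k ^ n)" using r(1,2)[of k] by (intro summable_mult summable_geometric) auto
    fix n
    show "norm (norm (S n) * r k ^ n) \<le> B * r k ^ n"
      using B r(1)[of k] by (simp add: mult_right_mono)
  qed
  have eq: "(\<lambda>n. a n * of_real (r k) ^ n) sums (s + (1 - of_real (r k)) * (\<Sum>n. S n * of_real (r k) ^ n))" for k
  proof -
    have sS: "summable (\<lambda>n. S n * of_real (r k) ^ n)"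
      by (rule summable_norm_cancel) (use summ[of k] r(1)[of k] in \<open>simp add: norm_mult norm_power\<close>)
    define b where "b = (\<lambda>n. S n * of_real (r k) ^ n)"
    have "(\<lambda>n. s * (of_real (r k) ^ n * (1 - of_real (r k))) + (1 - of_real (r k)) * b n) sums
        (s * (1 / (1 - of_real (r k)) * (1 - of_real (r k))) + (1 - of_real (r k)) * (\<Sum>n. b n))"
      unfolding b_def
      by (intro sums_add sums_mult sums_mult2 geo summable_sums sS)
    moreover have "s * (1 / (1 - of_real (r k)) * (1 - of_real (r k))) = s"
      using r(2)[of k] by simp
    moreover have "(\<lambda>n. s * (of_real (r k) ^ n * (1 - of_real (r k))) + (1 - of_real (r k)) * b n) =
        (\<lambda>n. (\<Sum>i<Suc n. a i) * (of_real (r k) ^ n - of_real (r k) ^ Suc n))"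
      by (auto simp: b_def S_def algebra_simps)
    ultimately have "(\<lambda>n. (\<Sum>i<Suc n. a i) * (of_real (r k) ^ n - of_real (r k) ^ Suc n)) sums
        (s + (1 - of_real (r k)) * (\<Sum>n. b n))" by (simp only:)
    moreover have "(\<lambda>N. (\<Sum>i<N. a i) * of_real (r k) ^ N) \<longlonglongrightarrow> s * 0"
      using r(1,2)[of k] by (intro tendsto_mult a[unfolded sums_def] LIMSEQ_power_zero) auto
    ultimately show ?thesis
      unfolding sums_def sum_by_parts[of a] b_def using tendsto_add by fastforce
  qed
  have "(\<lambda>k. (1 - of_real (r k)) * (\<Sum>n. S n * of_real (r k) ^ n)) \<longlonglongrightarrow> 0"
  proof (rule LIMSEQ_I)
    fix e :: real assume e: "e > 0"
    obtain N where N: "\<And>n. n \<ge> N \<Longrightarrow> norm (S n) < e / 2"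
      using LIMSEQ_D[OF S0, of "e / 2"] e by auto
    have "(\<lambda>k. (1 - r k) * (real N * B)) \<longlonglongrightarrow> (1 - 1) * (real N * B)" by (intro tendsto_intros r)
    hence "eventually (\<lambda>k. (1 - r k) * (real N * B) < e / 2) sequentially"
      using e by (intro order_tendstoD) auto
    then obtain K where K: "\<And>k. k \<ge> K \<Longrightarrow> (1 - r k) * (real N * B) < e / 2"
      by (auto simp: eventually_sequentially)
    show "\<exists>K. \<forall>k\<ge>K. norm ((1 - of_real (r k)) * (\<Sum>n. S n * of_real (r k) ^ n) - 0) < e"
    proof (intro exI allI impI)
      fix k assume "k \<ge> K"
      have "norm (\<Sum>n. S n * of_real (r k) ^ n) \<le> (\<Sum>n. norm (S n * of_real (r k) ^ n))"
        by (rule summable_norm) (use summ[of k] r(1)[of k] in \<open>simp add: norm_mult norm_power\<close>)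
      also have "\<dots> = (\<Sum>n. norm (S n) * r k ^ n)"
        using r(1)[of k] by (simp add: norm_mult norm_power)
      also have "\<dots> \<le> (\<Sum>n. (if n < N then B else 0) + e / 2 * r k ^ n)"
      proof (rule suminf_le[OF _ summ])
        fix n
        have "r k ^ n \<le> 1" using r(1,2)[of k] by (intro power_le_one) auto
        moreover have "0 \<le> r k ^ n" using r(1)[of k] by simp
        moreover have "norm (S n) * r k ^ n \<le> B * 1" 
          using B(1)[of n] B(2) r(1)[of k] calculation by (intro mult_mono) auto
        moreover have "norm (S n) * r k ^ n \<le> e / 2 * r k ^ n" if "n \<ge> N"
          using N[OF that] r(1)[of k] by (intro mult_right_mono) auto
        ultimately show "norm (S n) * r k ^ n \<le> (if n < N then B else 0) + e / 2 * r k ^ n"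
          using e by (auto simp: add_increasing2)
      next
        have "summable (\<lambda>n. if n < N then B else 0)" using summable_If_finite[of "\<lambda>n. n < N" "\<lambda>_. B"] by simp
        thus "summable (\<lambda>n. (if n < N then B else 0) + e / 2 * r k ^ n)"
          using r(1,2)[of k] by (intro summable_add summable_mult summable_geometric) auto
      qed
      also have "\<dots> = real N * B + e / 2 * (1 / (1 - r k))"
      proof (rule sums_unique[symmetric], rule sums_add)
        show "(\<lambda>n. if n < N then B else 0) sums (real N * B)"
          using sums_If_finite[of "\<lambda>n. n < N" "\<lambda>_. B"] by simp
        show "(\<lambda>n. e / 2 * r k ^ n) sums (e / 2 * (1 / (1 - r k)))"
          using r(1,2)[of k] by (intro sums_mult geometric_sums) auto
      qed
      finally have le: "norm (\<Sum>n. S n * of_real (r k) ^ n) \<le> real N * B + e / 2 * (1 / (1 - r k))" .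
      have "norm ((1 - of_real (r k)) * (\<Sum>n. S n * of_real (r k) ^ n)) =
          (1 - r k) * norm (\<Sum>n. S n * of_real (r k) ^ n)"
        using norm_of_real[of "1 - r k", where 'a = complex] r(2)[of k] by (simp add: norm_mult)
      also have "\<dots> \<le> (1 - r k) * (real N * B + e / 2 * (1 / (1 - r k)))"
        using le r(2)[of k] by (intro mult_left_mono) auto
      also have "\<dots> = (1 - r k) * (real N * B) + e / 2" using r(2)[of k] by (simp add: field_simps)
      also have "\<dots> < e" using K[OF \<open>k \<ge> K\<close>] by simp
      finally show "norm ((1 - of_real (r k)) * (\<Sum>n. S n * of_real (r k) ^ n) - 0) < e" by simp
    qed
  qed
  from tendsto_add[OF tendsto_const[of s] this] show ?thesis
    using eq by (simp add: sums_iff)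
qed

section \<open>Abel means of the sawtooth series\<close>

text \<open>The imaginary part of \<open>- ln (1 - r * cis y)\<close>; \<open>arctan\<close> is the
  right branch because \<open>1 - r * cos y > 0\<close> for \<open>r < 1\<close>. The formula keeps
  its meaning at \<open>r = 1\<close>, where it is the sawtooth: division by zero gives the value 0
  at multiples of \<open>2 * pi\<close>, which is also the limit there.\<close>

definition abel_sin :: "real \<Rightarrow> real \<Rightarrow> real" where
  "abel_sin r y = arctan (r * sin y / (1 - r * cos y))"

lemma one_minus_polar_pos:
  fixes r y :: real
  assumes "0 \<le> r" "r < 1"
  shows "1 - r * cos y > 0"
proof -
  have "r * cos y \<le> r * 1" using assms by (intro mult_left_mono) auto
  thus ?thesis using assms by simp
qed

lemma norm_one_minus_polar:
  fixes r y :: real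
  shows "(1 - r * cos y)\<^sup>2 + (r * sin y)\<^sup>2 = 1 - 2 * r * cos y + r\<^sup>2"
proof -
  have "(r * sin y)\<^sup>2 = r\<^sup>2 * (1 - (cos y)\<^sup>2)" by (simp add: power_mult_distrib sin_squared_eq)
  thus ?thesis by (simp add: power2_eq_square algebra_simps)
qed

lemma log_series_polar:
  fixes r y :: real
  assumes "0 \<le> r" "r < 1"
  shows abel_sin_sums: "(\<lambda>n. r ^ n * sin (real n * y) / real n) sums abel_sin r y"
    and abel_cos_sums: "(\<lambda>n. r ^ n * cos (real n * y) / real n) sums (- (1/2) * ln (1 - 2 * r * cos y + r\<^sup>2))"
proof -
  define z where "z = of_real r * cis y"
  have nz: "norm z < 1" using assms by (simp add: z_def norm_mult)
  have pos: "1 - r * cos y > 0" by (rule one_minus_polar_pos[OF assms])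
  have zn: "z ^ n = of_real (r ^ n) * cis (real n * y)" for n
    by (simp add: z_def power_mult_distrib Complex.DeMoivre)
  \<comment> \<open>Division by zero makes the term at \<open>n = 0\<close> vanish, so this and the
    later series with denominator \<open>n\<close> may start at 0.\<close>
  have "(\<lambda>n. - (z ^ n) / of_nat n) sums ln (1 - z)"
    using Ln_series'[of "-z"] nz by simp
  hence s: "(\<lambda>n. z ^ n / of_nat n) sums (- ln (1 - z))"
    using sums_minus by fastforce
  have ne: "1 - z \<noteq> 0" using nz by auto
  have re: "Re (1 - z) = 1 - r * cos y" and im: "Im (1 - z) = - (r * sin y)"
    by (simp_all add: z_def)
  have "Im (ln (1 - z)) = arctan (Im (1 - z) / Re (1 - z))"
    using arg_conv_arctan[of "1 - z"] Arg_eq_Im_Ln[OF ne] pos re by simp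
  also have "\<dots> = - abel_sin r y"
    unfolding re im abel_sin_def by (simp add: arctan_minus)
  finally have "Im (- ln (1 - z)) = abel_sin r y" by simp
  with sums_Im[OF s] show "(\<lambda>n. r ^ n * sin (real n * y) / real n) sums abel_sin r y"
    by (simp add: zn Im_divide_of_nat)
  have "(norm (1 - z))\<^sup>2 = (1 - r * cos y)\<^sup>2 + (r * sin y)\<^sup>2"
    unfolding cmod_power2 re im by simp
  also note norm_one_minus_polar
  finally have "(norm (1 - z))\<^sup>2 = 1 - 2 * r * cos y + r\<^sup>2" by simp
  hence "ln (1 - 2 * r * cos y + r\<^sup>2) = 2 * ln (norm (1 - z))"
    using ne by (metis ln_realpow norm_ge_zero norm_eq_zero of_nat_numeral zero_less_norm_iff)
  moreover have "Re (ln (1 - z)) = ln (norm (1 - z))" using ne by (rule Re_Ln)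
  ultimately have "Re (- ln (1 - z)) = - (1/2) * ln (1 - 2 * r * cos y + r\<^sup>2)" by simp
  moreover have "(\<lambda>n. r ^ n * cos (real n * y) / real n) sums Re (- ln (1 - z))"
    using sums_Re[OF s] by (simp add: zn Re_divide_of_nat)
  ultimately show "(\<lambda>n. r ^ n * cos (real n * y) / real n) sums (- (1/2) * ln (1 - 2 * r * cos y + r\<^sup>2))"
    by (simp only:)
qed

lemma abs_abel_sin_le: "\<bar>abel_sin r y\<bar> \<le> pi / 2"
  unfolding abel_sin_def using arctan_bounded[of "r * sin y / (1 - r * cos y)"] by linarith

lemma abel_sin_measurable [measurable]: "abel_sin r \<in> borel_measurable borel"
  unfolding abel_sin_def by measurable

lemma abel_sin_uminus: "abel_sin r (-y) = - abel_sin r y"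
  by (simp add: abel_sin_def arctan_minus)

lemma abel_sin_tendsto:
  assumes "r \<longlonglongrightarrow> 1"
  shows "(\<lambda>k. abel_sin (r k) y) \<longlonglongrightarrow> abel_sin 1 y"
proof (cases "cos y = 1")
  case True
  hence "sin y = 0" by (metis cos_one_sin_zero)
  thus ?thesis by (simp add: abel_sin_def)
next
  case False
  have "(\<lambda>k. arctan (r k * sin y / (1 - r k * cos y))) \<longlonglongrightarrow> arctan (1 * sin y / (1 - 1 * cos y))"
    using False by (intro tendsto_intros assms) auto
  thus ?thesis by (simp add: abel_sin_def)
qed

lemma abel_sin_1:
  assumes "0 < y" "y < 2 * pi"
  shows "abel_sin 1 y = (pi - y) / 2"
proof -
  define t where "t = y / 2"
  have t: "0 < t" "t < pi" "y = 2 * t" using assms by (auto simp: t_def)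
  have "sin t > 0" using t by (intro sin_gt_zero) auto
  hence "sin y / (1 - cos y) = cos t / sin t"
    unfolding t(3) sin_double cos_double_sin by (simp add: power2_eq_square)
  also have "\<dots> = tan (pi / 2 - t)"
    by (simp add: tan_def sin_diff cos_diff)
  finally have "abel_sin 1 y = arctan (tan (pi / 2 - t))" by (simp add: abel_sin_def)
  also have "\<dots> = pi / 2 - t" using t by (intro arctan_tan) auto
  finally show ?thesis using t by simp
qed

lemma abel_sin_1_neg:
  assumes "- 2 * pi < y" "y < 0"
  shows "abel_sin 1 y = - (pi + y) / 2"
  using abel_sin_1[of "-y"] abel_sin_uminus[of 1 y] assms by simp

lemma abel_sin_1_shift:
  assumes "2 * pi < y" "y < 4 * pi"
  shows "abel_sin 1 y = (3 * pi - y) / 2"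
proof -
  have "abel_sin 1 y = abel_sin 1 (y - 2 * pi)" by (simp add: abel_sin_def sin_diff cos_diff)
  thus ?thesis using abel_sin_1[of "y - 2 * pi"] assms by simp
qed

lemma DERIV_abel_sin:
  assumes "0 \<le> r" "r < 1"
  shows "((\<lambda>y. abel_sin r y) has_real_derivative r * (cos y - r) / (1 - 2 * r * cos y + r\<^sup>2)) (at y)"
proof -
  have pos: "1 - r * cos y > 0" by (rule one_minus_polar_pos[OF assms])
  define c s where "c = cos y" and "s = sin y"
  have cs: "s\<^sup>2 = 1 - c\<^sup>2" by (simp add: c_def s_def sin_squared_eq)
  have "((\<lambda>y. abel_sin r y) has_real_derivative
      inverse (1 + (r * s / (1 - r * c))\<^sup>2) * ((r * c * (1 - r * c) - r * s * (r * s)) / ((1 - r * c) * (1 - r * c)))) (at y)"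
    unfolding abel_sin_def c_def s_def
    using pos by (auto intro!: derivative_eq_intros simp: algebra_simps)
  also have "inverse (1 + (r * s / (1 - r * c))\<^sup>2) * ((r * c * (1 - r * c) - r * s * (r * s)) / ((1 - r * c) * (1 - r * c))) =
      (r * c * (1 - r * c) - r * s * (r * s)) / ((1 - r * c)\<^sup>2 + (r * s)\<^sup>2)"
  proof -
    have "1 + (r * s / (1 - r * c))\<^sup>2 = ((1 - r * c)\<^sup>2 + (r * s)\<^sup>2) / ((1 - r * c) * (1 - r * c))"
      using pos by (simp add: c_def power_divide power2_eq_square add_divide_distrib)
    thus ?thesis using pos by (simp add: c_def)
  qed
  also have "(1 - r * c)\<^sup>2 + (r * s)\<^sup>2 = 1 - 2 * r * c + r\<^sup>2"
    unfolding c_def s_def by (rule norm_one_minus_polar)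
  also have "r * c * (1 - r * c) - r * s * (r * s) = r * (c - r)"
  proof -
    have "r * s * (r * s) = r * r * (1 - c * c)" using cs by (simp add: power2_eq_square)
    thus ?thesis by (simp add: algebra_simps)
  qed
  finally show ?thesis by (simp add: c_def)
qed

text \<open>Supplies, uniformly in \<open>r\<close>, the factor \<open>x\<close> that cancels a
  \<open>1 / x\<close> singularity of the kernel. By oddness the sum is a difference of values at
  \<open>th + x\<close> and \<open>th - x\<close>; the conditions on \<open>e\<close> keep all
  points between them at distance at least \<open>e\<close> from the multiples of
  \<open>2 * pi\<close>, where the derivative blows up as \<open>r\<close> tends to 1.\<close>

lemma abel_sin_diff_le:
  assumes r: "0 \<le> r" "r < 1" and x: "0 < x" "2 * x \<le> th" "th + 2 * x \<le> 2 * pi"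
  assumes e: "x \<le> e" "2 * e \<le> th" "th + 2 * e \<le> 2 * pi"
  shows "\<bar>abel_sin r (x + th) + abel_sin r (x - th)\<bar> \<le> 16 / (1 - cos e)\<^sup>2 * x"
proof -
  have e0: "0 < e" "e < pi" using x e by auto
  have "cos e < cos 0" using e0 by (intro cos_monotone_0_pi) auto
  hence ce: "cos e < 1" by simp
  have der_le: "\<bar>r * (cos y - r) / (1 - 2 * r * cos y + r\<^sup>2)\<bar> \<le> 8 / (1 - cos e)\<^sup>2"
    if y: "e \<le> y" "y \<le> 2 * pi - e" for y
  proof -
    have cy: "cos y \<le> cos e"
    proof (cases "y \<le> pi")
      case True thus ?thesis using y e0 by (intro cos_monotone_0_pi_le) auto
    next
      case False
      have "cos (2 * pi - y) \<le> cos e" using False y e0 by (intro cos_monotone_0_pi_le) auto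
      thus ?thesis by simp
    qed
    \<comment> \<open>A lower bound free of \<open>r\<close>: for \<open>cos y >= 0\<close> it
      follows from \<open>r * cos y <= cos e\<close>, otherwise the left side is at least 1.\<close>
    have "1 - r * cos y \<ge> (1 - cos e) / 2"
    proof (cases "cos y \<ge> 0")
      case True
      have "r * cos y \<le> 1 * cos e" using r True cy by (intro mult_mono) auto
      thus ?thesis using ce by (simp add: field_simps)
    next
      case False
      have "r * cos y \<le> 0" using r False by (intro mult_nonneg_nonpos) auto
      moreover have "(1 - cos e) / 2 \<le> 1" using cos_ge_minus_one[of e] by simp
      ultimately show ?thesis by linarith
    qed
    hence "((1 - cos e) / 2)\<^sup>2 \<le> (1 - r * cos y)\<^sup>2" using ce by (intro power_mono) auto
    also have "\<dots> \<le> (1 - r * cos y)\<^sup>2 + (r * sin y)\<^sup>2" by simp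
    also note norm_one_minus_polar
    finally have den: "(1 - cos e)\<^sup>2 / 4 \<le> 1 - 2 * r * cos y + r\<^sup>2" by (simp add: power_divide)
    have "\<bar>cos y - r\<bar> \<le> 2" using r cos_ge_minus_one[of y] cos_le_one[of y] by linarith
    hence "\<bar>r * (cos y - r)\<bar> \<le> 1 * 2"
      unfolding abs_mult using r by (intro mult_mono) auto
    hence "\<bar>r * (cos y - r) / (1 - 2 * r * cos y + r\<^sup>2)\<bar> \<le> 2 / ((1 - cos e)\<^sup>2 / 4)"
      unfolding abs_divide using order_trans[OF den abs_ge_self] ce by (intro frac_le) auto
    thus ?thesis by simp
  qed
  obtain y where y: "th - x < y" "y < th + x"
    "abel_sin r (th + x) - abel_sin r (th - x) = (th + x - (th - x)) * (r * (cos y - r) / (1 - 2 * r * cos y + r\<^sup>2))"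
    using MVT2[of "th - x" "th + x" "abel_sin r" "\<lambda>y. r * (cos y - r) / (1 - 2 * r * cos y + r\<^sup>2)"] 
      DERIV_abel_sin[OF r] x(1) by auto
  have "\<bar>abel_sin r (th + x) - abel_sin r (th - x)\<bar> = 2 * x * \<bar>r * (cos y - r) / (1 - 2 * r * cos y + r\<^sup>2)\<bar>"
    unfolding y(3) abs_mult using x(1) by simp
  also have "\<dots> \<le> 2 * x * (8 / (1 - cos e)\<^sup>2)"
    using x y e by (intro mult_left_mono der_le) auto
  finally show ?thesis using abel_sin_uminus[of r "th - x"] by (simp add: add.commute mult_ac)
qed

section \<open>Termwise integration of Abel means against a kernel\<close>

lemma bounded_measurable_integrable_on:
  fixes f :: "real \<Rightarrow> real"
  assumes "f \<in> borel_measurable borel" "\<And>x. x \<in> {a..b} \<Longrightarrow> \<bar>f x\<bar> \<le> B"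
  shows "f integrable_on {a..b}"
proof (rule measurable_bounded_by_integrable_imp_integrable[where g = "\<lambda>_. B"])
  have "f \<in> borel_measurable lebesgue" using assms(1) by (intro measurable_completion) simp
  thus "f \<in> borel_measurable (lebesgue_on {a..b})" by (rule measurable_restrict_space1)
qed (use assms in auto)

lemma sums_integral_exchange:
  fixes h :: "nat \<Rightarrow> real \<Rightarrow> real"
  assumes int: "\<And>n. h n integrable_on {a..b}"
    and bd: "\<And>n x. x \<in> {a..b} \<Longrightarrow> \<bar>h n x\<bar> \<le> M n" and M: "summable M"
    and H: "\<And>x. x \<in> {a..b} \<Longrightarrow> (\<lambda>n. h n x) sums H x"
  shows "H integrable_on {a..b}" "(\<lambda>n. integral {a..b} (h n)) sums integral {a..b} H"
proof -
  have bound: "norm (\<Sum>n<N. h n x) \<le> suminf M" if x: "x \<in> {a..b}" for N x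
  proof -
    have "norm (\<Sum>n<N. h n x) \<le> (\<Sum>n<N. M n)"
      by (rule order_trans[OF norm_sum]) (auto intro!: sum_mono bd[OF x])
    also have "\<dots> \<le> suminf M"
      using bd[OF x] by (intro sum_le_suminf M) (auto intro: order_trans[OF abs_ge_zero])
    finally show ?thesis .
  qed
  have int': "(\<lambda>x. \<Sum>n<N. h n x) integrable_on {a..b}" for N by (auto intro!: integrable_sum int)
  have lim: "(\<lambda>N. \<Sum>n<N. h n x) \<longlonglongrightarrow> H x" if "x \<in> {a..b}" for x
    using H[OF that] by (simp add: sums_def)
  note dc = dominated_convergence[OF int' integrable_const_ivl[of "suminf M"] bound lim]
  show "H integrable_on {a..b}" by (rule dc(1))
  have "integral {a..b} (\<lambda>x. \<Sum>n<N. h n x) = (\<Sum>n<N. integral {a..b} (h n))" for N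
    by (rule integral_sum) (auto intro: int)
  thus "(\<lambda>n. integral {a..b} (h n)) sums integral {a..b} H" using dc(2) by (simp add: sums_def)
qed

lemma summable_const_geometric:
  assumes "0 \<le> r" "r < (1::real)"
  shows "summable (\<lambda>n. C * r ^ n)"
  using assms by (intro summable_mult summable_geometric) auto

text \<open>Product-to-sum turns \<open>cos (n th) sin (n x)\<close> into two sines. A kernel as
  large as \<open>C / x\<close> is admissible because \<open>|sin (n x)| <= n x\<close>; the factor
  \<open>n\<close> is absorbed by the denominator, which leaves the majorant
  \<open>C * r ^ n\<close>.\<close>

lemma abel_sine_transform:
  fixes K :: "real \<Rightarrow> real"
  assumes r: "0 \<le> r" "r < 1" and K: "K \<in> borel_measurable borel" "\<And>x. 0 < x \<Longrightarrow> x \<le> X \<Longrightarrow> \<bar>K x\<bar> \<le> C / x"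
    and X: "0 < X"
  shows "(\<lambda>n. r ^ n * cos (real n * th) / real n * integral {0..X} (\<lambda>x. K x * sin (real n * x))) sums
           integral {0..X} (\<lambda>x. K x * ((abel_sin r (x + th) + abel_sin r (x - th)) / 2))"
proof -
  define h where "h = (\<lambda>n x. r ^ n * cos (real n * th) / real n * (K x * sin (real n * x)))"
  have "0 \<le> C / X" using K(2)[of X] X abs_ge_zero[of "K X"] by linarith
  hence C: "C \<ge> 0" using X by (simp add: zero_le_divide_iff)
  have b: "\<bar>K x * sin (real n * x)\<bar> \<le> C * real n" if "x \<in> {0..X}" for x n
  proof (cases "x = 0")
    case False
    have "\<bar>K x * sin (real n * x)\<bar> \<le> C / x * (real n * x)"
      unfolding abs_mult using K(2)[of x] that False C abs_sin_x_le_abs_x[of "real n * x"] by (intro mult_mono) auto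
    thus ?thesis using False by simp
  qed (use C in auto)
  have int: "(\<lambda>x. K x * sin (real n * x)) integrable_on {0..X}" for n
    by (rule bounded_measurable_integrable_on[OF _ b]) (use K(1) in measurable)
  have "(\<lambda>n. integral {0..X} (h n)) sums integral {0..X} (\<lambda>x. K x * ((abel_sin r (x + th) + abel_sin r (x - th)) / 2))"
  proof (rule sums_integral_exchange(2))
    show "h n integrable_on {0..X}" for n unfolding h_def by (intro integrable_on_mult_right int)
    show "\<bar>h n x\<bar> \<le> C * r ^ n" if "x \<in> {0..X}" for n x
    proof -
      have "\<bar>r ^ n * cos (real n * th) / real n\<bar> \<le> r ^ n * 1 / real n"
        using r abs_cos_le_one[of "real n * th"]
        by (simp add: abs_mult abs_divide divide_right_mono mult_left_le)
      hence "\<bar>h n x\<bar> \<le> r ^ n * 1 / real n * (C * real n)"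
        unfolding h_def abs_mult[of "_ / _"] using b[OF that, of n] r
        by (intro mult_mono) auto
      also have "\<dots> \<le> C * r ^ n" using C r by simp
      finally show ?thesis .
    qed
    show "summable (\<lambda>n. C * r ^ n)" by (rule summable_const_geometric[OF r])
    show "(\<lambda>n. h n x) sums (K x * ((abel_sin r (x + th) + abel_sin r (x - th)) / 2))" for x
    proof -
      have "(\<lambda>n. K x * ((r ^ n * sin (real n * (x + th)) / real n + r ^ n * sin (real n * (x - th)) / real n) / 2)) sums
          (K x * ((abel_sin r (x + th) + abel_sin r (x - th)) / 2))"
        by (intro sums_mult sums_divide sums_add abel_sin_sums r)
      moreover have "K x * ((r ^ n * sin (real n * (x + th)) / real n + r ^ n * sin (real n * (x - th)) / real n) / 2) = h n x" for n
        by (cases "n = 0") (simp_all add: h_def distrib_left right_diff_distrib sin_add sin_diff divide_simps)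
      ultimately show ?thesis by simp
    qed
  qed
  thus ?thesis by (simp add: h_def)
qed

text \<open>Dominated convergence with a bound independent of the radius: near 0 it comes from
  \<open>abel_sin_diff_le\<close>, further out from the boundedness of
  \<open>abel_sin\<close>.\<close>

lemma abel_sine_transform_limit:
  fixes K :: "real \<Rightarrow> real" and r :: "nat \<Rightarrow> real"
  assumes r: "\<And>k. 0 \<le> r k" "\<And>k. r k < 1" "r \<longlonglongrightarrow> 1"
    and K: "K \<in> borel_measurable borel" "\<And>x. 0 < x \<Longrightarrow> x \<le> X \<Longrightarrow> \<bar>K x\<bar> \<le> C / x"
    and X: "0 < X" and th: "0 < th" "th < 2 * pi"
  shows "(\<lambda>k. \<Sum>n. r k ^ n * cos (real n * th) / real n * integral {0..X} (\<lambda>x. K x * sin (real n * x)))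
           \<longlonglongrightarrow> integral {0..X} (\<lambda>x. K x * ((abel_sin 1 (x + th) + abel_sin 1 (x - th)) / 2))"
proof -
  define e where "e = min th (2 * pi - th) / 2"
  have e: "0 < e" "2 * e \<le> th" "th + 2 * e \<le> 2 * pi" using th by (auto simp: e_def min_def)
  define B where "B = max (16 / (1 - cos e)\<^sup>2) (pi / e)"
  have "0 \<le> C / X" using K(2)[of X] X abs_ge_zero[of "K X"] by linarith
  hence C: "C \<ge> 0" using X by (simp add: zero_le_divide_iff)
  have B0: "B \<ge> 0" using e by (auto simp: B_def le_max_iff_disj)
  have D: "\<bar>abel_sin (r k) (x + th) + abel_sin (r k) (x - th)\<bar> \<le> B * x" if "0 < x" for x k
  proof (cases "x \<le> e")
    case True
    have "\<bar>abel_sin (r k) (x + th) + abel_sin (r k) (x - th)\<bar> \<le> 16 / (1 - cos e)\<^sup>2 * x"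
      using that True e r by (intro abel_sin_diff_le[where e = e]) auto
    also have "\<dots> \<le> B * x" using that by (intro mult_right_mono) (auto simp: B_def)
    finally show ?thesis .
  next
    case False
    have "\<bar>abel_sin (r k) (x + th) + abel_sin (r k) (x - th)\<bar> \<le> pi / e * e"
      using abs_abel_sin_le[of "r k" "x + th"] abs_abel_sin_le[of "r k" "x - th"] e by simp
    also have "\<dots> \<le> B * x" using False e B0 by (intro mult_mono) (auto simp: B_def)
    finally show ?thesis .
  qed
  have bd: "\<bar>K x * ((abel_sin (r k) (x + th) + abel_sin (r k) (x - th)) / 2)\<bar> \<le> C * B" if "x \<in> {0..X}" for x k
  proof (cases "x = 0")
    case True
    thus ?thesis using C B0 by (simp add: abel_sin_uminus)
  next
    case False
    have "\<bar>K x * ((abel_sin (r k) (x + th) + abel_sin (r k) (x - th)) / 2)\<bar> \<le> C / x * (B * x)"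
      unfolding abs_mult using K(2)[of x] D[of x k] False that C by (intro mult_mono) auto
    thus ?thesis using False by simp
  qed
  have "(\<lambda>k. integral {0..X} (\<lambda>x. K x * ((abel_sin (r k) (x + th) + abel_sin (r k) (x - th)) / 2)))
      \<longlonglongrightarrow> integral {0..X} (\<lambda>x. K x * ((abel_sin 1 (x + th) + abel_sin 1 (x - th)) / 2))"
  proof (rule dominated_convergence(2)[where h = "\<lambda>_. C * B"])
    show "(\<lambda>x. K x * ((abel_sin (r k) (x + th) + abel_sin (r k) (x - th)) / 2)) integrable_on {0..X}" for k
      by (rule bounded_measurable_integrable_on[OF _ bd]) (use K(1) in measurable)
  qed (use bd in \<open>auto intro!: tendsto_intros abel_sin_tendsto r\<close>)
  thus ?thesis using sums_unique[OF abel_sine_transform[OF r(1,2) K X]] by simp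
qed

lemma has_integral_indicator_tail:
  fixes K :: "real \<Rightarrow> real"
  assumes "\<And>t. 0 < t \<Longrightarrow> t < X \<Longrightarrow> (K has_integral P t) {t..X}" "\<And>t. t \<ge> X \<Longrightarrow> P t = 0"
    and t: "0 < t" and X: "0 < X"
  shows "((\<lambda>x. K x * (if t < x then 1 else 0)) has_integral P t) {0..X}"
proof (cases "t < X")
  case True
  have 1: "((\<lambda>x. K x * (if t < x then 1 else 0)) has_integral 0) {0..t}"
    by (rule has_integral_is_0) auto
  have 2: "((\<lambda>x. K x * (if t < x then 1 else 0)) has_integral P t) {t..X}"
    by (rule has_integral_spike_finite[of "{t}" _ _ K]) (use assms(1)[OF t True] in auto)
  from has_integral_combine[OF _ _ 1 2] show ?thesis using t True by simp
next
  case False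
  thus ?thesis using assms(2)[of t] by (auto intro!: has_integral_is_0)
qed

text \<open>The sawtooth jumps by \<open>pi\<close> at the multiples of \<open>2 * pi\<close>. The
  average of its two shifts is therefore \<open>- x / 2\<close> plus \<open>pi / 2\<close> for each
  jump already passed, at \<open>x = th\<close> or \<open>x = 2 * pi - th\<close>. The drift
  \<open>- x / 2\<close> contributes a constant independent of \<open>th\<close>, which disappears
  on summation against a nontrivial character.\<close>

lemma integral_sine_step:
  fixes K :: "real \<Rightarrow> real"
  assumes K: "K \<in> borel_measurable borel" "\<And>x. 0 < x \<Longrightarrow> x \<le> X \<Longrightarrow> \<bar>K x\<bar> \<le> C / x"
    and P: "\<And>t. 0 < t \<Longrightarrow> t < X \<Longrightarrow> (K has_integral P t) {t..X}" "\<And>t. t \<ge> X \<Longrightarrow> P t = 0"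
    and X: "0 < X" "X < pi" and th: "0 < th" "th < 2 * pi"
  shows "integral {0..X} (\<lambda>x. K x * ((abel_sin 1 (x + th) + abel_sin 1 (x - th)) / 2)) =
           pi / 2 * (P th + P (2 * pi - th)) - integral {0..X} (\<lambda>x. K x * x) / 2"
proof (rule integral_unique)
  have "\<bar>K x * x\<bar> \<le> \<bar>C\<bar>" if "x \<in> {0..X}" for x
  proof (cases "x = 0")
    case False
    have "\<bar>K x * x\<bar> \<le> C / x * x"
      unfolding abs_mult using K(2)[of x] False that by (intro mult_mono) (auto intro: order_trans[OF abs_ge_zero])
    also have "\<dots> \<le> \<bar>C\<bar>" using False by simp
    finally show ?thesis .
  qed auto
  hence "(\<lambda>x. K x * x) integrable_on {0..X}"
    by (rule bounded_measurable_integrable_on[rotated]) (use K(1) in measurable)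
  hence "((\<lambda>x. K x * x) has_integral integral {0..X} (\<lambda>x. K x * x)) {0..X}"
    by (rule integrable_integral)
  hence "((\<lambda>x. pi / 2 * (K x * (if th < x then 1 else 0) + K x * (if 2 * pi - th < x then 1 else 0)) - K x * x / 2) has_integral
      (pi / 2 * (P th + P (2 * pi - th)) - integral {0..X} (\<lambda>x. K x * x) / 2)) {0..X}"
    using th by (intro has_integral_diff has_integral_mult_right has_integral_add has_integral_divide
        has_integral_indicator_tail[OF P _ X(1)]) auto
  thus "((\<lambda>x. K x * ((abel_sin 1 (x + th) + abel_sin 1 (x - th)) / 2)) has_integral
      (pi / 2 * (P th + P (2 * pi - th)) - integral {0..X} (\<lambda>x. K x * x) / 2)) {0..X}"
  proof (rule has_integral_spike_finite[of "{0, th, 2 * pi - th}", rotated 2])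
    fix x assume x: "x \<in> {0..X} - {0, th, 2 * pi - th}"
    have "(abel_sin 1 (x + th) + abel_sin 1 (x - th)) / 2 =
        pi / 2 * ((if th < x then 1 else 0) + (if 2 * pi - th < x then 1 else 0)) - x / 2"
    proof (cases "th < x")
      case True
      hence "abel_sin 1 (x + th) = (pi - (x + th)) / 2" "abel_sin 1 (x - th) = (pi - (x - th)) / 2"
        using x X th by (intro abel_sin_1; auto)+
      thus ?thesis using True x X by (simp add: field_simps)
    next
      case False
      hence m: "abel_sin 1 (x - th) = - (pi + (x - th)) / 2"
        using x X th by (intro abel_sin_1_neg) auto
      show ?thesis
      proof (cases "2 * pi - th < x")
        case True
        hence "abel_sin 1 (x + th) = (3 * pi - (x + th)) / 2"
          using x X th by (intro abel_sin_1_shift) auto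
        thus ?thesis using True False m by (simp add: field_simps)
      next
        case F2: False
        hence "abel_sin 1 (x + th) = (pi - (x + th)) / 2"
          using x X th by (intro abel_sin_1) auto
        thus ?thesis using F2 False m by (simp add: field_simps)
      qed
    qed
    thus "K x * ((abel_sin 1 (x + th) + abel_sin 1 (x - th)) / 2) =
       pi / 2 * (K x * (if th < x then 1 else 0) + K x * (if 2 * pi - th < x then 1 else 0)) - K x * x / 2"
      by (simp only:) (simp add: algebra_simps)
  qed auto
qed

lemma abel_cosine_transform:
  fixes K :: "real \<Rightarrow> real"
  assumes r: "0 \<le> r" "r < 1" and K: "K \<in> borel_measurable borel" "\<And>x. 0 \<le> x \<Longrightarrow> x \<le> X \<Longrightarrow> \<bar>K x\<bar> \<le> C"
    and X: "0 < X"
  shows "(\<lambda>n. r ^ n * sin (real n * th) / real n * integral {0..X} (\<lambda>x. K x * (1 - cos (real n * x)))) sums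
           integral {0..X} (\<lambda>x. K x * (abel_sin r th - (abel_sin r (th + x) + abel_sin r (th - x)) / 2))"
proof -
  define h where "h = (\<lambda>n x. r ^ n * sin (real n * th) / real n * (K x * (1 - cos (real n * x))))"
  have C: "C \<ge> 0" using K(2)[of X] X by auto
  have b: "\<bar>K x * (1 - cos (real n * x))\<bar> \<le> C * 2" if "x \<in> {0..X}" for x n
    unfolding abs_mult using K(2)[of x] that C cos_ge_minus_one[of "real n * x"] by (intro mult_mono) auto
  have int: "(\<lambda>x. K x * (1 - cos (real n * x))) integrable_on {0..X}" for n
    by (rule bounded_measurable_integrable_on[OF _ b]) (use K(1) in measurable)
  have "(\<lambda>n. integral {0..X} (h n)) sums integral {0..X} (\<lambda>x. K x * (abel_sin r th - (abel_sin r (th + x) + abel_sin r (th - x)) / 2))"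
  proof (rule sums_integral_exchange(2))
    show "h n integrable_on {0..X}" for n unfolding h_def by (intro integrable_on_mult_right int)
    show "\<bar>h n x\<bar> \<le> (C * 2) * r ^ n" if "x \<in> {0..X}" for n x
    proof -
      have "\<bar>r ^ n * sin (real n * th) / real n\<bar> \<le> r ^ n * 1 / 1"
      proof (cases "n = 0")
        case False
        have "\<bar>r ^ n\<bar> * \<bar>sin (real n * th)\<bar> \<le> r ^ n * 1" using r by (intro mult_mono) auto
        thus ?thesis unfolding abs_mult abs_divide using r False by (intro frac_le) auto
      qed (use r in auto)
      hence "\<bar>h n x\<bar> \<le> r ^ n * 1 / 1 * (C * 2)"
        unfolding h_def abs_mult[of "_ / _"] using b[OF that, of n] r by (intro mult_mono) auto
      thus ?thesis by (simp add: mult_ac)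
    qed
    show "summable (\<lambda>n. (C * 2) * r ^ n)" by (rule summable_const_geometric[OF r])
    show "(\<lambda>n. h n x) sums (K x * (abel_sin r th - (abel_sin r (th + x) + abel_sin r (th - x)) / 2))" for x
    proof -
      have "(\<lambda>n. K x * (r ^ n * sin (real n * th) / real n -
            (r ^ n * sin (real n * (th + x)) / real n + r ^ n * sin (real n * (th - x)) / real n) / 2)) sums
          (K x * (abel_sin r th - (abel_sin r (th + x) + abel_sin r (th - x)) / 2))"
        by (intro sums_mult sums_divide sums_add sums_diff abel_sin_sums r)
      moreover have "K x * (r ^ n * sin (real n * th) / real n -
            (r ^ n * sin (real n * (th + x)) / real n + r ^ n * sin (real n * (th - x)) / real n) / 2) = h n x" for n
        by (cases "n = 0") (simp_all add: h_def distrib_left right_diff_distrib sin_add sin_diff divide_simps)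
      ultimately show ?thesis by simp
    qed
  qed
  thus ?thesis by (simp add: h_def)
qed

lemma abel_cosine_transform_limit:
  fixes K :: "real \<Rightarrow> real" and r :: "nat \<Rightarrow> real"
  assumes r: "\<And>k. 0 \<le> r k" "\<And>k. r k < 1" "r \<longlonglongrightarrow> 1"
    and K: "K \<in> borel_measurable borel" "\<And>x. 0 \<le> x \<Longrightarrow> x \<le> X \<Longrightarrow> \<bar>K x\<bar> \<le> C"
    and X: "0 < X"
  shows "(\<lambda>k. \<Sum>n. r k ^ n * sin (real n * th) / real n * integral {0..X} (\<lambda>x. K x * (1 - cos (real n * x))))
           \<longlonglongrightarrow> integral {0..X} (\<lambda>x. K x * (abel_sin 1 th - (abel_sin 1 (th + x) + abel_sin 1 (th - x)) / 2))"
proof -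
  have C: "C \<ge> 0" using K(2)[of X] X by auto
  have bd: "\<bar>K x * (abel_sin (r k) th - (abel_sin (r k) (th + x) + abel_sin (r k) (th - x)) / 2)\<bar> \<le> C * pi"
    if "x \<in> {0..X}" for x k
  proof -
    have "\<bar>abel_sin (r k) th - (abel_sin (r k) (th + x) + abel_sin (r k) (th - x)) / 2\<bar> \<le> pi"
      using abs_abel_sin_le[of "r k" th] abs_abel_sin_le[of "r k" "th + x"] abs_abel_sin_le[of "r k" "th - x"]
      by argo
    thus ?thesis unfolding abs_mult using K(2)[of x] that C by (intro mult_mono) auto
  qed
  have "(\<lambda>k. integral {0..X} (\<lambda>x. K x * (abel_sin (r k) th - (abel_sin (r k) (th + x) + abel_sin (r k) (th - x)) / 2)))
      \<longlonglongrightarrow> integral {0..X} (\<lambda>x. K x * (abel_sin 1 th - (abel_sin 1 (th + x) + abel_sin 1 (th - x)) / 2))"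
  proof (rule dominated_convergence(2)[where h = "\<lambda>_. C * pi"])
    show "(\<lambda>x. K x * (abel_sin (r k) th - (abel_sin (r k) (th + x) + abel_sin (r k) (th - x)) / 2)) integrable_on {0..X}" for k
      by (rule bounded_measurable_integrable_on[OF _ bd]) (use K(1) in measurable)
  qed (use bd in \<open>auto intro!: tendsto_intros abel_sin_tendsto r\<close>)
  thus ?thesis using sums_unique[OF abel_cosine_transform[OF r(1,2) K X]] by simp
qed

text \<open>As in the sine case, but the drifts cancel and the jump at \<open>2 * pi - th\<close>
  enters with the opposite sign.\<close>

lemma integral_cosine_step:
  fixes K :: "real \<Rightarrow> real"
  assumes P: "\<And>t. 0 < t \<Longrightarrow> t < X \<Longrightarrow> (K has_integral P t) {t..X}" "\<And>t. t \<ge> X \<Longrightarrow> P t = 0"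
    and X: "0 < X" "X < pi" and th: "0 < th" "th < 2 * pi"
  shows "integral {0..X} (\<lambda>x. K x * (abel_sin 1 th - (abel_sin 1 (th + x) + abel_sin 1 (th - x)) / 2)) =
           pi / 2 * (P th - P (2 * pi - th))"
proof (rule integral_unique)
  have "((\<lambda>x. pi / 2 * (K x * (if th < x then 1 else 0) - K x * (if 2 * pi - th < x then 1 else 0))) has_integral
      (pi / 2 * (P th - P (2 * pi - th)))) {0..X}"
    using th by (intro has_integral_diff has_integral_mult_right
        has_integral_indicator_tail[OF P _ X(1)]) auto
  thus "((\<lambda>x. K x * (abel_sin 1 th - (abel_sin 1 (th + x) + abel_sin 1 (th - x)) / 2)) has_integral
      (pi / 2 * (P th - P (2 * pi - th)))) {0..X}"
  proof (rule has_integral_spike_finite[of "{0, th, 2 * pi - th}", rotated 2])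
    fix x assume x: "x \<in> {0..X} - {0, th, 2 * pi - th}"
    have t: "abel_sin 1 th = (pi - th) / 2" using th by (rule abel_sin_1)
    have "abel_sin 1 th - (abel_sin 1 (th + x) + abel_sin 1 (th - x)) / 2 =
        pi / 2 * ((if th < x then 1 else 0) - (if 2 * pi - th < x then 1 else 0))"
    proof (cases "th < x")
      case True
      hence "abel_sin 1 (th + x) = (pi - (th + x)) / 2" "abel_sin 1 (th - x) = - (pi + (th - x)) / 2"
        using x X th by (intro abel_sin_1 abel_sin_1_neg; auto)+
      thus ?thesis using True x X t by (simp add: field_simps)
    next
      case False
      hence m: "abel_sin 1 (th - x) = (pi - (th - x)) / 2"
        using x X th by (intro abel_sin_1) auto
      show ?thesis
      proof (cases "2 * pi - th < x")
        case True
        hence "abel_sin 1 (th + x) = (3 * pi - (th + x)) / 2"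
          using x X th by (intro abel_sin_1_shift) auto
        thus ?thesis using True False m t by (simp add: field_simps)
      next
        case F2: False
        hence "abel_sin 1 (th + x) = (pi - (th + x)) / 2"
          using x X th by (intro abel_sin_1) auto
        thus ?thesis using F2 False m t by (simp add: field_simps)
      qed
    qed
    thus "K x * (abel_sin 1 th - (abel_sin 1 (th + x) + abel_sin 1 (th - x)) / 2) =
       pi / 2 * (K x * (if th < x then 1 else 0) - K x * (if 2 * pi - th < x then 1 else 0))"
      by (simp only:) (simp add: algebra_simps)
  qed auto
qed

section \<open>Character sums and the splitting of the L-value\<close>

lemma primitive_imp_character: "primitive_character q chi \<Longrightarrow> dirichlet_character q chi"
  by (simp add: primitive_character_def)

text \<open>Separability at \<open>n = 0\<close>, where \<open>chi 0 = 0\<close> because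
  \<open>q > 1\<close>.\<close>

lemma sum_character_eq_0:
  assumes "primitive_character q chi" "q > 1"
  shows "(\<Sum>a\<in>{0..<int q}. chi a) = 0"
proof -
  have "\<not> coprime 0 (int q)" using assms(2) by simp
  hence "chi 0 = 0" using dirichlet_characterD(4)[OF primitive_imp_character[OF assms(1)], of 0] by simp
  hence "gauss_sum q chi 0 = 0" using gauss_sum_separable[OF assms(1), of 0] by simp
  hence "cnj (\<Sum>a\<in>{0..<int q}. chi a) = 0" by (simp add: gauss_sum_def unit_root_def)
  thus ?thesis by (metis complex_cnj_zero_iff)
qed

text \<open>Complete periods cancel, leaving fewer than \<open>q\<close> terms of norm at most
  1.\<close>

lemma character_partial_sum_bound:
  assumes "primitive_character q chi" "q > 1"
  shows "norm (\<Sum>n<N. chi (int n)) \<le> real q"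
proof -
  note chi = primitive_imp_character[OF assms(1)]
  have "(\<Sum>n<q. chi (int n)) = (\<Sum>a\<in>{0..<int q}. chi a)"
    by (rule sum.reindex_bij_witness[of _ nat int]) auto
  hence zero: "(\<Sum>n<q. chi (int n)) = 0" using sum_character_eq_0[OF assms] by simp
  have "(\<Sum>n\<in>{m * q..<m * q + q}. chi (int n)) = (\<Sum>n<q. chi (int n))" for m
  proof (rule sum.reindex_bij_witness[of _ "\<lambda>n. n + m * q" "\<lambda>n. n - m * q"])
    fix n assume "n \<in> {m * q..<m * q + q}"
    thus "chi (int (n - m * q)) = chi (int n)"
      by (intro character_cong[OF chi]) (auto simp: of_nat_diff cong_iff_dvd_diff)
  qed auto
  hence block: "(\<Sum>n<m * q. chi (int n)) = 0" for m
    using sum.nat_group[of "\<lambda>n. chi (int n)" q m] zero by simp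
  define M where "M = (N div q) * q"
  have M: "M \<le> N" "N - M < q"
    using assms(2) unfolding M_def by (auto simp: minus_div_mult_eq_mod)
  have "(\<Sum>n<N. chi (int n)) = (\<Sum>n<M. chi (int n)) + (\<Sum>n\<in>{M..<N}. chi (int n))"
    using M(1) by (metis lessThan_atLeast0 sum.atLeastLessThan_concat zero_le)
  also have "(\<Sum>n<M. chi (int n)) = 0" unfolding M_def by (rule block)
  finally have "norm (\<Sum>n<N. chi (int n)) \<le> (\<Sum>n\<in>{M..<N}. norm (chi (int n)))"
    using norm_sum[of "\<lambda>n. chi (int n)" "{M..<N}"] by simp
  also have "\<dots> \<le> (\<Sum>n\<in>{M..<N}. 1)" by (intro sum_mono norm_character_le_1[OF chi])
  also have "\<dots> \<le> real q" using M by simp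
  finally show ?thesis .
qed

text \<open>Ties the abstract continuation to the conditionally convergent series: bounded partial
  sums give a holomorphic sum on \<open>Re z > 0\<close>, which is a continuation past 1.\<close>

lemma dirichlet_L_one_sums:
  assumes "primitive_character q chi" "q > 1"
  shows "(\<lambda>n. chi (int n) / of_nat n) sums dirichlet_L chi 1"
proof -
  have "\<not> coprime 0 (int q)" using assms(2) by simp
  hence chi0: "chi 0 = 0" using dirichlet_characterD(4)[OF primitive_imp_character[OF assms(1)], of 0] by simp
  have bd: "norm (\<Sum>n<N. chi (int (Suc n))) \<le> real q" for N
    using character_partial_sum_bound[OF assms, of "Suc N"] chi0
    by (simp add: sum.lessThan_Suc_shift del: sum.lessThan_Suc)
  obtain f where f: "f holomorphic_on {z. Re z > 0}"
    "\<And>z. Re z > 0 \<Longrightarrow> (\<lambda>n. chi (int (Suc n)) / of_nat (Suc n) powr z) sums f z"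
    using dirichlet_series_bounded_partial_sums[OF bd] by blast
  have "L_continuation chi 1 f" unfolding L_continuation_def
  proof (intro conjI exI allI impI)
    show "0 < Re (1::complex)" by simp
    show "f holomorphic_on insert 1 ({z. 0 < Re z} - {1})"
      by (rule holomorphic_on_subset[OF f(1)]) auto
  qed (use f(2) in auto)
  hence "dirichlet_L chi 1 = f 1" by (rule dirichlet_L_eqI)
  with f(2)[of 1] have "(\<lambda>n. chi (int (Suc n)) / of_nat (Suc n)) sums dirichlet_L chi 1"
    by (simp del: of_nat_Suc)
  thus ?thesis using sums_Suc_iff[of "\<lambda>n. chi (int n) / of_nat n"] by (simp del: of_nat_Suc)
qed

lemma L_one_abel_limit:
  assumes "primitive_character q chi" "q > 1" and r: "\<And>k. 0 \<le> r k" "\<And>k. r k < 1" "r \<longlonglongrightarrow> 1"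
  shows "(\<lambda>k. \<Sum>n. chi (int n) * of_real (r k ^ n / real n)) \<longlonglongrightarrow> dirichlet_L chi 1"
  using Abel_limit[OF dirichlet_L_one_sums[OF assms(1,2)] r] by (simp add: field_simps)

section \<open>Finite Fourier expansion of the character\<close>

lemma gauss_expansion:
  assumes "primitive_character q chi" "q > 1"
  shows "chi n * gauss_sum q chi 1 = (\<Sum>a\<in>{1..<int q}. cnj (chi a) * unit_root q (a * n))"
proof -
  have "\<not> coprime 0 (int q)" using assms(2) by simp
  hence chi0: "chi 0 = 0" using dirichlet_characterD(4)[OF primitive_imp_character[OF assms(1)], of 0] by simp
  have "{0..<int q} = insert 0 {1..<int q}" using assms(2) by auto
  thus ?thesis using gauss_sum_separable[OF assms(1), of n] chi0 by (simp add: gauss_sum_def)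
qed

text \<open>Averaging the expansions at \<open>n\<close> and \<open>- n\<close> leaves the cosines
  only.\<close>

lemma gauss_expansion_even:
  assumes "primitive_character q chi" "q > 1" "chi (-1) = 1"
  shows "chi (int n) * gauss_sum q chi 1 =
    (\<Sum>a\<in>{1..<int q}. cnj (chi a) * of_real (cos (real n * (2 * pi * of_int a / real q))))"
proof -
  have "chi (- int n) = chi (int n)"
    using dirichlet_characterD(2)[OF primitive_imp_character[OF assms(1)], of "-1" "int n"] assms(3) by simp
  hence "2 * (chi (int n) * gauss_sum q chi 1) = 
      (\<Sum>a\<in>{1..<int q}. cnj (chi a) * (unit_root q (a * int n) + unit_root q (a * - int n)))"
    using gauss_expansion[OF assms(1,2), of "int n"] gauss_expansion[OF assms(1,2), of "- int n"]
    by (simp add: distrib_left sum.distrib)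
  also have "\<dots> = (\<Sum>a\<in>{1..<int q}. 2 * (cnj (chi a) * of_real (cos (real n * (2 * pi * of_int a / real q)))))"
    by (intro sum.cong refl) (simp add: unit_root_def complex_eq_iff mult_ac)
  finally show ?thesis by (simp add: sum_distrib_left[symmetric])
qed

lemma gauss_expansion_odd:
  assumes "primitive_character q chi" "q > 1" "chi (-1) = -1"
  shows "chi (int n) * gauss_sum q chi 1 =
    \<i> * (\<Sum>a\<in>{1..<int q}. cnj (chi a) * of_real (sin (real n * (2 * pi * of_int a / real q))))"
proof -
  have "chi (- int n) = - chi (int n)"
    using dirichlet_characterD(2)[OF primitive_imp_character[OF assms(1)], of "-1" "int n"] assms(3) by simp
  hence "2 * (chi (int n) * gauss_sum q chi 1) = 
      (\<Sum>a\<in>{1..<int q}. cnj (chi a) * (unit_root q (a * int n) - unit_root q (a * - int n)))"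
    using gauss_expansion[OF assms(1,2), of "int n"] gauss_expansion[OF assms(1,2), of "- int n"]
    by (simp add: right_diff_distrib sum_subtractf) (metis minus_minus)
  also have "\<dots> = (\<Sum>a\<in>{1..<int q}. 2 * (\<i> * (cnj (chi a) * of_real (sin (real n * (2 * pi * of_int a / real q))))))"
    by (intro sum.cong refl) (simp add: unit_root_def complex_eq_iff mult_ac)
  finally show ?thesis by (simp add: sum_distrib_left[symmetric])
qed

text \<open>Used with \<open>c = 1\<close> and cosines for even characters, with
  \<open>c = \<i>\<close> and sines for odd ones; \<open>F\<close> is the weight
  \<open>1 - g\<close>. The sum over residues is finite, so the limit is taken for each residue
  separately.\<close>

lemma character_series_limit:
  fixes T :: "int \<Rightarrow> nat \<Rightarrow> real" and F :: "nat \<Rightarrow> real" and c :: complex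
  assumes tau: "tau \<noteq> 0" and exp: "\<And>n. chi (int n) * tau = c * (\<Sum>a\<in>A. cnj (chi a) * of_real (T a n))"
    and summ: "\<And>a k. a \<in> A \<Longrightarrow> summable (\<lambda>n. r k ^ n * T a n / real n * F n)"
    and lim: "\<And>a. a \<in> A \<Longrightarrow> (\<lambda>k. \<Sum>n. r k ^ n * T a n / real n * F n) \<longlonglongrightarrow> L a"
  shows "(\<lambda>n. chi (int n) * of_real (r k ^ n / real n * F n)) sums
           (c / tau * (\<Sum>a\<in>A. cnj (chi a) * of_real (\<Sum>n. r k ^ n * T a n / real n * F n)))" (is ?th1)
    and "(\<lambda>k. \<Sum>n. chi (int n) * of_real (r k ^ n / real n * F n)) \<longlonglongrightarrow>
           c / tau * (\<Sum>a\<in>A. cnj (chi a) * of_real (L a))" (is ?th2)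
proof -
  have eq: "c / tau * (\<Sum>a\<in>A. cnj (chi a) * of_real (r k ^ n * T a n / real n * F n)) =
      chi (int n) * of_real (r k ^ n / real n * F n)" for n k
  proof -
    have "c / tau * (\<Sum>a\<in>A. cnj (chi a) * of_real (r k ^ n * T a n / real n * F n)) =
        (c * (\<Sum>a\<in>A. cnj (chi a) * of_real (T a n))) / tau * of_real (r k ^ n / real n * F n)"
      by (simp add: sum_distrib_left sum_distrib_right sum_divide_distrib mult_ac)
    also have "c * (\<Sum>a\<in>A. cnj (chi a) * of_real (T a n)) = chi (int n) * tau" by (simp only: exp)
    finally show ?thesis using tau by simp
  qed
  have s: "(\<lambda>n. chi (int n) * of_real (r k ^ n / real n * F n)) sums
           (c / tau * (\<Sum>a\<in>A. cnj (chi a) * of_real (\<Sum>n. r k ^ n * T a n / real n * F n)))" for k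
    unfolding eq[symmetric] by (intro sums_mult sums_sum sums_of_real summable_sums summ)
  show ?th1 by (rule s)
  have "(\<lambda>k. c / tau * (\<Sum>a\<in>A. cnj (chi a) * of_real (\<Sum>n. r k ^ n * T a n / real n * F n))) \<longlonglongrightarrow>
           c / tau * (\<Sum>a\<in>A. cnj (chi a) * of_real (L a))"
    by (intro tendsto_intros lim)
  thus ?th2 using sums_unique[OF s] by simp
qed

text \<open>The part with weight \<open>g\<close> is estimated in absolute value;
  \<open>g >= 0\<close> is what lets its majorant be the same series with \<open>chi\<close>
  replaced by \<open>w\<close>, which can be summed in closed form. Cancellation in
  \<open>chi\<close> is exploited in the part with weight \<open>1 - g\<close>, whose limit is
  \<open>M\<close>.\<close>

lemma L_one_bound:
  fixes g w :: "nat \<Rightarrow> real" and r :: "nat \<Rightarrow> real"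
  assumes prim: "primitive_character q chi" "q > 1" and r: "\<And>k. 0 \<le> r k" "\<And>k. r k < 1" "r \<longlonglongrightarrow> 1"
    and g: "\<And>n. n > 0 \<Longrightarrow> 0 \<le> g n"
    and w: "\<And>n. norm (chi (int n)) \<le> w n"
    and S: "\<And>k. (\<lambda>n. w n * (r k ^ n / real n * g n)) sums s k"
    and s: "\<And>k. s k \<le> u k" "u \<longlonglongrightarrow> U"
    and F: "\<And>k. summable (\<lambda>n. chi (int n) * of_real (r k ^ n / real n * (1 - g n)))"
      "(\<lambda>k. \<Sum>n. chi (int n) * of_real (r k ^ n / real n * (1 - g n))) \<longlonglongrightarrow> M"
  shows "norm (dirichlet_L chi 1) \<le> U + norm M"
proof -
  have le: "norm (\<Sum>n. chi (int n) * of_real (r k ^ n / real n)) \<le>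
      u k + norm (\<Sum>n. chi (int n) * of_real (r k ^ n / real n * (1 - g n)))" for k
  proof -
    define a where "a = (\<lambda>n. chi (int n) * of_real (r k ^ n / real n * g n))"
    have na: "norm (a n) \<le> w n * (r k ^ n / real n * g n)" for n
    proof (cases "n = 0")
      case False
      have p: "0 \<le> r k ^ n / real n * g n" using g[of n] r(1)[of k] False by simp
      thus ?thesis unfolding a_def norm_mult norm_of_real abs_of_nonneg[OF p]
        by (intro mult_right_mono w)
    qed (simp add: a_def)
    have sa: "summable (\<lambda>n. norm (a n))"
      by (rule summable_comparison_test'[OF sums_summable[OF S[of k]], of 0]) (use na in auto)
    have "norm (suminf a) \<le> (\<Sum>n. norm (a n))" by (rule summable_norm[OF sa])
    also have "\<dots> \<le> (\<Sum>n. w n * (r k ^ n / real n * g n))"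
      by (intro suminf_le na sa sums_summable[OF S])
    also have "\<dots> = s k" using sums_unique[OF S[of k]] by simp
    finally have 1: "norm (suminf a) \<le> u k" using s(1)[of k] by linarith
    have "(\<lambda>n. a n + chi (int n) * of_real (r k ^ n / real n * (1 - g n))) sums
        (suminf a + (\<Sum>n. chi (int n) * of_real (r k ^ n / real n * (1 - g n))))"
      by (intro sums_add summable_sums F(1) summable_norm_cancel[OF sa])
    moreover have "a n + chi (int n) * of_real (r k ^ n / real n * (1 - g n)) = chi (int n) * of_real (r k ^ n / real n)" for n
    proof -
      have "r k ^ n / real n * g n + r k ^ n / real n * (1 - g n) = r k ^ n / real n" by (simp add: right_diff_distrib)
      thus ?thesis by (simp only: a_def flip: distrib_left of_real_add)
    qed
    ultimately have "(\<Sum>n. chi (int n) * of_real (r k ^ n / real n)) =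
       suminf a + (\<Sum>n. chi (int n) * of_real (r k ^ n / real n * (1 - g n)))"
      by (simp add: sums_iff)
    thus ?thesis using 1 norm_triangle_ineq[of "suminf a"] by (smt (verit))
  qed
  show ?thesis
    by (rule LIMSEQ_le[OF tendsto_norm[OF L_one_abel_limit[OF prim r]] tendsto_add[OF s(2) tendsto_norm[OF F(2)]]])
       (use le in auto)
qed

text \<open>On each block of length 3 the tangent at \<open>3 j + 1\<close> is integrated over the
  first half and the tangent at \<open>3 j + 2\<close> over the second. The nodes lie symmetrically,
  each 1/4 away from the midpoint of its half, so the slope terms combine to a multiple of
  \<open>d (3 j + 2) - d (3 j + 1)\<close>, which is nonnegative.\<close>

lemma sum_coprime3_le_integral:
  fixes f d :: "real \<Rightarrow> real"
  assumes tan: "\<And>x y. 0 < x \<Longrightarrow> 0 < y \<Longrightarrow> f x + d x * (y - x) \<le> f y"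
    and mono: "\<And>x y. 0 < x \<Longrightarrow> x \<le> y \<Longrightarrow> d x \<le> d y"
    and int: "f integrable_on {0..3 * real N}"
  shows "(\<Sum>j<N. f (3 * real j + 1) + f (3 * real j + 2)) \<le> 2 / 3 * integral {0..3 * real N} f"
  using int
proof (induction N)
  case (Suc N)
  define a where "a = 3 * real N"
  have a: "a \<ge> 0" by (simp add: a_def)
  have aS: "3 * real (Suc N) = a + 3" by (simp add: a_def)
  have i: "f integrable_on {0..a + 3}" using Suc.prems by (simp only: aS)
  have i1: "f integrable_on {0..a}" and i2: "f integrable_on {a..a+3}"
    and i3: "f integrable_on {a..a+3/2}" and i4: "f integrable_on {a+3/2..a+3}"
    using a by (auto intro: integrable_on_subinterval[OF i])
  have lin: "((\<lambda>y. p + s * (y - c)) has_integral (p * (v - u) + s * ((v - c)\<^sup>2 / 2 - (u - c)\<^sup>2 / 2))) {u..v}"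
    if "u \<le> v" for p s c u v :: real
  proof -
    have "((\<lambda>y. p + s * (y - c)) has_integral ((p * v + s * ((v - c)\<^sup>2 / 2)) - (p * u + s * ((u - c)\<^sup>2 / 2)))) {u..v}"
      by (rule fundamental_theorem_of_calculus[OF that])
         (auto intro!: derivative_eq_intros simp flip: has_real_derivative_iff_has_vector_derivative)
    thus ?thesis by (simp add: algebra_simps)
  qed
  have A: "f (a + 1) * (3/2) - d (a + 1) * (3/8) \<le> integral {a..a+3/2} f"
  proof (rule has_integral_le[OF _ integrable_integral[OF i3]])
    have "((\<lambda>y. f (a + 1) + d (a + 1) * (y - (a + 1))) has_integral
       (f (a + 1) * (3/2) - d (a + 1) * (3/8))) {a..a+3/2}"
      using lin[of a "a + 3/2" "f (a+1)" "d (a+1)" "a+1"] by (simp add: power2_eq_square)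
    \<comment> \<open>The tangent inequality is available at positive points only, because
      \<open>f\<close> may be singular at 0; changing one value leaves the integral alone.\<close>
    thus "((\<lambda>y. if y = 0 then f 0 else f (a + 1) + d (a + 1) * (y - (a + 1))) has_integral
       (f (a + 1) * (3/2) - d (a + 1) * (3/8))) {a..a+3/2}"
      by (rule has_integral_spike_finite[of "{0}", rotated 2]) auto
  qed (use tan[of "a + 1"] a in auto)
  have B: "f (a + 2) * (3/2) + d (a + 2) * (3/8) \<le> integral {a+3/2..a+3} f"
  proof (rule has_integral_le[OF _ integrable_integral[OF i4]])
    show "((\<lambda>y. f (a + 2) + d (a + 2) * (y - (a + 2))) has_integral
       (f (a + 2) * (3/2) + d (a + 2) * (3/8))) {a+3/2..a+3}"
      using lin[of "a + 3/2" "a + 3" "f (a+2)" "d (a+2)" "a+2"] by (simp add: power2_eq_square)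
  qed (use tan[of "a + 2"] a in auto)
  have "d (a + 1) \<le> d (a + 2)" using a by (intro mono) auto
  moreover have "integral {0..a+3} f = integral {0..a} f + (integral {a..a+3/2} f + integral {a+3/2..a+3} f)"
    using Henstock_Kurzweil_Integration.integral_combine[OF _ _ i, of a]
      Henstock_Kurzweil_Integration.integral_combine[OF _ _ i2, of "a+3/2"] a by simp
  moreover have "(\<Sum>j<N. f (3 * real j + 1) + f (3 * real j + 2)) \<le> 2 / 3 * integral {0..a} f"
    using Suc.IH i1 by (simp add: a_def)
  ultimately show ?case using A B unfolding aS by (simp add: a_def)
qed auto

section \<open>Sums over integers prime to three\<close>

lemma sin_ge_cubic:
  fixes y :: real
  assumes "0 \<le> y"
  shows "y - y ^ 3 / 6 \<le> sin y"
proof -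
  have "\<bar>sin y - y\<bar> \<le> y ^ 3 / 6"
    using Maclaurin_sin_bound[of y 3] assms by (simp add: sin_coeff_def eval_nat_numeral)
  thus ?thesis by linarith
qed

lemma sums_mult_three:
  fixes h :: "nat \<Rightarrow> real"
  assumes "(\<lambda>m. h (3 * m)) sums s"
  shows "(\<lambda>n. if 3 dvd n then h n else 0) sums s"
proof (subst sums_mono_reindex[of "\<lambda>m. 3 * m", symmetric])
  show "strict_mono (\<lambda>m::nat. 3 * m)" by (simp add: strict_mono_def)
qed (use assms in auto)

definition coprime3 :: "nat \<Rightarrow> real" where
  "coprime3 n = (if 3 dvd n then 0 else 1)"

text \<open>The terms with \<open>3 dvd n\<close> form the same series at radius
  \<open>r ^ 3\<close> and angle \<open>3 * x\<close>, divided by 3.\<close>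

lemma abel_coprime3:
  fixes r x :: real
  assumes r: "0 \<le> r" "r < 1"
  shows abel_coprime3_sin: "(\<lambda>n. coprime3 n * (r ^ n * sin (real n * x) / real n)) sums
      (abel_sin r x - abel_sin (r ^ 3) (3 * x) / 3)"
    and abel_coprime3_cos: "(\<lambda>n. coprime3 n * (r ^ n * cos (real n * x) / real n)) sums
      (- (1/2) * ln (1 - 2 * r * cos x + r\<^sup>2) + (1/6) * ln (1 - 2 * r ^ 3 * cos (3 * x) + (r ^ 3)\<^sup>2))"
proof -
  have r3: "0 \<le> r ^ 3" "r ^ 3 < 1" using r by (auto simp: power_less_one_iff)
  have 1: "(\<lambda>m. r ^ (3 * m) * f (real (3 * m) * x) / real (3 * m)) sums (s / 3)"
    if "(\<lambda>n. (r ^ 3) ^ n * f (real n * (3 * x)) / real n) sums s" for f s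
    using sums_divide[OF that, of 3] by (simp add: mult_ac flip: power_mult)
  have 2: "(\<lambda>n. coprime3 n * (r ^ n * f (real n * x) / real n)) sums (t - s / 3)"
    if "(\<lambda>n. (r ^ 3) ^ n * f (real n * (3 * x)) / real n) sums s" "(\<lambda>n. r ^ n * f (real n * x) / real n) sums t" for f s t
  proof -
    have "(\<lambda>n. r ^ n * f (real n * x) / real n - (if 3 dvd n then r ^ n * f (real n * x) / real n else 0)) sums (t - s / 3)"
      by (intro sums_diff that sums_mult_three 1)
    moreover have "r ^ n * f (real n * x) / real n - (if 3 dvd n then r ^ n * f (real n * x) / real n else 0) =
      coprime3 n * (r ^ n * f (real n * x) / real n)" for n by (simp add: coprime3_def)
    ultimately show ?thesis by simp
  qed
  show "(\<lambda>n. coprime3 n * (r ^ n * sin (real n * x) / real n)) sums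
      (abel_sin r x - abel_sin (r ^ 3) (3 * x) / 3)"
    by (rule 2[OF abel_sin_sums[OF r3] abel_sin_sums[OF r]])
  show "(\<lambda>n. coprime3 n * (r ^ n * cos (real n * x) / real n)) sums
      (- (1/2) * ln (1 - 2 * r * cos x + r\<^sup>2) + (1/6) * ln (1 - 2 * r ^ 3 * cos (3 * x) + (r ^ 3)\<^sup>2))"
    using 2[OF abel_cos_sums[OF r3] abel_cos_sums[OF r]] by simp
qed

text \<open>With \<open>z = r * cis x\<close>, the factorisation
  \<open>1 - z^3 = (1 - z) (1 + z + z^2)\<close> turns the claim into \<open>Q <= R^2\<close> for
  \<open>Q = |1 + z + z^2|^2\<close>. At \<open>r = 1\<close> the roots satisfy
  \<open>1 + 2 cos x <= 3 (sin (x / 2) / (x / 2))^2\<close>, with equality in the limit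
  \<open>x -> 0\<close>. The term with \<open>(2 - r) / r\<close> pays for \<open>r < 1\<close> and
  vanishes as \<open>r\<close> tends to 1.\<close>

lemma abel_coprime3_cos_le:
  fixes r x :: real
  assumes r: "0 < r" "r < 1" and x: "0 < x" "x \<le> 2"
  shows "- (1/2) * ln (1 - 2 * r * cos x + r\<^sup>2) + (1/6) * ln (1 - 2 * r ^ 3 * cos (3 * x) + (r ^ 3)\<^sup>2)
    \<le> - (2/3) * ln x + (1/3) * ln 3 + (1/3) * ln ((2 - r) / r)"
proof -
  define c where "c = cos x"
  define y where "y = x / 2"
  define s where "s = sin y"
  define m where "m = (s / y)\<^sup>2"
  have y: "0 < y" "y \<le> 1" using x by (auto simp: y_def)
  have c: "c = 1 - 2 * s\<^sup>2" unfolding c_def s_def y_def using cos_double_sin[of "x / 2"] by simp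
  have y2: "y\<^sup>2 \<le> 1" using y by (simp add: power_le_one)
  have "1 - y\<^sup>2 / 6 \<le> s / y"
  proof -
    have "(1 - y\<^sup>2 / 6) * y \<le> s" using sin_ge_cubic[of y] y by (simp add: s_def algebra_simps eval_nat_numeral)
    thus ?thesis using y by (simp add: pos_le_divide_eq)
  qed
  hence "(1 - y\<^sup>2 / 6)\<^sup>2 \<le> m" unfolding m_def using y2 by (intro power_mono) auto
  moreover have "(1 - y\<^sup>2 / 6)\<^sup>2 = 1 - y\<^sup>2 / 3 + (y\<^sup>2)\<^sup>2 / 36" by (simp add: power2_diff power_divide)
  moreover have "0 \<le> (y\<^sup>2)\<^sup>2 / 36" by simp
  ultimately have m: "1 - y\<^sup>2 / 3 \<le> m" by linarith
  hence m': "2 / 3 \<le> m" using y2 by linarith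
  have sm: "s\<^sup>2 = m * y\<^sup>2" using y by (simp add: m_def power_divide)
  \<comment> \<open>The inequality at \<open>r = 1\<close>. It rests on
    \<open>(1 - y^2 / 3) (3 + 4 y^2) >= 3\<close>, for which \<open>y <= 1\<close> suffices.\<close>
  have key: "3 - 4 * s\<^sup>2 \<le> 3 * m"
  proof -
    have "y\<^sup>2 * y\<^sup>2 \<le> y\<^sup>2" by (rule mult_left_le) (use y2 in auto)
    hence "0 \<le> 3 * y\<^sup>2 - 4 / 3 * (y\<^sup>2 * y\<^sup>2)" using zero_le_power2[of y] by linarith
    hence "3 \<le> (1 - y\<^sup>2 / 3) * (3 + 4 * y\<^sup>2)" by (simp add: algebra_simps)
    also have "\<dots> \<le> m * (3 + 4 * y\<^sup>2)" using m by (intro mult_right_mono) auto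
    finally show ?thesis by (simp add: sm algebra_simps)
  qed
  have "y < pi / 3" using y pi_gt3 by linarith
  hence "s < sin (pi / 3)" unfolding s_def using y pi_gt3 by (intro sin_monotone_2pi) auto
  moreover have "s > 0" unfolding s_def using y pi_gt3 by (intro sin_gt_zero) auto
  ultimately have "s\<^sup>2 \<le> (sqrt 3 / 2)\<^sup>2" by (intro power_mono) (auto simp: sin_60)
  hence p: "3 - 4 * s\<^sup>2 \<ge> 0" by (simp add: power_divide)
  define D where "D = 1 - 2 * r * c + r\<^sup>2"
  have Deq: "D = (1 - r)\<^sup>2 + 4 * r * s\<^sup>2" by (simp add: D_def c power2_eq_square algebra_simps)
  have D: "D \<ge> 4 * r * s\<^sup>2" unfolding Deq by simp
  have D0: "D > 0" using r unfolding Deq by (intro add_pos_nonneg) auto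
  \<comment> \<open>\<open>A\<close> and \<open>- B\<close> are the real and imaginary parts of
    \<open>cis (- x) * (1 + z + z ^ 2)\<close>; the rotation makes \<open>B\<close> vanish at
    \<open>r = 1\<close>.\<close>
  define A where "A = (1 + r\<^sup>2) * c + r"
  define B where "B = (1 - r\<^sup>2) * sin x"
  define Q where "Q = A\<^sup>2 + B\<^sup>2"
  have sc: "(sin x)\<^sup>2 = 1 - c\<^sup>2" by (simp add: c_def sin_squared_eq)
  have QD: "1 - 2 * r ^ 3 * cos (3 * x) + (r ^ 3)\<^sup>2 = D * Q"
  proof -
    have c3: "cos (3 * x) = 4 * c ^ 3 - 3 * c" by (simp add: c_def cos_treble_cos)
    have Qe: "Q = ((1 + r\<^sup>2) * c + r)\<^sup>2 + (1 - r\<^sup>2)\<^sup>2 * (1 - c\<^sup>2)"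
      by (simp add: Q_def A_def B_def power_mult_distrib sc)
    show ?thesis unfolding c3 Qe D_def by (simp add: eval_nat_numeral algebra_simps)
  qed
  have "1 - 2 * r ^ 3 * cos (3 * x) + (r ^ 3)\<^sup>2 > 0"
  proof -
    have "(1 - r ^ 3)\<^sup>2 > 0" using r by (simp add: power_less_one_iff less_imp_neq)
    moreover have "(1 - r ^ 3)\<^sup>2 \<le> 1 - 2 * r ^ 3 * cos (3 * x) + (r ^ 3)\<^sup>2"
      using r mult_left_le[of "cos (3 * x)" "2 * r ^ 3"] by (simp add: power2_diff)
    ultimately show ?thesis by linarith
  qed
  hence Q0: "Q > 0" using D0 QD by (simp add: zero_less_mult_iff)
  define R where "R = 3 * ((2 - r) / r) * D / x\<^sup>2"
  have R0: "R > 0" using r x D0 by (simp add: R_def)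
  have Ale: "\<bar>A\<bar> \<le> r * (3 - 4 * s\<^sup>2) + (1 - r)\<^sup>2"
  proof -
    have "A = r * (3 - 4 * s\<^sup>2) + (1 - r)\<^sup>2 * c" unfolding A_def c by (simp add: power2_eq_square algebra_simps)
    moreover have "\<bar>(1 - r)\<^sup>2 * c\<bar> \<le> (1 - r)\<^sup>2 * 1" unfolding abs_mult by (intro mult_mono) (auto simp: c_def)
    moreover have "0 \<le> r * (3 - 4 * s\<^sup>2)" using r p by simp
    ultimately show ?thesis by linarith
  qed
  have rle: "r * (3 - 4 * s\<^sup>2) \<le> 3 - 4 * s\<^sup>2" using r p by (intro mult_left_le_one_le) auto
  have Ble: "\<bar>B\<bar> \<le> (1 - r\<^sup>2) * 1"
    unfolding B_def abs_mult using r by (intro mult_mono) (auto simp: abs_square_le_1 power_le_one)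
  have "\<bar>A\<bar> + \<bar>B\<bar> \<le> (r * (3 - 4 * s\<^sup>2) + (1 - r)\<^sup>2) + (1 - r\<^sup>2) * 1" by (rule add_mono[OF Ale Ble])
  also have "\<dots> \<le> ((3 - 4 * s\<^sup>2) + (1 - r)\<^sup>2) + (1 - r\<^sup>2) * 1" by (intro add_right_mono rle)
  also have "\<dots> = (3 - 4 * s\<^sup>2) + 2 * (1 - r)" by (simp add: power2_eq_square algebra_simps)
  also have "\<dots> \<le> 3 * m * (2 - r)"
  proof -
    have "2 * (1 - r) \<le> 3 * m * (1 - r)" using m' r by (intro mult_right_mono) auto
    thus ?thesis using key by (simp add: algebra_simps)
  qed
  also have "\<dots> = 3 * ((2 - r) / r) * (4 * r * s\<^sup>2) / x\<^sup>2"
    using r x by (simp add: m_def y_def power_divide)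
  also have "\<dots> \<le> R" unfolding R_def using r D by (intro divide_right_mono mult_left_mono) auto
  finally have "\<bar>A\<bar> + \<bar>B\<bar> \<le> R" .
  hence "(\<bar>A\<bar> + \<bar>B\<bar>)\<^sup>2 \<le> R\<^sup>2" by (intro power_mono) auto
  moreover have "Q \<le> (\<bar>A\<bar> + \<bar>B\<bar>)\<^sup>2" unfolding Q_def power2_sum by simp
  ultimately have "Q \<le> R\<^sup>2" by linarith
  hence "ln Q \<le> ln (R\<^sup>2)" using Q0 R0 by (subst ln_le_cancel_iff) auto
  also have "\<dots> = 2 * ln R" using R0 by (simp add: ln_realpow)
  also have "ln R = ln 3 + ln ((2 - r) / r) + ln D - 2 * ln x"
  proof -
    have *: "ln (3 * E * D / x\<^sup>2) = ln 3 + ln E + ln D - 2 * ln x" if "E > 0" for E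
      using x D0 that by (simp add: ln_mult ln_div ln_realpow)
    show ?thesis unfolding R_def by (rule *) (use r in simp)
  qed
  finally have "ln Q \<le> 2 * (ln 3 + ln ((2 - r) / r) + ln D - 2 * ln x)" .
  moreover have "ln (D * Q) = ln D + ln Q" using D0 Q0 by (simp add: ln_mult)
  ultimately show ?thesis unfolding QD D_def[symmetric] c_def[symmetric] by argo
qed

text \<open>The reflection \<open>a -> q - a\<close> folds the second tail onto the first, hence the
  factor 2; every third residue drops out because it shares the factor 3 with
  \<open>q\<close>.\<close>

lemma norm_character_symmetric_sum_le:
  assumes prim: "primitive_character q chi" "q > 1" and q: "q = 3 * N" and h: "\<And>a. a \<in> {1..<int q} \<Longrightarrow> norm (h a) \<le> P (2 * pi * of_int a / real q) + P (2 * pi - 2 * pi * of_int a / real q)"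
    and P: "\<And>t. 0 < t \<Longrightarrow> 0 \<le> P t"
  shows "norm (\<Sum>a\<in>{1..<int q}. cnj (chi a) * h a) \<le>
     2 * (\<Sum>j<N. P (2 * pi * (3 * real j + 1) / real q) + P (2 * pi * (3 * real j + 2) / real q))"
proof -
  note chi = primitive_imp_character[OF prim(1)]
  let ?th = "\<lambda>a::int. 2 * pi * of_int a / real q"
  have "norm (\<Sum>a\<in>{1..<int q}. cnj (chi a) * h a) \<le> (\<Sum>a\<in>{1..<int q}. norm (chi a) * (P (?th a) + P (2 * pi - ?th a)))"
    by (rule sum_norm_le) (simp add: norm_mult mult_left_mono h)
  also have "\<dots> = (\<Sum>a\<in>{1..<int q}. norm (chi a) * P (?th a)) + (\<Sum>a\<in>{1..<int q}. norm (chi a) * P (2 * pi - ?th a))"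
    by (simp add: distrib_left sum.distrib)
  also have "(\<Sum>a\<in>{1..<int q}. norm (chi a) * P (2 * pi - ?th a)) = (\<Sum>a\<in>{1..<int q}. norm (chi a) * P (?th a))"
  proof (rule sum.reindex_bij_witness[of _ "\<lambda>a. int q - a" "\<lambda>a. int q - a"])
    fix a :: int
    have "chi (int q - a) = chi (- a)"
      by (rule character_cong[OF chi]) (simp add: cong_iff_dvd_diff)
    hence "norm (chi (int q - a)) = norm (chi a)" by (simp add: norm_character[OF chi])
    moreover have "?th (int q - a) = 2 * pi - ?th a" using prim(2) by (simp add: field_simps)
    ultimately show "norm (chi (int q - a)) * P (?th (int q - a)) = norm (chi a) * P (2 * pi - ?th a)" by simp
  qed auto
  also have "(\<Sum>a\<in>{1..<int q}. norm (chi a) * P (?th a)) \<le> 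
      (\<Sum>j<N. P (2 * pi * (3 * real j + 1) / real q) + P (2 * pi * (3 * real j + 2) / real q))"
  proof -
    have z: "norm (chi (int (3 * j))) = 0" for j
      using norm_character[OF chi, of "int (3 * j)"] q prim(2) by (auto simp: coprime_mult_left_iff coprime_mult_right_iff)
    have "(\<Sum>a\<in>{1..<int q}. norm (chi a) * P (?th a)) = (\<Sum>a\<in>{0..<int q}. norm (chi a) * P (?th a))"
    proof -
      have "{0..<int q} = insert 0 {1..<int q}" using prim(2) by auto
      thus ?thesis using z[of 0] by simp
    qed
    also have "\<dots> = (\<Sum>n<q. norm (chi (int n)) * P (?th (int n)))"
      by (rule sum.reindex_bij_witness[of _ int nat]) auto
    also have "\<dots> = (\<Sum>j<N. \<Sum>n\<in>{j * 3..<j * 3 + 3}. norm (chi (int n)) * P (?th (int n)))"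
      unfolding q using sum.nat_group[of "\<lambda>n. norm (chi (int n)) * P (2 * pi * real n / real (3 * N))" 3 N]
      by (simp add: mult.commute)
    also have "\<dots> \<le> (\<Sum>j<N. P (2 * pi * (3 * real j + 1) / real q) + P (2 * pi * (3 * real j + 2) / real q))"
    proof (rule sum_mono)
      fix j assume j: "j \<in> {..<N}"
      have "{j * 3..<j * 3 + 3} = {3 * j, 3 * j + 1, 3 * j + 2}" by auto
      hence "(\<Sum>n\<in>{j * 3..<j * 3 + 3}. norm (chi (int n)) * P (?th (int n))) =
         norm (chi (int (3 * j + 1))) * P (2 * pi * (3 * real j + 1) / real q) +
         norm (chi (int (3 * j + 2))) * P (2 * pi * (3 * real j + 2) / real q)"
        using z[of j] by (simp add: add_ac)
      also have "\<dots> \<le> 1 * P (2 * pi * (3 * real j + 1) / real q) + 1 * P (2 * pi * (3 * real j + 2) / real q)"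
        using prim(2) by (intro add_mono mult_right_mono norm_character_le_1[OF chi] P) auto
      finally show "(\<Sum>n\<in>{j * 3..<j * 3 + 3}. norm (chi (int n)) * P (?th (int n))) \<le> 
         P (2 * pi * (3 * real j + 1) / real q) + P (2 * pi * (3 * real j + 2) / real q)" by simp
    qed
    finally show ?thesis .
  qed
  finally show ?thesis by simp
qed

section \<open>Odd characters\<close>

text \<open>At 0 the convention \<open>0 * ln 0 = 0\<close> agrees with the limit.\<close>

lemma continuous_on_x_ln_x:
  assumes "0 < (X::real)"
  shows "continuous_on {0..X} (\<lambda>x::real. x * ln x)"
proof -
  have "continuous (at x within {0..X}) (\<lambda>x::real. x * ln x)" if "x \<in> {0..X}" for x
  proof (cases "x = 0")
    case True
    have "((\<lambda>x::real. x * ln x) \<longlongrightarrow> 0) (at_right 0)" by real_asymp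
    thus ?thesis using True assms by (simp add: continuous_within at_within_Icc_at_right)
  next
    case False
    thus ?thesis using that by (intro continuous_intros) auto
  qed
  thus ?thesis by (simp add: continuous_on_eq_continuous_within)
qed

text \<open>The mass beyond \<open>t\<close> of the density \<open>2 / X * (1 - x / X)\<close> on
  \<open>[0, X]\<close>; the \<open>max\<close> extends it by 0 past \<open>X\<close>.\<close>

definition odd_tail :: "real \<Rightarrow> real \<Rightarrow> real" where
  "odd_tail X t = (max 0 (1 - t / X))\<^sup>2"

definition abel_radius :: "nat \<Rightarrow> real" where
  "abel_radius k = 1 - 1 / real (k + 2)"

lemma abel_radius: "0 < abel_radius k" "abel_radius k < 1" "abel_radius \<longlonglongrightarrow> 1"
proof -
  show "abel_radius \<longlonglongrightarrow> 1" unfolding abel_radius_def by real_asymp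
qed (auto simp: abel_radius_def)

lemma norm_character_le_coprime3:
  assumes "dirichlet_character q chi" "3 dvd q"
  shows "norm (chi (int n)) \<le> coprime3 n"
proof (cases "3 dvd n")
  case True
  hence "\<not> coprime (int n) (int q)" using assms(2) 
    by (metis coprime_common_divisor_nat coprime_int_iff numeral_eq_one_iff semiring_norm(84) nat_dvd_1_iff_1)
  thus ?thesis using True norm_character[OF assms(1), of "int n"] by (simp add: coprime3_def)
next
  case False
  thus ?thesis using norm_character_le_1[OF assms(1)] by (simp add: coprime3_def)
qed

lemma odd_L_one_bound:
  assumes prim: "primitive_character q chi" "q > 1" and odd: "chi (-1) = -1" and q: "q = 3 * N"
    and X: "0 < X" "X \<le> 2"
  shows "norm (dirichlet_L chi 1) \<le> 1 - 2/3 * ln X + 1/3 * ln 3 +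
     pi / sqrt (real q) * (\<Sum>j<N. odd_tail X (2 * pi * (3 * real j + 1) / real q) + odd_tail X (2 * pi * (3 * real j + 2) / real q))"
proof -
  note chi = primitive_imp_character[OF prim(1)]
  \<comment> \<open>A probability density on \<open>[0, X]\<close>, so that \<open>F n\<close> below
    is 1 minus its cosine transform, and that transform is the Fejer weight.\<close>
  define K where "K = (\<lambda>x. 2 / X * (1 - x / X))"
  define r where "r = abel_radius"
  have r: "\<And>k. 0 \<le> r k" "\<And>k. r k < 1" "r \<longlonglongrightarrow> 1" and r0: "\<And>k. 0 < r k"
    using abel_radius by (auto simp: r_def less_imp_le)
  have K0: "0 \<le> K x" "K x \<le> 2 / X" if "x \<in> {0..X}" for x
  proof -
    have "2 / X * (1 - x / X) \<le> 2 / X * 1" using that X by (intro mult_left_mono) auto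
    thus "K x \<le> 2 / X" by (simp add: K_def)
    show "0 \<le> K x" unfolding K_def using that X by (intro mult_nonneg_nonneg) auto
  qed
  have Kb: "\<bar>K x\<bar> \<le> 2 / X" if "0 \<le> x" "x \<le> X" for x using K0[of x] that by auto
  have Km: "K \<in> borel_measurable borel" unfolding K_def by measurable
  have Ki: "(K has_integral odd_tail X t) {t..X}" if "0 \<le> t" "t \<le> X" for t
  proof -
    have "(K has_integral ((- (1 - X / X)\<^sup>2) - (- (1 - t / X)\<^sup>2))) {t..X}"
      unfolding K_def using X that
      by (intro fundamental_theorem_of_calculus)
         (auto intro!: derivative_eq_intros simp flip: has_real_derivative_iff_has_vector_derivative)
    moreover have "1 - t / X \<ge> 0" using X that by simp
    ultimately show ?thesis using X by (simp add: odd_tail_def max_def)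
  qed
  have tail0: "odd_tail X t = 0" if "t \<ge> X" for t using that X by (simp add: odd_tail_def max_def)
  define F where "F = (\<lambda>n. integral {0..X} (\<lambda>x. K x * (1 - cos (real n * x))))"
  define g where "g = (\<lambda>n. 1 - F n)"
  have int_cos: "(\<lambda>x. K x * cos (real n * x)) integrable_on {0..X}" for n
    unfolding K_def by (intro integrable_continuous_interval continuous_intros) (use X in auto)
  have g_eq: "g n = integral {0..X} (\<lambda>x. K x * cos (real n * x))" for n
  proof -
    have "((\<lambda>x. K x - K x * cos (real n * x)) has_integral (odd_tail X 0 - integral {0..X} (\<lambda>x. K x * cos (real n * x)))) {0..X}"
      using X by (intro has_integral_diff Ki integrable_integral int_cos) auto
    hence "F n = 1 - integral {0..X} (\<lambda>x. K x * cos (real n * x))"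
      unfolding F_def by (intro integral_unique) (simp add: odd_tail_def right_diff_distrib)
    thus ?thesis by (simp add: g_def)
  qed
  have g0: "0 \<le> g n" if n: "n > 0" for n
  proof -
    have "((\<lambda>x. K x * cos (real n * x)) has_integral
       (2 / X * ((1 - X / X) * sin (real n * X) / real n - cos (real n * X) / (X * (real n)\<^sup>2)) -
        2 / X * ((1 - 0 / X) * sin (real n * 0) / real n - cos (real n * 0) / (X * (real n)\<^sup>2)))) {0..X}"
      unfolding K_def using X n
      by (intro fundamental_theorem_of_calculus)
         (auto intro!: derivative_eq_intros simp: field_simps power2_eq_square simp flip: has_real_derivative_iff_has_vector_derivative)
    hence "g n = 2 / X * (1 / (X * (real n)\<^sup>2) - cos (real n * X) / (X * (real n)\<^sup>2))"
      unfolding g_eq using X by (intro integral_unique) (simp add: right_diff_distrib)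
    also have "\<dots> = 2 / X * ((1 - cos (real n * X)) / (X * (real n)\<^sup>2))" by (simp add: diff_divide_distrib)
    also have "\<dots> \<ge> 0" using X by (intro mult_nonneg_nonneg divide_nonneg_nonneg) auto
    finally show ?thesis .
  qed
  define V where "V = (\<lambda>(r::real) (x::real). - (1/2) * ln (1 - 2 * r * cos x + r\<^sup>2) + (1/6) * ln (1 - 2 * r ^ 3 * cos (3 * x) + (r ^ 3)\<^sup>2))"
  have ex: "(\<lambda>x. K x * V (r k) x) integrable_on {0..X}"
    "(\<lambda>n. integral {0..X} (\<lambda>x. K x * (coprime3 n * (r k ^ n * cos (real n * x) / real n)))) sums integral {0..X} (\<lambda>x. K x * V (r k) x)" for k
  proof -
    have i: "(\<lambda>x. K x * (coprime3 n * (r k ^ n * cos (real n * x) / real n))) integrable_on {0..X}" for n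
      using integrable_on_mult_right[OF int_cos[of n], of "coprime3 n * r k ^ n / real n"] by (simp add: mult_ac)
    have b: "\<bar>K x * (coprime3 n * (r k ^ n * cos (real n * x) / real n))\<bar> \<le> 2 / X * r k ^ n" if "x \<in> {0..X}" for x n
    proof -
      have "\<bar>coprime3 n * (r k ^ n * cos (real n * x) / real n)\<bar> \<le> r k ^ n"
      proof (cases "n = 0")
        case False
        have "\<bar>r k ^ n\<bar> * \<bar>cos (real n * x)\<bar> \<le> r k ^ n * 1" using r(1)[of k] by (intro mult_mono) auto
        hence "\<bar>r k ^ n * cos (real n * x) / real n\<bar> \<le> r k ^ n * 1 / 1"
          unfolding abs_mult abs_divide using r(1)[of k] False by (intro frac_le) auto
        thus ?thesis using r(1)[of k] by (auto simp: coprime3_def)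
      qed (use r in auto)
      thus ?thesis unfolding abs_mult[of "K x"] using Kb[of x] that X by (intro mult_mono) auto
    qed
    have s: "(\<lambda>n. K x * (coprime3 n * (r k ^ n * cos (real n * x) / real n))) sums (K x * V (r k) x)" for x
      unfolding V_def by (intro sums_mult abel_coprime3_cos r)
    note e = sums_integral_exchange[OF i b summable_const_geometric[OF r(1,2)] s]
    show "(\<lambda>x. K x * V (r k) x) integrable_on {0..X}" by (rule e(1))
    show "(\<lambda>n. integral {0..X} (\<lambda>x. K x * (coprime3 n * (r k ^ n * cos (real n * x) / real n)))) sums integral {0..X} (\<lambda>x. K x * V (r k) x)"
      by (rule e(2))
  qed
  have S: "(\<lambda>n. coprime3 n * (r k ^ n / real n * g n)) sums integral {0..X} (\<lambda>x. K x * V (r k) x)" for k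
  proof -
    have "integral {0..X} (\<lambda>x. K x * (coprime3 n * (r k ^ n * cos (real n * x) / real n))) = coprime3 n * (r k ^ n / real n * g n)" for n
      using integral_mult_right[of "{0..X}" "coprime3 n * r k ^ n / real n" "\<lambda>x. K x * cos (real n * x)"]
      by (simp add: g_eq mult_ac)
    thus ?thesis using ex(2)[of k] by (simp only:)
  qed
  define u where "u = (\<lambda>k. 1 - 2/3 * ln X + 1/3 * ln 3 + 1/3 * ln ((2 - r k) / r k))"
  have u: "u \<longlonglongrightarrow> 1 - 2/3 * ln X + 1/3 * ln 3 + 1/3 * ln ((2 - 1) / 1)"
    unfolding u_def by (intro tendsto_intros r) auto
  have s_le: "integral {0..X} (\<lambda>x. K x * V (r k) x) \<le> u k" for k
  proof -
    define c where "c = 1/3 * ln 3 + 1/3 * ln ((2 - r k) / r k)"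
    \<comment> \<open>An antiderivative of \<open>K x * (- (2/3) * ln x + c)\<close>, with the
      square times the logarithm written as \<open>x * (x * ln x)\<close> for continuity at 0. The
      mean of \<open>ln x\<close> under \<open>K\<close> is \<open>ln X - 3/2\<close>; this is the
      source of the constant 1 in the bound.\<close>
    define G where "G = (\<lambda>x. - (2/3) * (2 / X * (x * ln x - x - (x * (x * ln x) / 2 - x\<^sup>2 / 4) / X)) - c * (1 - x / X)\<^sup>2)"
    have "((\<lambda>x. K x * (- (2/3) * ln x + c)) has_integral (G X - G 0)) {0..X}"
    proof (rule fundamental_theorem_of_calculus_interior)
      show "continuous_on {0..X} G" unfolding G_def
        by (intro continuous_intros continuous_on_x_ln_x) (use X in auto)
      fix x assume x: "x \<in> {0<..<X}"
      show "(G has_vector_derivative K x * (- (2/3) * ln x + c)) (at x)"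
        unfolding has_real_derivative_iff_has_vector_derivative[symmetric] G_def K_def using x X
        by (auto intro!: derivative_eq_intros simp: field_simps power2_eq_square)
    qed (use X in auto)
    moreover have "G X - G 0 = u k"
      unfolding G_def u_def c_def using X by (simp add: field_simps power2_eq_square)
    ultimately have "((\<lambda>x. K x * (- (2/3) * ln x + c)) has_integral u k) {0..X}" by simp
    \<comment> \<open>The logarithmic bound holds for positive \<open>x\<close> only, so the
      comparison function is altered at 0 to make the inequality trivial there.\<close>
    hence "((\<lambda>x. if x = 0 then K 0 * V (r k) 0 else K x * (- (2/3) * ln x + c)) has_integral u k) {0..X}"
      by (rule has_integral_spike_finite[of "{0}", rotated 2]) auto
    thus ?thesis
    proof (rule has_integral_le[OF integrable_integral[OF ex(1)]])
      fix x assume x: "x \<in> {0..X}"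
      show "K x * V (r k) x \<le> (if x = 0 then K 0 * V (r k) 0 else K x * (- (2/3) * ln x + c))"
      proof (cases "x = 0")
        case False
        have "V (r k) x \<le> - (2/3) * ln x + c"
          using abel_coprime3_cos_le[OF r0 r(2), of x k] x X False by (simp add: V_def c_def)
        thus ?thesis using False K0(1)[OF x] by (simp add: mult_left_mono)
      qed auto
    qed
  qed
  define th where "th = (\<lambda>a::int. 2 * pi * of_int a / real q)"
  have th: "0 < th a" "th a < 2 * pi" if "a \<in> {1..<int q}" for a
  proof -
    show "0 < th a" using that prim(2) by (simp add: th_def)
    have "of_int a < real q" using that by (simp add: of_int_less_iff[symmetric, where 'a = real] del: of_int_less_iff)
    thus "th a < 2 * pi" using prim(2) by (simp add: th_def field_simps)
  qed
  define M where "M = \<i> / gauss_sum q chi 1 * (\<Sum>a\<in>{1..<int q}. cnj (chi a) * of_real (pi / 2 * (odd_tail X (th a) - odd_tail X (2 * pi - th a))))"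
  have tau: "norm (gauss_sum q chi 1) = sqrt (real q)" by (rule norm_gauss_sum[OF prim(1)])
  hence tau0: "gauss_sum q chi 1 \<noteq> 0" using prim(2) by auto
  have lim: "(\<lambda>k. \<Sum>n. r k ^ n * sin (real n * th a) / real n * F n) \<longlonglongrightarrow> pi / 2 * (odd_tail X (th a) - odd_tail X (2 * pi - th a))"
    if "a \<in> {1..<int q}" for a
  proof -
    have "integral {0..X} (\<lambda>x. K x * (abel_sin 1 (th a) - (abel_sin 1 (th a + x) + abel_sin 1 (th a - x)) / 2)) =
        pi / 2 * (odd_tail X (th a) - odd_tail X (2 * pi - th a))"
      using X th[OF that] pi_gt3 by (intro integral_cosine_step Ki tail0) auto
    with abel_cosine_transform_limit[OF r Km Kb X(1), of "th a"] show ?thesis by (simp add: F_def)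
  qed
  have "chi (int n) * gauss_sum q chi 1 = \<i> * (\<Sum>a\<in>{1..<int q}. cnj (chi a) * of_real (sin (real n * th a)))" for n
    unfolding th_def by (rule gauss_expansion_odd[OF prim odd])
  note csl = character_series_limit[OF tau0 this, of r F]
  have summ: "summable (\<lambda>n. r k ^ n * sin (real n * th a) / real n * F n)" for a k
    unfolding F_def by (rule sums_summable[OF abel_cosine_transform[OF r(1,2) Km Kb X(1)]])
  have F: "F n = 1 - g n" for n by (simp add: g_def)
  have "norm (dirichlet_L chi 1) \<le> (1 - 2/3 * ln X + 1/3 * ln 3 + 1/3 * ln ((2 - 1) / 1)) + norm M"
  proof (rule L_one_bound[OF prim r g0 norm_character_le_coprime3[OF chi] S s_le u])
    show "summable (\<lambda>n. chi (int n) * of_real (r k ^ n / real n * (1 - g n)))" for k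
      unfolding F[symmetric] by (rule sums_summable[OF csl(1)[OF summ lim]])
    show "(\<lambda>k. \<Sum>n. chi (int n) * of_real (r k ^ n / real n * (1 - g n))) \<longlonglongrightarrow> M"
      unfolding F[symmetric] M_def by (rule csl(2)[OF summ lim])
  qed (use q in auto)
  moreover have "norm M \<le> pi / sqrt (real q) * (\<Sum>j<N. odd_tail X (2 * pi * (3 * real j + 1) / real q) + odd_tail X (2 * pi * (3 * real j + 2) / real q))"
  proof -
    have "norm (\<Sum>a\<in>{1..<int q}. cnj (chi a) * of_real (odd_tail X (th a) - odd_tail X (2 * pi - th a))) \<le>
      2 * (\<Sum>j<N. odd_tail X (2 * pi * (3 * real j + 1) / real q) + odd_tail X (2 * pi * (3 * real j + 2) / real q))"
      by (rule norm_character_symmetric_sum_le[OF prim q])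
         (auto simp: th_def odd_tail_def abs_le_iff norm_of_real simp del: of_real_diff)
    moreover have "M = \<i> * of_real (pi / 2) / gauss_sum q chi 1 *
        (\<Sum>a\<in>{1..<int q}. cnj (chi a) * of_real (odd_tail X (th a) - odd_tail X (2 * pi - th a)))"
      unfolding M_def by (simp add: sum_distrib_left mult_ac)
    ultimately show ?thesis using prim(2) by (simp add: norm_mult norm_divide tau field_simps)
  qed
  ultimately show ?thesis by simp
qed

text \<open>Split as \<open>2 ^ 3 * (3/2)\<close> to use quickly converging series. The precision is
  dictated by odd characters: their constant \<open>(5 - ln 12) / 3\<close> lies only about
  \<open>10^-5\<close> below 0.838374.\<close>

lemma ln_12_ge: "ln (12::real) \<ge> 31061 / 12500"
proof -
  have "ln (2::real) \<ge> 0.693146"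
    using ln_approx_bounds[of 2 5] by (simp add: eval_nat_numeral)
  moreover have "ln (3/2::real) \<ge> 0.40546"
    using ln_approx_bounds[of "3/2" 4] by (simp add: eval_nat_numeral)
  moreover have "ln (12::real) = 3 * ln 2 + ln (3/2)"
    using ln_mult[of "2^3::real" "3/2"] ln_realpow[of "2::real" 3] by simp
  ultimately show ?thesis by simp
qed

text \<open>Units modulo 6 are odd, so congruence to 1 modulo 3 gives congruence to 1 modulo 6 and
  the character is induced from 3. This leaves the conductor 3 and those that are at least
  9.\<close>

lemma conductor_6_impossible:
  assumes "primitive_character q chi"
  shows "q \<noteq> 6"
proof
  assume q: "q = 6"
  have chi: "dirichlet_character q chi" by (rule primitive_imp_character[OF assms])
  have "induced_modulus q chi 3" unfolding induced_modulus_def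
  proof (intro conjI allI impI)
    fix a assume a: "coprime a (int q) \<and> [a = 1] (mod int 3)"
    hence "odd a" using q by (auto simp: coprime_commute dest: coprime_common_divisor[of _ _ 2])
    moreover have "a mod 3 = 1" using a by (simp add: cong_def)
    ultimately have "a mod 6 = 1" by presburger
    hence "[a = 1] (mod int q)" using q by (simp add: cong_def)
    thus "chi a = 1" using character_cong[OF chi] character_one[OF chi] by simp
  qed (use q in auto)
  thus False using primitive_not_induced[OF assms, of 3] q by simp
qed

text \<open>The block estimate for a convex function with integral \<open>T / 3\<close>;
  \<open>T <= 3 * real N\<close> places its whole support inside the range of integration.\<close>

lemma sum_odd_tail_le:
  assumes T: "0 < T" "T \<le> 3 * real N"
  shows "(\<Sum>j<N. (max 0 (1 - (3 * real j + 1) / T))\<^sup>2 + (max 0 (1 - (3 * real j + 2) / T))\<^sup>2) \<le> 2/9 * T"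
proof -
  define f where "f = (\<lambda>y. (max 0 (1 - y / T))\<^sup>2)"
  define d where "d = (\<lambda>y. - (2 / T) * max 0 (1 - y / T))"
  have "((\<lambda>y. (1 - y / T)\<^sup>2) has_integral ((- T / 3 * (1 - T / T) ^ 3) - (- T / 3 * (1 - 0 / T) ^ 3))) {0..T}"
    using T by (intro fundamental_theorem_of_calculus)
      (auto intro!: derivative_eq_intros simp flip: has_real_derivative_iff_has_vector_derivative)
  hence "((\<lambda>y. (1 - y / T)\<^sup>2) has_integral T / 3) {0..T}" using T by simp
  hence 1: "(f has_integral T / 3) {0..T}"
    by (rule has_integral_eq[rotated]) (use T in \<open>auto simp: f_def max_def\<close>)
  have 2: "(f has_integral 0) {T..3 * real N}"
    by (rule has_integral_is_0) (use T in \<open>auto simp: f_def max_def\<close>)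
  have I: "(f has_integral T / 3) {0..3 * real N}"
    using has_integral_combine[OF _ _ 1 2] T by simp
  have "(\<Sum>j<N. f (3 * real j + 1) + f (3 * real j + 2)) \<le> 2 / 3 * integral {0..3 * real N} f"
  proof (rule sum_coprime3_le_integral[where d = d])
    show "f x + d x * (y - x) \<le> f y" for x y
    proof -
      define A B where "A = 1 - x / T" and "B = 1 - y / T"
      have yx: "y - x = T * (A - B)" using T by (simp add: A_def B_def field_simps)
      have "f x + d x * (y - x) = (max 0 A)\<^sup>2 - 2 * max 0 A * (A - B)"
        using T by (simp add: f_def d_def yx A_def[symmetric])
      also have "\<dots> \<le> (max 0 B)\<^sup>2"
      proof (cases "A \<ge> 0")
        case True
        have "A\<^sup>2 - 2 * A * (A - B) = 2 * A * B - A\<^sup>2" by (simp add: power2_eq_square algebra_simps)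
        also have "\<dots> \<le> (max 0 B)\<^sup>2"
        proof (cases "B \<ge> 0")
          case True
          have "0 \<le> (A - B)\<^sup>2" by simp
          thus ?thesis using True by (simp add: power2_diff)
        next
          case False
          have "A * B \<le> 0" using True False by (intro mult_nonneg_nonpos) auto
          hence "2 * (A * B) - A\<^sup>2 \<le> 0" using zero_le_power2[of A] by linarith
          thus ?thesis using False by (simp add: mult.assoc)
        qed
        finally show ?thesis using True by (simp add: max_def)
      qed (auto simp: max_def)
      finally show ?thesis by (simp add: f_def B_def)
    qed
    show "d x \<le> d y" if "x \<le> y" for x y
    proof -
      have "max 0 (1 - y / T) \<le> max 0 (1 - x / T)" using that T by (intro max.mono) (auto simp: divide_right_mono)
      thus ?thesis unfolding d_def using T by (intro mult_left_mono_neg) auto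
    qed
    show "f integrable_on {0..3 * real N}" using I by blast
  qed
  thus ?thesis using integral_unique[OF I] by (simp add: f_def)
qed

lemma odd_character_bound:
  assumes prim: "primitive_character q chi" and q3: "3 dvd q" and odd: "chi (-1) = -1"
  shows "norm (dirichlet_L chi 1) \<le> 1 / 3 * ln (real q) + 0.838374"
proof -
  obtain N where q: "q = 3 * N" using q3 by auto
  have "q > 0" using dirichlet_characterD(1)[OF primitive_imp_character[OF prim]] .
  hence q1: "q > 1" using q by (cases N) auto
  consider "q = 3" | "q \<ge> 9" using conductor_6_impossible[OF prim] q \<open>q > 0\<close> by fastforce
  thus ?thesis
  proof cases
    case 1
    hence N: "N = 1" using q by simp
    \<comment> \<open>Here \<open>6 / sqrt q\<close> would exceed 2, the limit set by
      \<open>abel_coprime3_cos_le\<close>. With \<open>X = 2\<close> both residues lie beyond the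
      support, as \<open>2 * pi / 3 > 2\<close>, and the dual sum is 0.\<close>
    have "odd_tail 2 (2 * pi / 3) = 0" "odd_tail 2 (2 * pi * 2 / 3) = 0"
      using pi_gt3 by (auto simp: odd_tail_def max_def)
    hence "norm (dirichlet_L chi 1) \<le> 1 - 2/3 * ln 2 + 1/3 * ln 3"
      using odd_L_one_bound[OF prim q1 odd q, of 2] 1 N by simp
    thus ?thesis using ln2_ge_two_thirds 1 by simp
  next
    case 2
    define s where "s = sqrt (real q)"
    have s: "s \<ge> 3" "s > 0" "s\<^sup>2 = real q" using 2 real_le_rsqrt[of 3 "real q"] by (auto simp: s_def)
    \<comment> \<open>The minimiser of \<open>- 2/3 * ln X + s * X / 9\<close>, the part of the
      bound that depends on \<open>X\<close>. The next constant is the cut-off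
      \<open>T = q * X / (2 * pi)\<close> for residues.\<close>
    define X where "X = 6 / s"
    define T where "T = 3 * s / pi"
    have X: "0 < X" "X \<le> 2" using s by (auto simp: X_def field_simps)
    have tX: "2 * pi * y / real q / X = y / T" for y
      unfolding X_def T_def s(3)[symmetric] using s(2) by (simp add: field_simps power2_eq_square)
    have T0: "0 < T" using s by (simp add: T_def)
    have "3 * s \<le> pi * s" using pi_gt3 s by (intro mult_right_mono) auto
    hence "T \<le> s" by (simp add: T_def field_simps)
    moreover have "s * 1 \<le> s * s" using s by (intro mult_left_mono) auto
    hence "s \<le> real q" using s(3) unfolding power2_eq_square by linarith
    ultimately have T1: "T \<le> 3 * real N" using q by simp
    have "norm (dirichlet_L chi 1) \<le> 1 - 2/3 * ln X + 1/3 * ln 3 + pi / s * (2/9 * T)"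
      using odd_L_one_bound[OF prim q1 odd q X] sum_odd_tail_le[OF T0 T1] s(2)
      unfolding odd_tail_def tX s_def[symmetric]
      by (elim order_trans) (intro add_left_mono mult_left_mono, auto)
    also have "pi / s * (2/9 * T) = 2/3" using s by (simp add: T_def)
    also have "ln X = ln 6 - 1/2 * ln (real q)"
      using s by (simp add: X_def ln_div s_def ln_sqrt)
    also have "1 - 2/3 * (ln 6 - 1/2 * ln (real q)) + 1/3 * ln 3 + 2/3 = 1/3 * ln (real q) + (5 - 2 * ln 6 + ln 3) / 3"
      by (simp add: field_simps)
    also have "2 * ln 6 - ln 3 = ln (12::real)"
      using ln_div[of "6^2::real" 3] ln_realpow[of "6::real" 2] by simp
    hence "(5 - 2 * ln 6 + ln 3) / 3 \<le> (0.838374::real)" using ln_12_ge by (simp add: field_simps)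
    finally show ?thesis by simp
  qed
qed

section \<open>The sine integral and the kernel for even characters\<close>

lemma nonneg_of_deriv_nonneg:
  fixes f f' :: "real \<Rightarrow> real"
  assumes "\<And>x. 0 \<le> x \<Longrightarrow> x \<le> b \<Longrightarrow> (f has_real_derivative f' x) (at x)"
    "\<And>x. 0 \<le> x \<Longrightarrow> x \<le> b \<Longrightarrow> 0 \<le> f' x" "f 0 = 0" "0 \<le> x" "x \<le> b"
  shows "0 \<le> f x"
proof -
  have "f 0 \<le> f x"
    by (rule DERIV_nonneg_imp_nondecreasing[OF assms(4)]) (use assms in force)
  thus ?thesis using assms(3) by simp
qed

text \<open>The asymptotic expansion of the sine integral, cut off at a term that makes it an upper bound.\<close>
lemma two_Si_le:
  fixes a :: real
  assumes "0 < a"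
  shows "2 * Si a + 2 * cos a / a + 2 * sin a / a ^ 2 - 4 * cos a / a ^ 3 - 12 * sin a / a ^ 4
    + 48 * cos a / a ^ 5 + 240 * (sin a - 1) / a ^ 6 \<le> pi"
proof -
  define E where "E = (\<lambda>a. 2 * Si a + 2 * cos a / a + 2 * sin a / a ^ 2 - 4 * cos a / a ^ 3 - 12 * sin a / a ^ 4
    + 48 * cos a / a ^ 5 + 240 * (sin a - 1) / a ^ 6)"
  \<comment> \<open>The last numerator is \<open>sin a - 1\<close> instead of \<open>sin a\<close>:
    this turns the derivative into a nonnegative multiple of \<open>1 - sin x\<close>, so
    \<open>E\<close> increases to its limit \<open>pi\<close>.\<close>
  have dE: "(E has_real_derivative 1440 * (1 - sin x) / x ^ 7) (at x)" if "x > 0" for x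
  proof -
    have "(E has_real_derivative 2 * (sin x / x) + (- 2 * sin x * x - 2 * cos x) / x\<^sup>2
        + (2 * cos x * x ^ 2 - 2 * sin x * (2 * x)) / (x ^ 2)\<^sup>2
        - (- 4 * sin x * x ^ 3 - 4 * cos x * (3 * x ^ 2)) / (x ^ 3)\<^sup>2
        - (12 * cos x * x ^ 4 - 12 * sin x * (4 * x ^ 3)) / (x ^ 4)\<^sup>2
        + (- 48 * sin x * x ^ 5 - 48 * cos x * (5 * x ^ 4)) / (x ^ 5)\<^sup>2
        + (240 * cos x * x ^ 6 - 240 * (sin x - 1) * (6 * x ^ 5)) / (x ^ 6)\<^sup>2) (at x)"
      unfolding E_def using that
      by (auto intro!: derivative_eq_intros DERIV_Si simp: power2_eq_square mult_ac)
    moreover have "2 * (sin x / x) + (- 2 * sin x * x - 2 * cos x) / x\<^sup>2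
        + (2 * cos x * x ^ 2 - 2 * sin x * (2 * x)) / (x ^ 2)\<^sup>2
        - (- 4 * sin x * x ^ 3 - 4 * cos x * (3 * x ^ 2)) / (x ^ 3)\<^sup>2
        - (12 * cos x * x ^ 4 - 12 * sin x * (4 * x ^ 3)) / (x ^ 4)\<^sup>2
        + (- 48 * sin x * x ^ 5 - 48 * cos x * (5 * x ^ 4)) / (x ^ 5)\<^sup>2
        + (240 * cos x * x ^ 6 - 240 * (sin x - 1) * (6 * x ^ 5)) / (x ^ 6)\<^sup>2 = 1440 * (1 - sin x) / x ^ 7"
      using that by (simp add: field_simps) (simp add: eval_nat_numeral algebra_simps)
    ultimately show ?thesis by simp
  qed
  have mono: "E a \<le> E b" if "a \<le> b" for b
  proof (rule DERIV_nonneg_imp_nondecreasing[OF that])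
    fix x assume x: "a \<le> x"
    have "0 \<le> 1440 * (1 - sin x) / x ^ 7" using x assms by (intro divide_nonneg_nonneg) auto
    thus "\<exists>y. (E has_real_derivative y) (at x) \<and> 0 \<le> y" using dE[of x] x assms by auto
  qed
  have lim: "((\<lambda>a. c * f a / a ^ n) \<longlongrightarrow> 0) at_top"
    if "\<And>a. \<bar>f a\<bar> \<le> 2" "n > 0" for c :: real and f :: "real \<Rightarrow> real" and n
  proof (rule Lim_null_comparison)
    show "((\<lambda>a. \<bar>c\<bar> * 2 / a ^ n) \<longlongrightarrow> 0) at_top"
      by (rule real_tendsto_divide_at_top[OF tendsto_const filterlim_pow_at_top[OF that(2) filterlim_ident]])
    show "\<forall>\<^sub>F a in at_top. norm (c * f a / a ^ n) \<le> \<bar>c\<bar> * 2 / a ^ n"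
      using eventually_gt_at_top[of 0]
    proof eventually_elim
      case (elim a)
      have "\<bar>c\<bar> * \<bar>f a\<bar> \<le> \<bar>c\<bar> * 2" using that(1) by (intro mult_left_mono) auto
      thus ?case using elim by (simp add: abs_mult divide_right_mono)
    qed
  qed
  have b: "\<bar>sin a\<bar> \<le> 2" "\<bar>cos a\<bar> \<le> 2" "\<bar>sin a - 1\<bar> \<le> 2" for a :: real
    using abs_sin_le_one[of a] abs_cos_le_one[of a] sin_le_one[of a] sin_ge_minus_one[of a] by linarith+
  have "(E \<longlongrightarrow> 2 * (pi / 2) + 0 + 0 - 0 - 0 + 0 + 0) at_top"
    unfolding E_def
    by (intro tendsto_add tendsto_diff tendsto_mult_left Si_at_top lim b
          lim[of "\<lambda>a. cos a" 1 2, simplified]) auto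
  hence "(E \<longlongrightarrow> pi) at_top" by simp
  hence "E a \<le> pi"
    by (rule tendsto_lowerbound) (use mono in \<open>auto intro: eventually_mono[OF eventually_ge_at_top[of a]]\<close>)
  thus ?thesis by (simp add: E_def)
qed

text \<open>This is \<open>a ^ 6\<close> times the gap between the left side of
  \<open>two_Si_le\<close> and \<open>even_kernel_transform a\<close>. In terms of the half angle,
  and with \<open>|cos (a / 2)| <= 1\<close>, it is at least a quadratic polynomial in
  \<open>t = |sin (a / 2)|\<close> without sign change.\<close>

lemma two_Si_remainder_nonneg:
  fixes a :: real
  assumes a: "6 \<le> a"
  shows "0 \<le> 32 / 3 * (1 - cos a) * a ^ 3 - 16 * sin a * a ^ 2 + 48 * cos a * a + 240 * (sin a - 1)"
proof -
  define S C t where "S = sin (a / 2)" and "C = cos (a / 2)" and "t = \<bar>S\<bar>"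
  have sa: "sin a = 2 * S * C" using sin_double[of "a / 2"] by (simp add: S_def C_def)
  have ca: "cos a = 1 - 2 * t\<^sup>2" using cos_double_sin[of "a / 2"] by (simp add: S_def t_def)
  define al be ga where "al = 32 / 3 * a * (2 * a\<^sup>2 - 9)" and "be = 32 * (a\<^sup>2 - 15)" and "ga = 48 * (a - 5)"
  define b where "b = a - 6"
  have b: "b \<ge> 0" "a = 6 + b" using a by (auto simp: b_def)
  have a2: "a\<^sup>2 \<ge> 36" using power_mono[of 6 a 2] a by simp
  have al: "al > 0" unfolding al_def using a a2 by (intro mult_pos_pos) auto
  have be: "be \<ge> 0" using a2 by (simp add: be_def)
  \<comment> \<open>The negated discriminant, expanded at 6: every coefficient in
    \<open>b = a - 6\<close> is positive.\<close>
  have "4 * al * ga - be\<^sup>2 = 1024 * (315 + 666 * b + 300 * b ^ 2 + 52 * b ^ 3 + 3 * b ^ 4)"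
    unfolding al_def be_def ga_def b(2) by (simp add: eval_nat_numeral field_simps)
  also have "\<dots> \<ge> 0" using b(1) by (intro mult_nonneg_nonneg add_nonneg_nonneg) auto
  finally have disc: "4 * al * ga - be\<^sup>2 \<ge> 0" .
  have "4 * al * (al * t\<^sup>2 - be * t + ga) = (2 * al * t - be)\<^sup>2 + (4 * al * ga - be\<^sup>2)"
    by (simp add: power2_eq_square algebra_simps)
  also have "\<dots> \<ge> 0" using disc by (intro add_nonneg_nonneg) auto
  finally have quad: "0 \<le> al * t\<^sup>2 - be * t + ga" using al by (simp add: zero_le_mult_iff)
  have "S * C \<le> \<bar>S\<bar> * 1" 
    using abs_le_D1[of "S * C" "\<bar>S\<bar> * 1"] by (simp add: abs_mult C_def mult_left_le)
  hence "be * (S * C) \<le> be * t" using be by (intro mult_left_mono) (auto simp: t_def)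
  hence "0 \<le> al * t\<^sup>2 - be * (S * C) + ga" using quad by linarith
  also have "\<dots> = 32 / 3 * (1 - cos a) * a ^ 3 - 16 * sin a * a ^ 2 + 48 * cos a * a + 240 * (sin a - 1)"
    unfolding sa ca al_def be_def ga_def by (simp add: eval_nat_numeral field_simps)
  finally show ?thesis .
qed

text \<open>The sine transform of the even kernel at \<open>a = n * X\<close>, as
  \<open>integral_even_kernel_sin\<close> shows. Its bound by \<open>pi\<close> is the nonnegativity
  of the weight \<open>g\<close>.\<close>

definition even_kernel_transform :: "real \<Rightarrow> real" where
  "even_kernel_transform a = 2 * Si a + 2 * cos a / a + 2 * sin a / a ^ 2 + (20 * cos a - 32) / (3 * a ^ 3) + 4 * sin a / a ^ 4"

lemma even_kernel_transform_le_pi_large: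
  assumes "6 \<le> a"
  shows "even_kernel_transform a \<le> pi"
proof -
  have a: "a > 0" using assms by simp
  have "even_kernel_transform a + (32 / 3 * (1 - cos a) * a ^ 3 - 16 * sin a * a ^ 2 + 48 * cos a * a + 240 * (sin a - 1)) / a ^ 6
     = 2 * Si a + 2 * cos a / a + 2 * sin a / a ^ 2 - 4 * cos a / a ^ 3 - 12 * sin a / a ^ 4
    + 48 * cos a / a ^ 5 + 240 * (sin a - 1) / a ^ 6"
    unfolding even_kernel_transform_def using a by (simp add: field_simps) (simp add: eval_nat_numeral algebra_simps)
  also have "\<dots> \<le> pi" by (rule two_Si_le[OF a])
  finally show ?thesis using two_Si_remainder_nonneg[OF assms] a
    by (smt (verit) divide_nonneg_nonneg zero_le_power)
qed

text \<open>Up to a positive factor, the derivative of \<open>even_kernel_transform\<close>. On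
  \<open>[0, pi]\<close> two differentiations reduce the sign to
  \<open>sin x - x * cos x >= 0\<close>; beyond \<open>pi\<close> the sine is nonpositive and the
  terms can be compared directly.\<close>

lemma even_kernel_transform_deriv_nonneg:
  fixes a :: real
  assumes "0 \<le> a" "a \<le> 2 * pi"
  shows "0 \<le> 6 * a - 3 * a * cos a - 3 * sin a - 2 * a\<^sup>2 * sin a"
proof (cases "a \<le> pi")
  case True
  have 0: "0 \<le> sin x - x * cos x" if "0 \<le> x" "x \<le> pi" for x :: real
    by (rule nonneg_of_deriv_nonneg[where b = pi and f = "\<lambda>x. sin x - x * cos x" and f' = "\<lambda>x. x * sin x"])
       (use that in \<open>auto intro!: derivative_eq_intros mult_nonneg_nonneg sin_ge_zero\<close>)
  have 1: "0 \<le> 6 - 6 * cos x - x * sin x - 2 * x\<^sup>2 * cos x" if "0 \<le> x" "x \<le> pi" for x :: real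
  proof (rule nonneg_of_deriv_nonneg[where b = pi and f = "\<lambda>x. 6 - 6 * cos x - x * sin x - 2 * x\<^sup>2 * cos x"
        and f' = "\<lambda>x. 5 * (sin x - x * cos x) + 2 * x\<^sup>2 * sin x"])
    fix y :: real assume "0 \<le> y" "y \<le> pi"
    thus "0 \<le> 5 * (sin y - y * cos y) + 2 * y\<^sup>2 * sin y"
      using 0[of y] sin_ge_zero[of y] by (intro add_nonneg_nonneg mult_nonneg_nonneg) auto
  qed (use that in \<open>auto intro!: derivative_eq_intros simp: algebra_simps power2_eq_square\<close>)
  show ?thesis
    by (rule nonneg_of_deriv_nonneg[where b = pi and f = "\<lambda>x. 6 * x - 3 * x * cos x - 3 * sin x - 2 * x\<^sup>2 * sin x"
        and f' = "\<lambda>x. 6 - 6 * cos x - x * sin x - 2 * x\<^sup>2 * cos x"])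
       (use assms True 1 in \<open>auto intro!: derivative_eq_intros simp: algebra_simps power2_eq_square\<close>)
next
  case False
  have s: "sin a \<le> 0" using False assms sin_ge_zero[of "a - pi"] by (simp add: sin_diff)
  have "a * cos a \<le> a * 1" using assms by (intro mult_left_mono) auto
  moreover have "a\<^sup>2 * sin a \<le> 0" using s by (intro mult_nonneg_nonpos) auto
  ultimately show ?thesis using s assms(1) by (simp add: mult.assoc)
qed

text \<open>Up to \<open>2 * pi\<close> the transform increases, and \<open>2 * pi > 6\<close>
  already lies in the range of the asymptotic estimate.\<close>

lemma even_kernel_transform_le_pi:
  assumes "0 < a"
  shows "even_kernel_transform a \<le> pi"
proof (cases "a \<le> 2 * pi")
  case True
  have d: "(even_kernel_transform has_real_derivative 16 / 3 * (6 * x - 3 * x * cos x - 3 * sin x - 2 * x\<^sup>2 * sin x) / x ^ 5) (at x)" if "x > 0" for x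
  proof -
    have "(even_kernel_transform has_real_derivative 2 * (sin x / x) + (- 2 * sin x * x - 2 * cos x) / x\<^sup>2
        + (2 * cos x * x ^ 2 - 2 * sin x * (2 * x)) / (x ^ 2)\<^sup>2
        + (- 20 * sin x * (3 * x ^ 3) - (20 * cos x - 32) * (9 * x ^ 2)) / (3 * x ^ 3)\<^sup>2
        + (4 * cos x * x ^ 4 - 4 * sin x * (4 * x ^ 3)) / (x ^ 4)\<^sup>2) (at x)"
      unfolding even_kernel_transform_def[abs_def] using that
      by (auto intro!: derivative_eq_intros DERIV_Si simp: power2_eq_square mult_ac)
    moreover have "2 * (sin x / x) + (- 2 * sin x * x - 2 * cos x) / x\<^sup>2
        + (2 * cos x * x ^ 2 - 2 * sin x * (2 * x)) / (x ^ 2)\<^sup>2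
        + (- 20 * sin x * (3 * x ^ 3) - (20 * cos x - 32) * (9 * x ^ 2)) / (3 * x ^ 3)\<^sup>2
        + (4 * cos x * x ^ 4 - 4 * sin x * (4 * x ^ 3)) / (x ^ 4)\<^sup>2 = 16 / 3 * (6 * x - 3 * x * cos x - 3 * sin x - 2 * x\<^sup>2 * sin x) / x ^ 5"
      using that by (simp add: field_simps) (simp add: eval_nat_numeral algebra_simps)
    ultimately show ?thesis by simp
  qed
  have "even_kernel_transform a \<le> even_kernel_transform (2 * pi)"
  proof (rule DERIV_nonneg_imp_nondecreasing[OF True])
    fix x assume x: "a \<le> x" "x \<le> 2 * pi"
    have "0 \<le> 16 / 3 * (6 * x - 3 * x * cos x - 3 * sin x - 2 * x\<^sup>2 * sin x) / x ^ 5"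
      using x assms even_kernel_transform_deriv_nonneg[of x] by (intro divide_nonneg_nonneg mult_nonneg_nonneg) auto
    thus "\<exists>y. (even_kernel_transform has_real_derivative y) (at x) \<and> 0 \<le> y"
      using d[of x] x assms by auto
  qed
  also have "\<dots> \<le> pi" using pi_gt3 by (intro even_kernel_transform_le_pi_large) auto
  finally show ?thesis .
next
  case False
  thus ?thesis using pi_gt3 by (intro even_kernel_transform_le_pi_large) auto
qed

text \<open>The expansion of \<open>2 * (1 - u)^2 * (1 + 2 * u - u^2 / 3) / u\<close>.\<close>

definition even_kernel :: "real \<Rightarrow> real" where
  "even_kernel u = 2 / u - 20 / 3 * u + 16 / 3 * u ^ 2 - 2 / 3 * u ^ 3"

text \<open>The integral of \<open>even_kernel\<close> from \<open>u\<close> to 1; the constant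
  \<open>31 / 18\<close> makes the formula vanish at 1.\<close>

definition even_tail :: "real \<Rightarrow> real" where
  "even_tail u = (if u < 1 then - 31 / 18 - 2 * ln u + 10 / 3 * u ^ 2 - 16 / 9 * u ^ 3 + u ^ 4 / 6 else 0)"

lemma even_kernel_measurable [measurable]: "even_kernel \<in> borel_measurable borel"
  unfolding even_kernel_def by measurable

text \<open>Since \<open>- even_kernel\<close> is the derivative of the tail, this is the convexity
  of the tail on the unit interval.\<close>

lemma even_kernel_antimono:
  assumes "0 < x" "x \<le> y" "y \<le> 1"
  shows "even_kernel y \<le> even_kernel x"
proof (rule DERIV_nonpos_imp_nonincreasing[OF assms(2)])
  fix z assume z: "x \<le> z" "z \<le> y"
  hence z0: "0 < z" "z \<le> 1" using assms by auto
  have "(even_kernel has_real_derivative - 2 / z\<^sup>2 - 20 / 3 + 32 / 3 * z - 2 * z\<^sup>2) (at z)"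
    unfolding even_kernel_def[abs_def] using z0 
    by (auto intro!: derivative_eq_intros simp: power2_eq_square)
  moreover have "- 2 / z\<^sup>2 - 20 / 3 + 32 / 3 * z - 2 * z\<^sup>2 \<le> 0"
  proof -
    have "1 \<le> 1 / z\<^sup>2" using z0 by (simp add: power_le_one)
    \<comment> \<open>After the estimate \<open>1 / z^2 >= 1\<close> a quadratic polynomial with
      root 1 remains.\<close>
    moreover have "(1 - z) * (26 / 3 - 2 * z) \<ge> 0" using z0 by (intro mult_nonneg_nonneg) auto
    hence "0 \<le> 26 / 3 - 32 / 3 * z + 2 * z\<^sup>2" by (simp add: power2_eq_square field_simps)
    ultimately show ?thesis by simp
  qed
  ultimately show "\<exists>D. (even_kernel has_real_derivative D) (at z) \<and> D \<le> 0" by blast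
qed

lemma even_kernel_nonneg:
  assumes "0 < u" "u \<le> 1"
  shows "0 \<le> even_kernel u"
  using even_kernel_antimono[of u 1] assms by (simp add: even_kernel_def)

lemma even_kernel_le:
  assumes "0 < u" "u \<le> 1"
  shows "even_kernel u \<le> 2 / u"
proof -
  have "u * u \<le> u * 1" using assms by (intro mult_left_mono) auto
  moreover have "0 \<le> u ^ 3" using assms by simp
  ultimately show ?thesis using assms unfolding even_kernel_def power2_eq_square by linarith
qed

lemma DERIV_even_tail:
  assumes "0 < u"
  shows "((\<lambda>u. - 31 / 18 - 2 * ln u + 10 / 3 * u ^ 2 - 16 / 9 * u ^ 3 + u ^ 4 / 6) has_real_derivative - even_kernel u) (at u)"
  unfolding even_kernel_def using assms
  by (auto intro!: derivative_eq_intros simp: eval_nat_numeral)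

lemma even_tail_eq:
  assumes "0 < u" "u \<le> 1"
  shows "even_tail u = - 31 / 18 - 2 * ln u + 10 / 3 * u ^ 2 - 16 / 9 * u ^ 3 + u ^ 4 / 6"
  using assms by (cases "u = 1") (auto simp: even_tail_def)

lemma even_tail_tangent_unit:
  assumes "0 < x" "x \<le> 1" "0 < y" "y \<le> 1"
  shows "even_tail x - even_kernel x * (y - x) \<le> even_tail y"
proof -
  define f where "f = (\<lambda>u::real. - 31 / 18 - 2 * ln u + 10 / 3 * u ^ 2 - 16 / 9 * u ^ 3 + u ^ 4 / 6)"
  have d: "(f has_real_derivative - even_kernel u) (at u)" if "u > 0" for u
    unfolding f_def by (rule DERIV_even_tail[OF that])
  have "f x - even_kernel x * (y - x) \<le> f y"
  proof (cases x y rule: linorder_cases)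
    case less
    then obtain z where z: "x < z" "z < y" "f y - f x = (y - x) * - even_kernel z"
      using MVT2[of x y f "\<lambda>u. - even_kernel u"] d assms by auto
    have "even_kernel z \<le> even_kernel x" using z assms by (intro even_kernel_antimono) auto
    hence "(y - x) * even_kernel z \<le> (y - x) * even_kernel x" using less by (intro mult_left_mono) auto
    thus ?thesis using z(3) by (simp add: mult.commute)
  next
    case greater
    then obtain z where z: "y < z" "z < x" "f x - f y = (x - y) * - even_kernel z"
      using MVT2[of y x f "\<lambda>u. - even_kernel u"] d assms by auto
    have "even_kernel x \<le> even_kernel z" using z assms by (intro even_kernel_antimono) auto
    hence "(x - y) * even_kernel x \<le> (x - y) * even_kernel z" using greater by (intro mult_left_mono) auto
    thus ?thesis using z(3) by (simp add: algebra_simps)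
  qed auto
  thus ?thesis using assms by (simp add: even_tail_eq f_def)
qed

lemma even_tail_nonneg:
  assumes "0 < u"
  shows "0 \<le> even_tail u"
proof (cases "u < 1")
  case True
  thus ?thesis using even_tail_tangent_unit[of 1 u] assms by (simp add: even_tail_def even_kernel_def)
qed (auto simp: even_tail_def)

text \<open>Past 1 the tail and its slope are 0; the inequality survives the gluing because the
  slope \<open>- even_kernel x\<close> before 1 is never positive.\<close>

lemma even_tail_tangent:
  assumes "0 < x" "0 < y"
  shows "even_tail x + (if x < 1 then - even_kernel x else 0) * (y - x) \<le> even_tail y"
proof (cases "x < 1")
  case True
  show ?thesis
  proof (cases "y \<le> 1")
    case y: True
    thus ?thesis using even_tail_tangent_unit[of x y] assms True by simp
  next
    case False
    have "even_tail x - even_kernel x * (1 - x) \<le> 0"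
      using even_tail_tangent_unit[of x 1] assms True by (simp add: even_tail_def)
    moreover have "even_kernel x * (1 - x) \<le> even_kernel x * (y - x)"
      using False True assms even_kernel_nonneg[of x] by (intro mult_left_mono) auto
    ultimately show ?thesis using True False by (simp add: even_tail_def[of y])
  qed
next
  case False
  thus ?thesis using even_tail_nonneg[OF assms(2)] by (simp add: even_tail_def[of x])
qed

text \<open>The tail has integral \<open>44 / 45\<close> over the unit interval, and the block
  estimate multiplies this by \<open>2 / 3\<close>. Its logarithmic singularity at 0 forces the
  interior form of the fundamental theorem, with an antiderivative continuous at 0.\<close>

lemma sum_even_tail_le:
  assumes T: "0 < T" "T \<le> 3 * real N"
  shows "(\<Sum>j<N. even_tail ((3 * real j + 1) / T) + even_tail ((3 * real j + 2) / T)) \<le> 88 / 135 * T"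
proof -
  define f where "f = (\<lambda>y. even_tail (y / T))"
  define d where "d = (\<lambda>y. (if y / T < 1 then - even_kernel (y / T) else 0) / T)"
  define P where "P = (\<lambda>u::real. - 31 / 18 * u - 2 * (u * ln u - u) + 10 / 9 * u ^ 3 - 4 / 9 * u ^ 4 + u ^ 5 / 30)"
  have 1: "(f has_integral (T * P (T / T) - T * P (0 / T))) {0..T}"
  proof (rule fundamental_theorem_of_calculus_interior)
    have "continuous_on {0..1} P" unfolding P_def by (intro continuous_intros continuous_on_x_ln_x) auto
    hence "continuous_on {0..T} (\<lambda>y. P (y / T))"
      by (rule continuous_on_compose2) (use T in \<open>auto intro!: continuous_intros\<close>)
    thus "continuous_on {0..T} (\<lambda>y. T * P (y / T))" by (intro continuous_intros)
    fix y assume y: "y \<in> {0<..<T}"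
    define u where "u = y / T"
    have u: "0 < u" "u < 1" using y T by (auto simp: u_def)
    have "(P has_real_derivative even_tail u) (at u)"
      unfolding P_def even_tail_eq[OF u(1) less_imp_le[OF u(2)]] using u 
      by (auto intro!: derivative_eq_intros simp: field_simps eval_nat_numeral)
    moreover have "((\<lambda>y. y / T) has_real_derivative 1 / T) (at y)"
      using T by (auto intro!: derivative_eq_intros)
    ultimately have "((\<lambda>y. P (y / T)) has_real_derivative even_tail u * (1 / T)) (at y)"
      unfolding u_def by (rule DERIV_chain2)
    hence "((\<lambda>y. T * P (y / T)) has_real_derivative T * (even_tail u * (1 / T))) (at y)" by (rule DERIV_cmult)
    thus "((\<lambda>y. T * P (y / T)) has_vector_derivative f y) (at y)"
      using T by (simp add: f_def u_def has_real_derivative_iff_has_vector_derivative)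
  qed (use T in auto)
  have "T * P (T / T) - T * P (0 / T) = 44 / 45 * T" using T by (simp add: P_def)
  with 1 have 1: "(f has_integral 44 / 45 * T) {0..T}" by (simp only:)
  have 2: "(f has_integral 0) {T..3 * real N}"
    by (rule has_integral_is_0) (use T in \<open>auto simp: f_def even_tail_def\<close>)
  have I: "(f has_integral 44 / 45 * T) {0..3 * real N}"
    using has_integral_combine[OF _ _ 1 2] T by simp
  have "(\<Sum>j<N. f (3 * real j + 1) + f (3 * real j + 2)) \<le> 2 / 3 * integral {0..3 * real N} f"
  proof (rule sum_coprime3_le_integral[where d = d])
    fix x y :: real assume xy: "0 < x" "0 < y"
    have "d x * (y - x) = (if x / T < 1 then - even_kernel (x / T) else 0) * (y / T - x / T)"
      using T by (simp add: d_def diff_divide_distrib right_diff_distrib)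
    thus "f x + d x * (y - x) \<le> f y"
      using even_tail_tangent[of "x / T" "y / T"] xy T by (simp add: f_def)
  next
    fix x y :: real assume xy: "0 < x" "x \<le> y"
    have le: "x / T \<le> y / T" using xy T by (simp add: divide_right_mono)
    have "(if x / T < 1 then - even_kernel (x / T) else 0) \<le> (if y / T < 1 then - even_kernel (y / T) else 0)"
      using le xy T even_kernel_antimono[of "x / T" "y / T"] even_kernel_nonneg[of "x / T"] by auto
    thus "d x \<le> d y" unfolding d_def using T by (intro divide_right_mono) auto
  next
    show "f integrable_on {0..3 * real N}" using I by blast
  qed
  thus ?thesis using integral_unique[OF I] by (simp add: f_def)
qed

section \<open>The half-angle cotangent as comparison kernel\<close>

lemma cot_half_step:
  fixes x :: real
  assumes "sin (x / 2) \<noteq> 0"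
  shows "cot (x / 2) * sin (real (Suc n) * x) = cot (x / 2) * sin (real n * x) + (cos (real n * x) + cos (real (Suc n) * x))"
proof -
  define t m where "t = x / 2" and "m = (real n + 1 / 2) * x"
  have e: "real (Suc n) * x = m + t" "real n * x = m - t" by (auto simp: m_def t_def algebra_simps)
  have "sin (m + t) = sin (m - t) + 2 * cos m * sin t" "cos (m - t) + cos (m + t) = 2 * cos m * cos t"
    by (simp_all add: sin_add sin_diff cos_add cos_diff)
  thus ?thesis unfolding e t_def[symmetric] using assms by (simp add: cot_def t_def field_simps)
qed

lemma has_integral_cos_0_pi: "((\<lambda>x. cos (real n * x)) has_integral (if n = 0 then pi else 0)) {0..pi}"
proof (cases "n = 0")
  case True
  thus ?thesis using has_integral_const_real[of "1::real" 0 pi] by simp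
next
  case False
  have "((\<lambda>x. cos (real n * x)) has_integral (sin (real n * pi) / real n - sin (real n * 0) / real n)) {0..pi}"
    using False by (intro fundamental_theorem_of_calculus)
      (auto intro!: derivative_eq_intros simp flip: has_real_derivative_iff_has_vector_derivative)
  thus ?thesis using False by simp
qed

text \<open>The conjugate Dirichlet kernel: on the positive integers the sine transform of the half-angle
  cotangent is constant, so that it represents the full weight 1.\<close>
lemma has_integral_cot_sin:
  "((\<lambda>x. cot (x / 2) * sin (real n * x)) has_integral (if n = 0 then 0 else pi)) {0..pi}"
proof (induction n)
  case (Suc n)
  \<comment> \<open>The added cosines integrate to \<open>pi\<close> for \<open>n = 0\<close>, from
    the constant term, and to 0 for every later \<open>n\<close>.\<close>
  have "((\<lambda>x. cot (x / 2) * sin (real n * x) + (cos (real n * x) + cos (real (Suc n) * x))) has_integral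
     ((if n = 0 then 0 else pi) + ((if n = 0 then pi else 0) + (if Suc n = 0 then pi else 0)))) {0..pi}"
    by (intro has_integral_add Suc.IH has_integral_cos_0_pi)
  hence "((\<lambda>x. cot (x / 2) * sin (real n * x) + (cos (real n * x) + cos (real (Suc n) * x))) has_integral pi) {0..pi}"
    by (cases "n = 0") auto
  hence "((\<lambda>x. cot (x / 2) * sin (real (Suc n) * x)) has_integral pi) {0..pi}"
  proof (rule has_integral_spike_finite[of "{0}", rotated 2])
    fix x assume "x \<in> {0..pi} - {0}"
    hence "sin (x / 2) > 0" by (intro sin_gt_zero) auto
    thus "cot (x / 2) * sin (real (Suc n) * x) = cot (x / 2) * sin (real n * x) + (cos (real n * x) + cos (real (Suc n) * x))"
      by (intro cot_half_step) auto
  qed auto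
  thus ?case by simp
qed (simp add: has_integral_0)

text \<open>Near 0 both the cotangent and the kernel are \<open>2 / x\<close> up to a bounded error,
  so their difference is bounded. Only boundedness matters, and the constant 2 is crude.\<close>

lemma cot_half_bounds:
  fixes x :: real
  assumes "0 < x" "x \<le> pi"
  shows "0 \<le> cot (x / 2)" "cot (x / 2) \<le> 2 / x" "2 / x - cot (x / 2) \<le> 2"
proof -
  define y where "y = x / 2"
  have y: "0 < y" "y \<le> pi / 2" using assms by (auto simp: y_def)
  have s: "sin y > 0" using y by (intro sin_gt_zero) auto
  have c: "cos y \<ge> 0" using y by (intro cos_ge_zero) auto
  show "0 \<le> cot (x / 2)" using s c by (simp add: cot_def y_def)
  have "0 \<le> sin y - y * cos y"
    by (rule nonneg_of_deriv_nonneg[where b = pi and f = "\<lambda>x. sin x - x * cos x" and f' = "\<lambda>x. x * sin x"])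
       (use y in \<open>auto intro!: derivative_eq_intros mult_nonneg_nonneg sin_ge_zero\<close>)
  hence "cos y / sin y \<le> 1 / y" using y s by (simp add: field_simps)
  thus "cot (x / 2) \<le> 2 / x" by (simp add: cot_def y_def)
  have "0 \<le> 2 * y * sin y - (sin y - y * cos y)"
  proof (rule nonneg_of_deriv_nonneg[where b = "pi / 2" and f = "\<lambda>y. 2 * y * sin y - (sin y - y * cos y)"
          and f' = "\<lambda>y. (2 - y) * sin y + 2 * y * cos y"])
    fix x :: real assume x: "0 \<le> x" "x \<le> pi / 2"
    thus "0 \<le> (2 - x) * sin x + 2 * x * cos x"
      using pi_less_4 by (intro add_nonneg_nonneg mult_nonneg_nonneg sin_ge_zero cos_ge_zero) auto
  qed (use y in \<open>auto intro!: derivative_eq_intros simp: algebra_simps\<close>)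
  hence "1 / y - cos y / sin y \<le> 2" using y s by (simp add: field_simps)
  thus "2 / x - cot (x / 2) \<le> 2" by (simp add: cot_def y_def)
qed

lemma even_kernel_ge:
  assumes "0 < u" "u \<le> 1"
  shows "2 / u - even_kernel u \<le> 8"
proof -
  have "u ^ 3 \<le> 1" using assms by (simp add: power_le_one)
  moreover have "0 \<le> u ^ 2" by simp
  ultimately show ?thesis using assms unfolding even_kernel_def by linarith
qed

text \<open>The pole \<open>2 / x\<close> contributes \<open>2 * Si\<close>; the polynomial
  remainder \<open>m\<close> is integrated by parts until it is exhausted, which gives
  \<open>A\<close>.\<close>

lemma integral_even_kernel_sin:
  assumes X: "0 < X" and n: "n > 0"
  shows "((\<lambda>x. even_kernel (x / X) / X * sin (real n * x)) has_integral even_kernel_transform (real n * X)) {0..X}"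
proof -
  define a where "a = real n * X"
  have a: "a > 0" using X n by (simp add: a_def)
  define m where "m = (\<lambda>u::real. - 20 / 3 * u + 16 / 3 * u ^ 2 - 2 / 3 * u ^ 3)"
  define A where "A = (\<lambda>u. - m u * cos (a * u) / a + (- 20 / 3 + 32 / 3 * u - 2 * u ^ 2) * sin (a * u) / a ^ 2
      + (32 / 3 - 4 * u) * cos (a * u) / a ^ 3 + 4 * sin (a * u) / a ^ 4)"
  have dA: "(A has_real_derivative m u * sin (a * u)) (at u)" for u
  proof -
    have "(A has_real_derivative
        (- (- 20 / 3 + 32 / 3 * u - 2 * u ^ 2) * cos (a * u) + m u * (sin (a * u) * a)) / a
        + ((32 / 3 - 4 * u) * sin (a * u) + (- 20 / 3 + 32 / 3 * u - 2 * u ^ 2) * (cos (a * u) * a)) / a ^ 2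
        + (- 4 * cos (a * u) - (32 / 3 - 4 * u) * (sin (a * u) * a)) / a ^ 3
        + 4 * (cos (a * u) * a) / a ^ 4) (at u)"
      unfolding A_def
    proof (intro DERIV_add DERIV_cdivide)
      show "((\<lambda>u. - m u * cos (a * u)) has_real_derivative
          - (- 20 / 3 + 32 / 3 * u - 2 * u ^ 2) * cos (a * u) + m u * (sin (a * u) * a)) (at u)"
        unfolding m_def by (auto intro!: derivative_eq_intros simp: field_simps)
      show "((\<lambda>u. (- 20 / 3 + 32 / 3 * u - 2 * u ^ 2) * sin (a * u)) has_real_derivative
          (32 / 3 - 4 * u) * sin (a * u) + (- 20 / 3 + 32 / 3 * u - 2 * u ^ 2) * (cos (a * u) * a)) (at u)"
        by (auto intro!: derivative_eq_intros simp: algebra_simps)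
      show "((\<lambda>u. (32 / 3 - 4 * u) * cos (a * u)) has_real_derivative
          - 4 * cos (a * u) - (32 / 3 - 4 * u) * (sin (a * u) * a)) (at u)"
        by (auto intro!: derivative_eq_intros simp: algebra_simps)
      show "((\<lambda>u. 4 * sin (a * u)) has_real_derivative 4 * (cos (a * u) * a)) (at u)"
        by (auto intro!: derivative_eq_intros simp: algebra_simps)
    qed
    moreover have "(- (- 20 / 3 + 32 / 3 * u - 2 * u ^ 2) * cos (a * u) + m u * (sin (a * u) * a)) / a
        + ((32 / 3 - 4 * u) * sin (a * u) + (- 20 / 3 + 32 / 3 * u - 2 * u ^ 2) * (cos (a * u) * a)) / a ^ 2
        + (- 4 * cos (a * u) - (32 / 3 - 4 * u) * (sin (a * u) * a)) / a ^ 3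
        + 4 * (cos (a * u) * a) / a ^ 4 = m u * sin (a * u)"
      using a by (simp add: divide_simps) (simp add: eval_nat_numeral algebra_simps)
    ultimately show ?thesis by simp
  qed
  have "((\<lambda>x. even_kernel (x / X) / X * sin (real n * x)) has_integral
      ((2 * Si (real n * X) + A (X / X)) - (2 * Si (real n * 0) + A (0 / X)))) {0..X}"
  proof (rule fundamental_theorem_of_calculus_interior)
    have cSi: "continuous_on UNIV Si" by (simp add: continuous_on_eq_continuous_at isCont_Si)
    show "continuous_on {0..X} (\<lambda>x. 2 * Si (real n * x) + A (x / X))"
      unfolding A_def m_def
      by (intro continuous_intros continuous_on_compose2[OF cSi]) (use a X in auto)
    fix x assume x: "x \<in> {0<..<X}"
    have 1: "((\<lambda>x. Si (real n * x)) has_real_derivative sin (real n * x) / (real n * x) * real n) (at x)"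
    proof (rule DERIV_chain2[of Si])
      show "(Si has_real_derivative sin (real n * x) / (real n * x)) (at (real n * x))"
        using DERIV_Si[of "real n * x"] x n by simp
    qed (auto intro!: derivative_eq_intros)
    have 2: "((\<lambda>x. A (x / X)) has_real_derivative m (x / X) * sin (a * (x / X)) * (1 / X)) (at x)"
      by (rule DERIV_chain2[OF dA]) (use X in \<open>auto intro!: derivative_eq_intros\<close>)
    have "((\<lambda>x. 2 * Si (real n * x) + A (x / X)) has_real_derivative
        2 * (sin (real n * x) / (real n * x) * real n) + m (x / X) * sin (a * (x / X)) * (1 / X)) (at x)"
      by (intro DERIV_add DERIV_cmult 1 2)
    also have "2 * (sin (real n * x) / (real n * x) * real n) + m (x / X) * sin (a * (x / X)) * (1 / X) =
        even_kernel (x / X) / X * sin (real n * x)"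
    proof -
      have "a * (x / X) = real n * x" using X by (simp add: a_def)
      moreover have "even_kernel (x / X) / X = 2 / x + m (x / X) / X"
        using X x by (simp add: even_kernel_def m_def add_divide_distrib diff_divide_distrib)
      ultimately show ?thesis using n x by (simp add: algebra_simps)
    qed
    finally show "((\<lambda>x. 2 * Si (real n * x) + A (x / X)) has_vector_derivative
        even_kernel (x / X) / X * sin (real n * x)) (at x)"
      by (simp add: has_real_derivative_iff_has_vector_derivative)
  qed (use X in auto)
  moreover have "Si 0 = 0" using Si_neg[of 0] by simp
  hence "(2 * Si (real n * X) + A (X / X)) - (2 * Si (real n * 0) + A (0 / X)) = even_kernel_transform (real n * X)"
    unfolding even_kernel_transform_def a_def[symmetric] using X a 
    by (simp add: A_def m_def) (simp add: field_simps eval_nat_numeral)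
  ultimately show ?thesis by (simp only:)
qed

text \<open>The poles at 0 cancel into the antiderivative \<open>2 * ln (sin (x / 2) / x)\<close>.
  The end point \<open>2 * pi / 3\<close> is where the sine series over integers prime to 3 drops to
  0, and \<open>sin (pi / 3) = sqrt 3 / 2\<close> produces \<open>ln 3\<close>.\<close>

lemma integral_cot_minus_even_kernel:
  assumes X: "0 < X" "X \<le> 2 * pi / 3"
  shows "((\<lambda>x. cot (x / 2) - (if x \<le> X then even_kernel (x / X) / X else 0)) has_integral
     (ln 3 - 2 * ln X + 31 / 18)) {0..2 * pi / 3}"
proof -
  define b where "b = 2 * pi / 3"
  have b: "X \<le> b" "b < pi" using X by (auto simp: b_def)
  have spos: "sin (x / 2) > 0" if "0 < x" "x \<le> b" for x using that b by (intro sin_gt_zero) auto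
  define p where "p = (\<lambda>u::real. 10 / 3 * u ^ 2 - 16 / 9 * u ^ 3 + u ^ 4 / 6)"
  \<comment> \<open>The value at 0 is the limit of the logarithm, so that \<open>G\<close> is
    continuous up to the end point.\<close>
  define G where "G = (\<lambda>x. (if x = 0 then 2 * ln (1 / 2) else 2 * ln (sin (x / 2) / x)) + p (x / X))"
  have "((\<lambda>x. cot (x / 2) - even_kernel (x / X) / X) has_integral (G X - G 0)) {0..X}"
  proof (rule fundamental_theorem_of_calculus_interior)
    have "continuous (at x within {0..X}) (\<lambda>x. if x = 0 then 2 * ln (1 / 2) else 2 * ln (sin (x / 2) / x))"
      if x: "x \<in> {0..X}" for x
    proof (cases "x = 0")
      case True
      have "((\<lambda>x::real. 2 * ln (sin (x / 2) / x)) \<longlongrightarrow> 2 * ln (1 / 2)) (at_right 0)" by real_asymp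
      hence "((\<lambda>x. if x = 0 then 2 * ln (1 / 2) else 2 * ln (sin (x / 2) / x)) \<longlongrightarrow> 2 * ln (1 / 2 :: real)) (at_right 0)"
        by (rule Lim_transform_eventually) (auto simp: eventually_at_filter)
      thus ?thesis using True X by (simp add: continuous_within at_within_Icc_at_right)
    next
      case False
      have "isCont (\<lambda>x. 2 * ln (sin (x / 2) / x)) x"
        using False x spos[of x] b by (intro continuous_intros) auto
      moreover have "eventually (\<lambda>y. (if y = 0 then 2 * ln (1 / 2) else 2 * ln (sin (y / 2) / y)) = 2 * ln (sin (y / 2) / y)) (nhds x)"
        using t1_space_nhds[OF False] by eventually_elim auto
      ultimately have "isCont (\<lambda>x. if x = 0 then 2 * ln (1 / 2) else 2 * ln (sin (x / 2) / x)) x"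
        by (subst isCont_cong) auto
      thus ?thesis by (rule continuous_at_imp_continuous_within)
    qed
    hence "continuous_on {0..X} (\<lambda>x. if x = 0 then 2 * ln (1 / 2) else 2 * ln (sin (x / 2) / x))"
      by (simp add: continuous_on_eq_continuous_within)
    thus "continuous_on {0..X} G" unfolding G_def p_def
      by (intro continuous_on_add continuous_intros) (use X in auto)
    fix x assume x: "x \<in> {0<..<X}"
    have s: "sin (x / 2) > 0" using spos[of x] x b by auto
    have "((\<lambda>x. 2 * ln (sin (x / 2) / x) + p (x / X)) has_real_derivative
        2 * ((cos (x / 2) / 2 * x - sin (x / 2)) / x ^ 2 / (sin (x / 2) / x)) +
        (20 / 3 * (x / X) - 16 / 3 * (x / X) ^ 2 + 2 / 3 * (x / X) ^ 3) * (1 / X)) (at x)"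
      unfolding p_def using s x X
      by (auto intro!: derivative_eq_intros simp: power2_eq_square eval_nat_numeral field_simps)
    also have "2 * ((cos (x / 2) / 2 * x - sin (x / 2)) / x ^ 2 / (sin (x / 2) / x)) +
        (20 / 3 * (x / X) - 16 / 3 * (x / X) ^ 2 + 2 / 3 * (x / X) ^ 3) * (1 / X) = cot (x / 2) - even_kernel (x / X) / X"
    proof -
      have "2 * ((cos (x / 2) / 2 * x - sin (x / 2)) / x ^ 2 / (sin (x / 2) / x)) = cot (x / 2) - 2 / x"
        using s x by (simp add: cot_def field_simps power2_eq_square)
      moreover have "even_kernel (x / X) / X = 2 / x - (20 / 3 * (x / X) - 16 / 3 * (x / X) ^ 2 + 2 / 3 * (x / X) ^ 3) * (1 / X)"
        using X x by (simp add: even_kernel_def add_divide_distrib diff_divide_distrib)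
      ultimately show ?thesis by simp
    qed
    finally have "((\<lambda>x. 2 * ln (sin (x / 2) / x) + p (x / X)) has_real_derivative cot (x / 2) - even_kernel (x / X) / X) (at x)" .
    moreover have "eventually (\<lambda>y. 2 * ln (sin (y / 2) / y) + p (y / X) = G y) (nhds x)"
      using t1_space_nhds[of x 0] x unfolding G_def by (auto elim: eventually_mono)
    ultimately have "(G has_real_derivative cot (x / 2) - even_kernel (x / X) / X) (at x)"
      by (subst (asm) DERIV_cong_ev[OF refl _ refl]) auto
    thus "(G has_vector_derivative cot (x / 2) - even_kernel (x / X) / X) (at x)"
      by (simp add: has_real_derivative_iff_has_vector_derivative)
  qed (use X in auto)
  hence 1: "((\<lambda>x. cot (x / 2) - (if x \<le> X then even_kernel (x / X) / X else 0)) has_integral (G X - G 0)) {0..X}"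
    by (rule has_integral_eq[rotated]) auto
  have "((\<lambda>x. cot (x / 2)) has_integral (2 * ln (sin (b / 2)) - 2 * ln (sin (X / 2)))) {X..b}"
  proof (rule fundamental_theorem_of_calculus[OF b(1)])
    fix x assume x: "x \<in> {X..b}"
    have "sin (x / 2) > 0" using spos[of x] x X by auto
    hence "((\<lambda>x. 2 * ln (sin (x / 2))) has_real_derivative cot (x / 2)) (at x)"
      by (auto intro!: derivative_eq_intros simp: cot_def field_simps)
    thus "((\<lambda>x. 2 * ln (sin (x / 2))) has_vector_derivative cot (x / 2)) (at x within {X..b})"
      by (simp add: has_real_derivative_iff_has_vector_derivative has_vector_derivative_at_within)
  qed
  hence 2: "((\<lambda>x. cot (x / 2) - (if x \<le> X then even_kernel (x / X) / X else 0)) has_integral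
      (2 * ln (sin (b / 2)) - 2 * ln (sin (X / 2)))) {X..b}"
    by (rule has_integral_spike_finite[of "{X}", rotated 2]) auto
  have sb: "sin (b / 2) = sqrt 3 / 2" unfolding b_def using sin_60 by simp
  have "2 * ln (sin (b / 2)) = ln 3 - 2 * ln 2" unfolding sb by (simp add: ln_div ln_sqrt)
  moreover have "G X - G 0 = 2 * ln (sin (X / 2)) - 2 * ln X + 2 * ln 2 + 31 / 18"
    using X spos[of X] b by (simp add: G_def p_def ln_div)
  ultimately have "(G X - G 0) + (2 * ln (sin (b / 2)) - 2 * ln (sin (X / 2))) = ln 3 - 2 * ln X + 31 / 18"
    by simp
  with has_integral_combine[OF _ b(1) 1 2] X show ?thesis by (simp add: b_def)
qed

section \<open>Even characters\<close>

lemma even_L_one_bound: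
  assumes prim: "primitive_character q chi" "q > 1" and even: "chi (-1) = 1" and q: "q = 3 * N"
    and X: "0 < X" "X \<le> 2 * pi / 3"
  shows "norm (dirichlet_L chi 1) \<le> 1 / 3 * (ln 3 - 2 * ln X + 31 / 18) +
     1 / sqrt (real q) * (\<Sum>j<N. even_tail (2 * pi * (3 * real j + 1) / real q / X) + even_tail (2 * pi * (3 * real j + 2) / real q / X))"
proof -
  note chi = primitive_imp_character[OF prim(1)]
  define K where "K = (\<lambda>x. even_kernel (x / X) / X)"
  define P where "P = (\<lambda>t. even_tail (t / X))"
  define r where "r = abel_radius"
  have r: "\<And>k. 0 \<le> r k" "\<And>k. r k < 1" "r \<longlonglongrightarrow> 1"
    using abel_radius by (auto simp: r_def less_imp_le)
  have Xpi: "X < pi" using X pi_gt_zero by linarith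
  have Kb: "0 \<le> K x" "K x \<le> 2 / x" "2 / x - K x \<le> 8 / X" if "0 < x" "x \<le> X" for x
  proof -
    have u: "0 < x / X" "x / X \<le> 1" using that X by auto
    show "0 \<le> K x" unfolding K_def using even_kernel_nonneg[OF u] X by simp
    have "even_kernel (x / X) / X \<le> 2 / (x / X) / X" using even_kernel_le[OF u] X by (intro divide_right_mono) auto
    thus "K x \<le> 2 / x" using X by (simp add: K_def)
    have "(2 / (x / X) - even_kernel (x / X)) / X \<le> 8 / X" using even_kernel_ge[OF u] X by (intro divide_right_mono) auto
    thus "2 / x - K x \<le> 8 / X" using X by (simp add: K_def diff_divide_distrib)
  qed
  hence Kabs: "\<bar>K x\<bar> \<le> 2 / x" if "0 < x" "x \<le> X" for x using that by force
  have Km: "K \<in> borel_measurable borel" unfolding K_def by measurable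
  have Ki: "(K has_integral P t) {t..X}" if t: "0 < t" "t < X" for t
  proof -
    define f where "f = (\<lambda>u::real. - 31 / 18 - 2 * ln u + 10 / 3 * u ^ 2 - 16 / 9 * u ^ 3 + u ^ 4 / 6)"
    have "(K has_integral (- f (X / X) - - f (t / X))) {t..X}"
    proof (rule fundamental_theorem_of_calculus)
      fix x assume x: "x \<in> {t..X}"
      have "((\<lambda>x. f (x / X)) has_real_derivative - even_kernel (x / X) * (1 / X)) (at x)"
      proof (rule DERIV_chain2[of f])
        show "(f has_real_derivative - even_kernel (x / X)) (at (x / X))"
          unfolding f_def by (rule DERIV_even_tail) (use x t X in auto)
      qed (use X in \<open>auto intro!: derivative_eq_intros\<close>)
      from DERIV_minus[OF this] have "((\<lambda>x. - f (x / X)) has_real_derivative K x) (at x)" by (simp add: K_def)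
      thus "((\<lambda>x. - f (x / X)) has_vector_derivative K x) (at x within {t..X})"
        by (simp add: has_real_derivative_iff_has_vector_derivative has_vector_derivative_at_within)
    qed (use t in auto)
    moreover have "- f (X / X) - - f (t / X) = P t"
      using X t by (simp add: f_def P_def even_tail_def)
    ultimately show ?thesis by (simp only:)
  qed
  have P0: "P t = 0" if "t \<ge> X" for t using that X by (simp add: P_def even_tail_def)
  \<comment> \<open>Normalised by \<open>pi\<close>, the sine transform of
    \<open>cot (x / 2)\<close> at every positive \<open>n\<close>.\<close>
  define F where "F = (\<lambda>n. 1 / pi * integral {0..X} (\<lambda>x. K x * sin (real n * x)))"
  define g where "g = (\<lambda>n. 1 - F n)"
  have Fint: "((\<lambda>x. K x * sin (real n * x)) has_integral pi * F n) {0..X}" if "n > 0" for n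
  proof -
    have hi: "((\<lambda>x. K x * sin (real n * x)) has_integral even_kernel_transform (real n * X)) {0..X}"
      unfolding K_def by (rule integral_even_kernel_sin[OF X(1) that])
    hence "pi * F n = even_kernel_transform (real n * X)" unfolding F_def integral_unique[OF hi] by simp
    thus ?thesis using hi by (simp only:)
  qed
  have g0: "0 \<le> g n" if "n > 0" for n
  proof -
    have "integral {0..X} (\<lambda>x. K x * sin (real n * x)) = even_kernel_transform (real n * X)"
      unfolding K_def by (rule integral_unique[OF integral_even_kernel_sin[OF X(1) that]])
    also have "\<dots> \<le> pi" using X that by (intro even_kernel_transform_le_pi) auto
    finally show ?thesis by (simp add: g_def F_def)
  qed
  \<comment> \<open>With this normalisation \<open>pi * g n\<close> is the sine transform over
    \<open>[0, pi]\<close> of \<open>kap\<close>, which is bounded because the \<open>2 / x\<close>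
    singularities cancel.\<close>
  define kap where "kap = (\<lambda>x. cot (x / 2) - (if x \<le> X then K x else 0))"
  define B where "B = 2 + 8 / X"
  have B: "B \<ge> 2" "2 / X \<le> B" "8 / X \<le> B" using X by (auto simp: B_def field_simps)
  have kapb: "\<bar>kap x\<bar> \<le> B" if x: "x \<in> {0..pi}" for x
  proof (cases "x = 0")
    case True
    thus ?thesis using B X by (simp add: kap_def K_def even_kernel_def cot_def)
  next
    case False
    note cb = cot_half_bounds[of x]
    show ?thesis
    proof (cases "x \<le> X")
      case True
      have "kap x = (2 / x - K x) - (2 / x - cot (x / 2))" using True by (simp add: kap_def)
      moreover have "0 \<le> 2 / x - K x" "2 / x - K x \<le> 8 / X" using Kb[of x] True False x by auto
      moreover have "0 \<le> 2 / x - cot (x / 2)" "2 / x - cot (x / 2) \<le> 2" using cb False x by auto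
      ultimately show ?thesis using B by linarith
    next
      case F2: False
      have "2 / x \<le> 2 / X" using F2 X by (intro divide_left_mono) auto
      moreover have "0 \<le> cot (x / 2)" "cot (x / 2) \<le> 2 / x" using cb False x by auto
      ultimately show ?thesis using F2 B by (simp add: kap_def)
    qed
  qed
  have kapm: "kap \<in> borel_measurable borel" unfolding kap_def cot_def using Km by measurable
  have kap_int: "((\<lambda>x. kap x * sin (real n * x)) has_integral pi * g n) {0..pi}" if n: "n > 0" for n
  proof -
    have 1: "((\<lambda>x. (if x \<le> X then K x else 0) * sin (real n * x)) has_integral pi * F n) {0..X}"
      by (rule has_integral_eq[OF _ Fint[OF n]]) auto
    have 2: "((\<lambda>x. (if x \<le> X then K x else 0) * sin (real n * x)) has_integral 0) {X..pi}"
      by (rule has_integral_spike_finite[of "{X}" _ _ "\<lambda>_. 0"]) auto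
    have "((\<lambda>x. (if x \<le> X then K x else 0) * sin (real n * x)) has_integral pi * F n) {0..pi}"
      using has_integral_combine[OF _ _ 1 2] X Xpi by simp
    hence "((\<lambda>x. cot (x / 2) * sin (real n * x) - (if x \<le> X then K x else 0) * sin (real n * x)) has_integral pi - pi * F n) {0..pi}"
      using has_integral_cot_sin[of n] n by (intro has_integral_diff) auto
    thus ?thesis by (simp add: kap_def g_def left_diff_distrib right_diff_distrib)
  qed
  \<comment> \<open>Closed form of the Abel mean of the sine series over \<open>n\<close> prime to
    3. It is bounded by \<open>pi\<close> for all radii, which permits the limit under the
    integral.\<close>
  define W where "W = (\<lambda>r x. abel_sin r x - abel_sin (r ^ 3) (3 * x) / 3)"
  have Wb: "\<bar>W s x\<bar> \<le> pi" for s x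
    using abs_abel_sin_le[of s x] abs_abel_sin_le[of "s ^ 3" "3 * x"] pi_gt_zero unfolding W_def by argo
  have Wm: "W s \<in> borel_measurable borel" for s unfolding W_def by measurable
  have S: "(\<lambda>n. coprime3 n * (r k ^ n / real n * g n)) sums (1 / pi * integral {0..pi} (\<lambda>x. kap x * W (r k) x))" for k
  proof -
    have b: "\<bar>kap x * (coprime3 n * (r k ^ n * sin (real n * x) / real n))\<bar> \<le> B * r k ^ n" if "x \<in> {0..pi}" for x n
    proof -
      have "\<bar>coprime3 n * (r k ^ n * sin (real n * x) / real n)\<bar> \<le> r k ^ n"
      proof (cases "n = 0")
        case False
        have "\<bar>r k ^ n\<bar> * \<bar>sin (real n * x)\<bar> \<le> r k ^ n * 1" using r(1)[of k] by (intro mult_mono) auto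
        hence "\<bar>r k ^ n * sin (real n * x) / real n\<bar> \<le> r k ^ n * 1 / 1"
          unfolding abs_mult abs_divide using r(1)[of k] False by (intro frac_le) auto
        thus ?thesis using r(1)[of k] by (auto simp: coprime3_def)
      qed (use r in auto)
      thus ?thesis unfolding abs_mult[of "kap x"] using kapb[OF that] B by (intro mult_mono) auto
    qed
    have i: "(\<lambda>x. kap x * (coprime3 n * (r k ^ n * sin (real n * x) / real n))) integrable_on {0..pi}" for n
      by (rule bounded_measurable_integrable_on[OF _ b]) (use kapm in measurable)
    have s: "(\<lambda>n. kap x * (coprime3 n * (r k ^ n * sin (real n * x) / real n))) sums (kap x * W (r k) x)" for x
      unfolding W_def by (intro sums_mult abel_coprime3_sin r)
    have "(\<lambda>n. 1 / pi * integral {0..pi} (\<lambda>x. kap x * (coprime3 n * (r k ^ n * sin (real n * x) / real n)))) sums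
        (1 / pi * integral {0..pi} (\<lambda>x. kap x * W (r k) x))"
      by (rule sums_mult[OF sums_integral_exchange(2)[OF i b summable_const_geometric[OF r(1,2)] s]])
    moreover have "1 / pi * integral {0..pi} (\<lambda>x. kap x * (coprime3 n * (r k ^ n * sin (real n * x) / real n))) =
        coprime3 n * (r k ^ n / real n * g n)" for n
    proof (cases "n = 0")
      case False
      have "((\<lambda>x. coprime3 n * r k ^ n / real n * (kap x * sin (real n * x))) has_integral
          coprime3 n * r k ^ n / real n * (pi * g n)) {0..pi}"
        using False by (intro has_integral_mult_right kap_int) auto
      moreover have "(\<lambda>x. coprime3 n * r k ^ n / real n * (kap x * sin (real n * x))) =
          (\<lambda>x. kap x * (coprime3 n * (r k ^ n * sin (real n * x) / real n)))" by (simp add: mult_ac)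
      ultimately have "integral {0..pi} (\<lambda>x. kap x * (coprime3 n * (r k ^ n * sin (real n * x) / real n))) =
          coprime3 n * r k ^ n / real n * (pi * g n)" by (intro integral_unique) (simp only:)
      thus ?thesis by (simp only:) simp
    qed simp
    ultimately show ?thesis by (simp only:)
  qed
  have lim1: "(\<lambda>k. 1 / pi * integral {0..pi} (\<lambda>x. kap x * W (r k) x)) \<longlonglongrightarrow> 1 / pi * integral {0..pi} (\<lambda>x. kap x * W 1 x)"
  proof (rule tendsto_mult_left, rule dominated_convergence(2)[where h = "\<lambda>_. B * pi"])
    have bd: "\<bar>kap x * W (r k) x\<bar> \<le> B * pi" if "x \<in> {0..pi}" for x k
      unfolding abs_mult using kapb[OF that] Wb[of "r k" x] B by (intro mult_mono) auto
    show "(\<lambda>x. kap x * W (r k) x) integrable_on {0..pi}" for k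
      by (rule bounded_measurable_integrable_on[OF _ bd]) (use kapm Wm in measurable)
    show "norm (kap x * W (r k) x) \<le> B * pi" if "x \<in> {0..pi}" for x k using bd[OF that] by simp
    have r3: "(\<lambda>k. r k ^ 3) \<longlonglongrightarrow> 1" using tendsto_power[OF r(3), of 3] by simp
    show "(\<lambda>k. kap x * W (r k) x) \<longlonglongrightarrow> kap x * W 1 x" for x
      unfolding W_def power_one by (intro tendsto_intros abel_sin_tendsto r r3) auto
  qed auto
  \<comment> \<open>At radius 1 the function \<open>W\<close> is a step: \<open>pi / 3\<close>
    before \<open>2 * pi / 3\<close> and 0 after it, so the integral of \<open>kap\<close> over the
    first part remains.\<close>
  have lim_val: "1 / pi * integral {0..pi} (\<lambda>x. kap x * W 1 x) = 1 / 3 * (ln 3 - 2 * ln X + 31 / 18)"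
  proof -
    have 1: "((\<lambda>x. kap x * W 1 x) has_integral (ln 3 - 2 * ln X + 31 / 18) * (pi / 3)) {0..2 * pi / 3}"
    proof (rule has_integral_spike_finite[of "{0, 2 * pi / 3}"])
      show "((\<lambda>x. kap x * (pi / 3)) has_integral (ln 3 - 2 * ln X + 31 / 18) * (pi / 3)) {0..2 * pi / 3}"
        unfolding kap_def K_def by (intro has_integral_mult_left integral_cot_minus_even_kernel X)
      fix x assume x: "x \<in> {0..2 * pi / 3} - {0, 2 * pi / 3}"
      hence "abel_sin 1 x = (pi - x) / 2" "abel_sin 1 (3 * x) = (pi - 3 * x) / 2"
        by (intro abel_sin_1; auto)+
      hence "W 1 x = pi / 3" by (simp add: W_def field_simps)
      thus "kap x * W 1 x = kap x * (pi / 3)" by simp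
    qed auto
    have 2: "((\<lambda>x. kap x * W 1 x) has_integral 0) {2 * pi / 3..pi}"
    proof (rule has_integral_spike_finite[of "{2 * pi / 3}" _ _ "\<lambda>_. 0"])
      fix x assume x: "x \<in> {2 * pi / 3..pi} - {2 * pi / 3}"
      hence "abel_sin 1 x = (pi - x) / 2" "abel_sin 1 (3 * x) = (3 * pi - 3 * x) / 2"
        by (intro abel_sin_1 abel_sin_1_shift; auto)+
      hence "W 1 x = 0" by (simp add: W_def field_simps)
      thus "kap x * W 1 x = 0" by simp
    qed auto
    have "((\<lambda>x. kap x * W 1 x) has_integral ((ln 3 - 2 * ln X + 31 / 18) * (pi / 3) + 0)) {0..pi}"
      by (rule has_integral_combine[OF _ _ 1 2]) auto
    thus ?thesis by (simp add: integral_unique)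
  qed
  define th where "th = (\<lambda>a::int. 2 * pi * of_int a / real q)"
  have th: "0 < th a" "th a < 2 * pi" if "a \<in> {1..<int q}" for a
  proof -
    show "0 < th a" using that prim(2) by (simp add: th_def)
    have "of_int a < real q" using that by (simp add: of_int_less_iff[symmetric, where 'a = real] del: of_int_less_iff)
    thus "th a < 2 * pi" using prim(2) by (simp add: th_def field_simps)
  qed
  \<comment> \<open>The contribution of the sawtooth drift, the same for all residues.\<close>
  define c0 where "c0 = integral {0..X} (\<lambda>x. K x * x) / 2"
  define M where "M = 1 / gauss_sum q chi 1 * (\<Sum>a\<in>{1..<int q}. cnj (chi a) * of_real (1 / pi * (pi / 2 * (P (th a) + P (2 * pi - th a)) - c0)))"
  have tau: "norm (gauss_sum q chi 1) = sqrt (real q)" by (rule norm_gauss_sum[OF prim(1)])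
  hence tau0: "gauss_sum q chi 1 \<noteq> 0" using prim(2) by auto
  have summ: "(\<lambda>n. r k ^ n * cos (real n * t) / real n * F n) sums
      (1 / pi * integral {0..X} (\<lambda>x. K x * ((abel_sin (r k) (x + t) + abel_sin (r k) (x - t)) / 2)))" for k t
    using sums_mult[OF abel_sine_transform[OF r(1,2) Km Kabs X(1), of k t], of "1 / pi"]
    unfolding F_def by (simp add: mult_ac)
  have lim: "(\<lambda>k. \<Sum>n. r k ^ n * cos (real n * th a) / real n * F n) \<longlonglongrightarrow> 1 / pi * (pi / 2 * (P (th a) + P (2 * pi - th a)) - c0)"
    if "a \<in> {1..<int q}" for a
  proof -
    have "integral {0..X} (\<lambda>x. K x * ((abel_sin 1 (x + th a) + abel_sin 1 (x - th a)) / 2)) =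
        pi / 2 * (P (th a) + P (2 * pi - th a)) - c0"
      unfolding c0_def by (rule integral_sine_step[OF Km Kabs Ki P0 X(1) Xpi th[OF that]])
    with tendsto_mult_left[OF abel_sine_transform_limit[OF r Km Kabs X(1) th[OF that]], of "1 / pi"]
    have "(\<lambda>k. 1 / pi * (\<Sum>n. r k ^ n * cos (real n * th a) / real n * integral {0..X} (\<lambda>x. K x * sin (real n * x))))
        \<longlonglongrightarrow> 1 / pi * (pi / 2 * (P (th a) + P (2 * pi - th a)) - c0)" by (simp only:)
    moreover have "1 / pi * (\<Sum>n. r k ^ n * cos (real n * th a) / real n * integral {0..X} (\<lambda>x. K x * sin (real n * x))) =
        (\<Sum>n. r k ^ n * cos (real n * th a) / real n * F n)" for k
      using sums_unique[OF summ[of k "th a"]] sums_unique[OF abel_sine_transform[OF r(1,2) Km Kabs X(1), of k "th a"]]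
      by (simp only:)
    ultimately show ?thesis by (simp only:)
  qed
  have "chi (int n) * gauss_sum q chi 1 = 1 * (\<Sum>a\<in>{1..<int q}. cnj (chi a) * of_real (cos (real n * th a)))" for n
    unfolding th_def using gauss_expansion_even[OF prim even] by simp
  note csl = character_series_limit[OF tau0 this, of r F]
  have F: "F n = 1 - g n" for n by (simp add: g_def)
  have "norm (dirichlet_L chi 1) \<le> 1 / 3 * (ln 3 - 2 * ln X + 31 / 18) + norm M"
  proof (rule L_one_bound[OF prim r g0 norm_character_le_coprime3[OF chi] S order_refl lim1[unfolded lim_val]])
    show "summable (\<lambda>n. chi (int n) * of_real (r k ^ n / real n * (1 - g n)))" for k
      unfolding F[symmetric] by (rule sums_summable[OF csl(1)[OF sums_summable[OF summ] lim]])
    show "(\<lambda>k. \<Sum>n. chi (int n) * of_real (r k ^ n / real n * (1 - g n))) \<longlonglongrightarrow> M"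
      unfolding F[symmetric] M_def by (rule csl(2)[OF sums_summable[OF summ] lim])
  qed (use q in auto)
  moreover have "norm M \<le> 1 / sqrt (real q) * (\<Sum>j<N. even_tail (2 * pi * (3 * real j + 1) / real q / X) + even_tail (2 * pi * (3 * real j + 2) / real q / X))"
  proof -
    have chi0: "chi 0 = 0" using dirichlet_characterD(4)[OF chi, of 0] prim(2) by simp
    have "{0..<int q} = insert 0 {1..<int q}" using prim(2) by auto
    hence "(\<Sum>a\<in>{1..<int q}. chi a) = 0" using sum_character_eq_0[OF prim] chi0 by simp
    \<comment> \<open>This removes \<open>c0\<close> from \<open>M\<close>.\<close>
    hence z: "(\<Sum>a\<in>{1..<int q}. cnj (chi a)) = 0" by (metis cnj_sum complex_cnj_zero)
    have Pn: "0 \<le> P t" if "t > 0" for t using that X by (auto simp: P_def intro!: even_tail_nonneg)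
    have "norm (\<Sum>a\<in>{1..<int q}. cnj (chi a) * of_real (P (th a) + P (2 * pi - th a))) \<le>
      2 * (\<Sum>j<N. P (2 * pi * (3 * real j + 1) / real q) + P (2 * pi * (3 * real j + 2) / real q))"
    proof (rule norm_character_symmetric_sum_le[OF prim q _ Pn])
      fix a assume "a \<in> {1..<int q}"
      hence "0 \<le> P (th a) + P (2 * pi - th a)" using th[of a] by (intro add_nonneg_nonneg Pn) auto
      thus "norm (complex_of_real (P (th a) + P (2 * pi - th a))) \<le>
          P (2 * pi * of_int a / real q) + P (2 * pi - 2 * pi * of_int a / real q)"
        unfolding norm_of_real by (simp add: th_def)
    qed
    moreover have "M = 1 / (2 * gauss_sum q chi 1) *
        (\<Sum>a\<in>{1..<int q}. cnj (chi a) * of_real (P (th a) + P (2 * pi - th a)))"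
    proof -
      have "(\<Sum>a\<in>{1..<int q}. cnj (chi a) * of_real (1 / pi * (pi / 2 * (P (th a) + P (2 * pi - th a)) - c0))) =
        (\<Sum>a\<in>{1..<int q}. 1 / 2 * (cnj (chi a) * of_real (P (th a) + P (2 * pi - th a))) - of_real (c0 / pi) * cnj (chi a))"
        by (intro sum.cong refl) (simp add: field_simps)
      also have "\<dots> = 1 / 2 * (\<Sum>a\<in>{1..<int q}. cnj (chi a) * of_real (P (th a) + P (2 * pi - th a)))"
        by (simp only: sum_subtractf sum_distrib_left[symmetric] z) simp
      finally have e: "(\<Sum>a\<in>{1..<int q}. cnj (chi a) * of_real (1 / pi * (pi / 2 * (P (th a) + P (2 * pi - th a)) - c0))) =
        1 / 2 * (\<Sum>a\<in>{1..<int q}. cnj (chi a) * of_real (P (th a) + P (2 * pi - th a)))" .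
      show ?thesis unfolding M_def e by simp
    qed
    ultimately show ?thesis using prim(2) by (simp add: norm_mult norm_divide tau field_simps P_def)
  qed
  ultimately show ?thesis by simp
qed

text \<open>The units modulo 3 are 1 and -1, so an even character is trivial on them and induced
  from modulus 1.\<close>

lemma conductor_3_not_even:
  assumes "primitive_character q chi" "chi (-1) = 1"
  shows "q \<noteq> 3"
proof
  assume q: "q = 3"
  have chi: "dirichlet_character q chi" by (rule primitive_imp_character[OF assms(1)])
  have "induced_modulus q chi 1" unfolding induced_modulus_def
  proof (intro conjI allI impI)
    fix a assume a: "coprime a (int q) \<and> [a = 1] (mod int 1)"
    hence "\<not> 3 dvd a" using q by (auto dest: coprime_common_divisor[of _ _ 3])
    hence "a mod 3 = 1 \<or> a mod 3 = (-1) mod 3" by presburger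
    hence "[a = 1] (mod int q) \<or> [a = -1] (mod int q)" using q by (simp add: cong_def)
    thus "chi a = 1" using character_cong[OF chi] character_one[OF chi] assms(2) by metis
  qed (use q in auto)
  thus False using primitive_not_induced[OF assms(1), of 1] q by simp
qed

text \<open>\<open>157 / 300\<close> is \<open>3.14 / 6\<close>, and the Taylor estimate puts its
  sine below \<open>1 / 2 = sin (pi / 6)\<close>.\<close>

lemma pi_gt_314: "pi > 3.14"
proof (rule ccontr)
  assume "\<not> pi > 3.14"
  hence "pi / 6 \<le> 157 / 300" by simp
  hence "sin (pi / 6) \<le> sin (157 / 300)" using pi_gt3 by (intro sin_monotone_2pi_le) auto
  hence "1 / 2 \<le> sin (157 / 300 :: real)" by (simp add: sin_30)
  moreover have "\<bar>sin (157 / 300 :: real) - (157 / 300 - (157 / 300) ^ 3 / 6)\<bar> \<le> (157 / 300) ^ 5 / 120"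
    using Maclaurin_sin_bound[of "157 / 300 :: real" 5] by (simp add: sin_coeff_Suc cos_coeff_Suc eval_nat_numeral)
  ultimately show False by (simp add: eval_nat_numeral abs_le_iff)
qed

text \<open>The left side is the logarithm of \<open>(2 * pi)^2 / 3\<close>, which exceeds
  \<open>13.146 = 12 * 2191 / 2000\<close>; splitting off 12 reuses \<open>ln_12_ge\<close>.\<close>

lemma two_ln_two_pi_ge: "2 * ln (2 * pi) - ln 3 \<ge> 103 / 40"
proof -
  have "3.14\<^sup>2 \<le> pi\<^sup>2" using pi_gt_314 by (intro power_mono) auto
  hence "12 * (2191 / 2000) \<le> (2 * pi)\<^sup>2 / 3" by (simp add: power_mult_distrib power2_eq_square)
  hence "ln (12 * (2191 / 2000)) \<le> ln ((2 * pi)\<^sup>2 / 3)" by (subst ln_le_cancel_iff) auto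
  moreover have "ln ((2 * pi)\<^sup>2 / 3) = 2 * ln (2 * pi) - ln 3"
    using ln_div[of "(2 * pi)\<^sup>2" 3] ln_realpow[of "2 * pi" 2] by simp
  moreover have "ln (12 * (2191 / 2000)) = ln 12 + ln (2191 / 2000 :: real)"
    using ln_mult[of 12 "2191 / 2000 :: real"] by simp
  moreover have "ln (2191 / 2000 :: real) \<ge> 911 / 10000"
    using ln_approx_bounds[of "2191 / 2000" 1] by (simp add: eval_nat_numeral)
  ultimately show ?thesis using ln_12_ge by linarith
qed

lemma even_character_bound:
  assumes prim: "primitive_character q chi" and q3: "3 dvd q" and even: "chi (-1) = 1"
  shows "norm (dirichlet_L chi 1) \<le> 1 / 3 * ln (real q) + 0.368296"
proof -
  obtain N where q: "q = 3 * N" using q3 by auto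
  have "q > 0" using dirichlet_characterD(1)[OF primitive_imp_character[OF prim]] .
  hence q9: "q \<ge> 9" using conductor_6_impossible[OF prim] conductor_3_not_even[OF prim even] q by presburger
  define s where "s = sqrt (real q)"
  have s: "s \<ge> 3" "s > 0" "s\<^sup>2 = real q" using q9 real_le_rsqrt[of 3 "real q"] by (auto simp: s_def)
  \<comment> \<open>This makes the residue cut-off equal to \<open>s\<close>, and at
    \<open>q = 9\<close> it just meets the restriction \<open>X <= 2 * pi / 3\<close>. The exact
    minimiser of the bound would be \<open>45 / 44\<close> of this value, a gain below
    0.0002.\<close>
  define X where "X = 2 * pi / s"
  have X: "0 < X" "X \<le> 2 * pi / 3" using s divide_left_mono[of 3 s "2 * pi"] by (auto simp: X_def)
  have tX: "2 * pi * y / real q / X = y / s" for y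
    unfolding X_def s(3)[symmetric] using s(2) by (simp add: field_simps power2_eq_square)
  have "s * 1 \<le> s * s" using s by (intro mult_left_mono) auto
  hence "s \<le> real q" using s(3) unfolding power2_eq_square by linarith
  hence s1: "s \<le> 3 * real N" using q by simp
  have "norm (dirichlet_L chi 1) \<le> 1 / 3 * (ln 3 - 2 * ln X + 31 / 18) + 1 / s * (88 / 135 * s)"
  proof -
    have "norm (dirichlet_L chi 1) \<le> 1 / 3 * (ln 3 - 2 * ln X + 31 / 18) +
        1 / s * (\<Sum>j<N. even_tail ((3 * real j + 1) / s) + even_tail ((3 * real j + 2) / s))"
      using even_L_one_bound[OF prim _ even q X] q9 unfolding tX s_def[symmetric] by simp
    also have "\<dots> \<le> 1 / 3 * (ln 3 - 2 * ln X + 31 / 18) + 1 / s * (88 / 135 * s)"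
      using sum_even_tail_le[OF s(2) s1] s(2) by (intro add_left_mono mult_left_mono) auto
    finally show ?thesis .
  qed
  also have "1 / s * (88 / 135 * s) = 88 / 135" using s by simp
  also have "ln X = ln (2 * pi) - 1 / 2 * ln (real q)"
    using s pi_gt_zero ln_div[of "2 * pi" s] by (simp add: X_def s_def ln_sqrt)
  also have "1 / 3 * (ln 3 - 2 * (ln (2 * pi) - 1 / 2 * ln (real q)) + 31 / 18) + 88 / 135 =
      1 / 3 * ln (real q) + (331 / 270 - (2 * ln (2 * pi) - ln 3) / 3)"
    by (simp add: field_simps)
  also have "331 / 270 - (2 * ln (2 * pi) - ln 3) / 3 \<le> (0.368296 :: real)"
    using two_ln_two_pi_ge by (simp add: field_simps)
  finally show ?thesis by simp
qed

theorem theorem1p1: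
  fixes q :: nat and chi :: "int \<Rightarrow> complex"
  assumes "primitive_character q chi"
    and "3 dvd q"
  shows "(chi (-1) = 1 \<longrightarrow> cmod (dirichlet_L chi 1) \<le> 1 / 3 * ln (real q) + 0.368296) \<and>
         (chi (-1) = -1 \<longrightarrow> cmod (dirichlet_L chi 1) \<le> 1 / 3 * ln (real q) + 0.838374)"
  using even_character_bound[OF assms] odd_character_bound[OF assms] by blast

end
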